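(* There exist a regular local ring $(R,\mathfrak m)$ of dimension $d$ whose maximal ideal $\mathfrak m$ is generated by a regular system of parameters $\underline{x}=x_1,\dots,x_d$, and a finitely generated $R$-module $M$ with $\dim M = d$, such that the function $$J_{\underline{x},M}(n) = n^d e(\underline{x};M) - \ell\big(M/(\underline{x}^{[n]})^{\lim}_M\big),\qquad n\ge 1,$$ cannot be represented by finitely many polynomials in $n$; that is, there are no finitely many polynomials $P_1,\dots,P_r$ such that for every $n\ge 1$ one has $J_{\underline{x},M}(n) = P_i(n)$ for some $i$.
   Context: $\underline{x}^{[n]} = x_1^n,\dots,x_d^n$; $e$ is the Serre multiplicity, $\ell$ length, and for a system of parameters $\underline{y}$ of $M$, $(\underline{y})^{\lim}_M = \bigcup_{k>0}\big((y_1^{k+1},\dots,y_d^{k+1})M :_M (y_1\cdots y_d)^k\big)$ is the limit closure. *)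

theory Defs
  imports "HOL-Algebra.Module" "HOL-Algebra.Ideal_Product" "HOL-Algebra.Ring_Divisibility"
          "HOL-Library.Extended_Nat" "HOL-Computational_Algebra.Polynomial"
begin

definition local_ring :: "('a, 'b) ring_scheme \<Rightarrow> 'a set \<Rightarrow> bool" where
  "local_ring R m \<longleftrightarrow> cring R \<and> maximalideal m R \<and> (\<forall>I. maximalideal I R \<longrightarrow> I = m)"

definition noetherian_local_ring :: "('a, 'b) ring_scheme \<Rightarrow> 'a set \<Rightarrow> bool" where
  "noetherian_local_ring R m \<longleftrightarrow> noetherian_ring R \<and> local_ring R m"

definition prime_chain :: "('a, 'b) ring_scheme \<Rightarrow> (nat \<Rightarrow> 'a set) \<Rightarrow> nat \<Rightarrow> bool" where
  "prime_chain R P n \<longleftrightarrow> (\<forall>i\<le>n. primeideal (P i) R) \<and> (\<forall>i<n. P i \<subset> P (Suc i))"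

definition krull_dim :: "('a, 'b) ring_scheme \<Rightarrow> enat" where
  "krull_dim R = Sup {enat n | n P. prime_chain R P n}"

definition ann :: "('a, 'c) ring_scheme \<Rightarrow> ('a, 'b, 'd) module_scheme \<Rightarrow> 'a set" where
  "ann R M = {a \<in> carrier R. \<forall>u \<in> carrier M. a \<odot>\<^bsub>M\<^esub> u = \<zero>\<^bsub>M\<^esub>}"

text \<open>Krull dimension of a (finitely generated) module: dim (R / ann M), i.e. the supremum of
  lengths of chains of primes in Supp M = V(ann M).\<close>
definition module_dim :: "('a, 'c) ring_scheme \<Rightarrow> ('a, 'b, 'd) module_scheme \<Rightarrow> enat" where
  "module_dim R M = Sup {enat n | n P. prime_chain R P n \<and> ann R M \<subseteq> P 0}"

definition span :: "('a, 'c) ring_scheme \<Rightarrow> ('a, 'b, 'd) module_scheme \<Rightarrow> 'b set \<Rightarrow> 'b set" where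
  "span R M S = \<Inter> {H. submodule H R M \<and> S \<subseteq> H}"

definition finitely_generated :: "('a, 'c) ring_scheme \<Rightarrow> ('a, 'b, 'd) module_scheme \<Rightarrow> bool" where
  "finitely_generated R M \<longleftrightarrow> (\<exists>S. finite S \<and> S \<subseteq> carrier M \<and> span R M S = carrier M)"

definition ideal_mod :: "('a, 'c) ring_scheme \<Rightarrow> ('a, 'b, 'd) module_scheme \<Rightarrow> 'a set \<Rightarrow> 'b set" where
  "ideal_mod R M I = span R M {a \<odot>\<^bsub>M\<^esub> u | a u. a \<in> I \<and> u \<in> carrier M}"

fun ideal_pow :: "('a, 'c) ring_scheme \<Rightarrow> 'a set \<Rightarrow> nat \<Rightarrow> 'a set" where
  "ideal_pow R I 0 = carrier R"
| "ideal_pow R I (Suc n) = ideal_prod R I (ideal_pow R I n)"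

definition quot_length :: "('a, 'c) ring_scheme \<Rightarrow> ('a, 'b, 'd) module_scheme \<Rightarrow> 'b set \<Rightarrow> enat" where
  "quot_length R M N = Sup {enat n | n C. (\<forall>i\<le>n. submodule (C i) R M) \<and> C 0 = N \<and>
       C n = carrier M \<and> (\<forall>i<n. C i \<subset> C (Suc i))}"

definition multiplicity :: "('a, 'c) ring_scheme \<Rightarrow> ('a, 'b, 'd) module_scheme \<Rightarrow> nat \<Rightarrow> (nat \<Rightarrow> 'a) \<Rightarrow> real" where
  "multiplicity R M d x = lim (\<lambda>n. real (fact d) *
      real (the_enat (quot_length R M (ideal_mod R M (ideal_pow R (genideal R (x ` {..<d})) n))))
      / real n ^ d)"

definition lim_closure :: "('a, 'c) ring_scheme \<Rightarrow> ('a, 'b, 'd) module_scheme \<Rightarrow> nat \<Rightarrow> (nat \<Rightarrow> 'a) \<Rightarrow> 'b set" where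
  "lim_closure R M d y = (\<Union>k\<in>{0<..}. {u \<in> carrier M.
      ((finprod R y {..<d}) [^]\<^bsub>R\<^esub> (k::nat)) \<odot>\<^bsub>M\<^esub> u \<in>
        span R M {(y i [^]\<^bsub>R\<^esub> (k + 1)) \<odot>\<^bsub>M\<^esub> v | i v. i < d \<and> v \<in> carrier M}})"

definition J_fun :: "('a, 'c) ring_scheme \<Rightarrow> ('a, 'b, 'd) module_scheme \<Rightarrow> nat \<Rightarrow> (nat \<Rightarrow> 'a) \<Rightarrow> nat \<Rightarrow> real" where
  "J_fun R M d x n = real n ^ d * multiplicity R M d x
      - real (the_enat (quot_length R M (lim_closure R M d (\<lambda>i. x i [^]\<^bsub>R\<^esub> n))))"

end

theory Submission
  imports Defs "HOL-Library.Z2" "HOL-Computational_Algebra.Fraction_Field" "HOL-Library.Countable"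
begin

text \<open>Let \<open>k\<close> be the field with two elements, let \<open>R\<close> be the localization of
  \<open>k[x, y, t, w]\<close> at the origin with the regular system of parameters \<open>x, y, z = x + y + t, w\<close>, and
  let \<open>M\<close> be the ideal \<open>(t, w)\<close>. Since \<open>M\<close> has height two, the limit closure of the \<open>n\<close>-th powers
  in \<open>M\<close> is \<open>M \<inter> (x\<^sup>n, y\<^sup>n, z\<^sup>n, w\<^sup>n)\<close>, so its colength is \<open>n\<^sup>4\<close> minus the colength \<open>D(n)\<close> of
  \<open>(x\<^sup>n, y\<^sup>n, (x + y)\<^sup>n)\<close> in \<open>k[x, y]\<close>. For \<open>n = (2\<^sup>e - 1) q\<close> with \<open>q\<close> a power of two, the colon ideal of
  \<open>(x\<^sup>n, y\<^sup>n)\<close> by \<open>(x + y)\<^sup>n\<close> is \<open>(x\<^bsup>n-q\<^esup>, x\<^sup>q + y\<^sup>q)\<close>, hence \<open>D(n) = n\<^sup>2 - (n - q) q\<close>. For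
  fixed \<open>e\<close> this is a multiple of \<open>n\<^sup>2\<close>, and the factors for different \<open>e\<close> are pairwise
  distinct, so no finite set of polynomials suffices; the value of the multiplicity is irrelevant.

  Lengths are computed as base-two logarithms of numbers of cosets. The dimension of \<open>R\<close> is
  bounded by counting residue classes: if \<open>Q \<subset> Q'\<close> are primes of the polynomial ring and
  \<open>f \<in> Q' - Q\<close> has degree at most \<open>c\<close>, then multiplication by \<open>f\<close> shows that the classes mod \<open>Q\<close>
  of polynomials of degree at most \<open>n + c\<close> are at least as many as the classes mod \<open>Q'\<close> in degree at
  most \<open>n + c\<close> times the classes mod \<open>Q\<close> in degree at most \<open>n\<close>. So each step of a chain of primes lowers
  the order of growth of the logarithm by one.\<close>

subsection \<open>Transversals of additive subgroups\<close>

definition add_subgroup :: "'a::ab_group_add set \<Rightarrow> bool" where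
  "add_subgroup V \<longleftrightarrow> 0 \<in> V \<and> (\<forall>a\<in>V. \<forall>b\<in>V. a - b \<in> V)"

lemma add_subgroupD:
  assumes "add_subgroup V"
  shows "0 \<in> V" "a \<in> V \<Longrightarrow> b \<in> V \<Longrightarrow> a - b \<in> V" "a \<in> V \<Longrightarrow> - a \<in> V"
    "a \<in> V \<Longrightarrow> b \<in> V \<Longrightarrow> a + b \<in> V"
proof -
  show z: "0 \<in> V" and d: "\<And>a b. a \<in> V \<Longrightarrow> b \<in> V \<Longrightarrow> a - b \<in> V"
    using assms by (auto simp: add_subgroup_def)
  show n: "\<And>a. a \<in> V \<Longrightarrow> - a \<in> V" using d[OF z] by simp
  show "a \<in> V \<Longrightarrow> b \<in> V \<Longrightarrow> a + b \<in> V" using d[of a "- b"] n by simp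
qed

text \<open>Representatives of the cosets of \<open>V\<close> that meet \<open>U\<close>. Indices
  are counted through such sets, so no quotient type is formed, and \<open>V\<close> may fail to lie
  inside \<open>U\<close>.\<close>

definition transversal :: "'a::ab_group_add set \<Rightarrow> 'a set \<Rightarrow> 'a set \<Rightarrow> bool" where
  "transversal U V T \<longleftrightarrow> T \<subseteq> U \<and> (\<forall>u\<in>U. \<exists>!t. t \<in> T \<and> u - t \<in> V)"

lemma transversalI:
  assumes "add_subgroup V" "T \<subseteq> U" "\<And>u. u \<in> U \<Longrightarrow> \<exists>t\<in>T. u - t \<in> V"
    "\<And>s t. s \<in> T \<Longrightarrow> t \<in> T \<Longrightarrow> s - t \<in> V \<Longrightarrow> s = t"
  shows "transversal U V T"
  unfolding transversal_def
proof (intro conjI ballI assms(2))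
  fix u assume "u \<in> U"
  then obtain t where t: "t \<in> T" "u - t \<in> V" using assms(3) by blast
  show "\<exists>!t. t \<in> T \<and> u - t \<in> V"
  proof (rule ex1I[of _ t])
    fix s assume "s \<in> T \<and> u - s \<in> V"
    then have "(u - t) - (u - s) \<in> V" using t add_subgroupD[OF assms(1)] by blast
    then show "s = t" using \<open>s \<in> T \<and> u - s \<in> V\<close> t assms(4) by (simp add: algebra_simps)
  qed (use t in auto)
qed

lemma transversalD:
  assumes "transversal U V T"
  shows "T \<subseteq> U" "u \<in> U \<Longrightarrow> \<exists>t\<in>T. u - t \<in> V"
  using assms unfolding transversal_def by auto

lemma transversal_inj:
  assumes "transversal U V T" "add_subgroup V" "s \<in> T" "t \<in> T" "s - t \<in> V"
  shows "s = t"
proof -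
  have "s \<in> U" "s - s \<in> V" using assms add_subgroupD(1)[OF assms(2)] by (auto simp: transversal_def)
  then show ?thesis using assms unfolding transversal_def by blast
qed

lemma transversal_exists:
  assumes V: "add_subgroup V"
  shows "\<exists>T. transversal U V T"
proof -
  define f where "f u = (SOME v. v \<in> U \<and> u - v \<in> V)" for u
  have f: "f u \<in> U \<and> u - f u \<in> V" if "u \<in> U" for u
    unfolding f_def by (rule someI[of _ u]) (use that add_subgroupD(1)[OF V] in auto)
  \<comment> \<open>The predicates under \<open>SOME\<close> for \<open>u\<close> and
    \<open>v\<close> coincide as soon as \<open>u - v\<close> lies in \<open>V\<close>, so the
    choice depends only on the coset.\<close>
  have eq: "f u = f v" if "u - v \<in> V" for u v
  proof -
    have "u - w \<in> V \<longleftrightarrow> v - w \<in> V" for w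
      using add_subgroupD(2)[OF V, of "u - w" "u - v"] add_subgroupD(4)[OF V, of "v - w" "u - v"] that
      by auto
    then show ?thesis by (simp add: f_def)
  qed
  have "transversal U V (f ` U)"
  proof (rule transversalI[OF V])
    fix s t assume "s \<in> f ` U" "t \<in> f ` U" and st: "s - t \<in> V"
    then obtain u v where uv: "s = f u" "t = f v" "u \<in> U" "v \<in> U" by auto
    have "(u - f u) + ((f u - f v) - (v - f v)) \<in> V"
      using f[OF uv(3)] f[OF uv(4)] st uv add_subgroupD[OF V] by blast
    then show "s = t" using eq[of u v] uv by (simp add: algebra_simps)
  qed (use f in auto)
  then show ?thesis by blast
qed

lemma transversal_card_unique:
  assumes "transversal U V T" "transversal U V T'" "add_subgroup V"
  shows "card T = card T'"
proof -
  define f where "f t = (SOME t'. t' \<in> T' \<and> t - t' \<in> V)" for t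
  have f: "f t \<in> T' \<and> t - f t \<in> V" if "t \<in> T" for t
  proof -
    have "\<exists>t'. t' \<in> T' \<and> t - t' \<in> V"
      using that transversalD[OF assms(1)] transversalD(2)[OF assms(2)] by blast
    then show ?thesis unfolding f_def by (rule someI_ex)
  qed
  have "bij_betw f T T'"
  proof (rule bij_betw_imageI)
    show "inj_on f T"
    proof (rule inj_onI)
      fix s t assume st: "s \<in> T" "t \<in> T" "f s = f t"
      then have "(s - f s) - (t - f t) \<in> V" using f add_subgroupD(2)[OF assms(3)] by blast
      then show "s = t" using transversal_inj[OF assms(1,3)] st by simp
    qed
    show "f ` T = T'"
    proof (intro equalityI subsetI)
      fix t' assume t': "t' \<in> T'"
      then obtain t where t: "t \<in> T" "t' - t \<in> V"
        using transversalD[OF assms(2)] transversalD(2)[OF assms(1)] by blast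
      have "(t' - t) + (t - f t) \<in> V" using f[OF t(1)] t add_subgroupD(4)[OF assms(3)] by blast
      then have "t' = f t" using transversal_inj[OF assms(2,3)] t' f[OF t(1)] by simp
      then show "t' \<in> f ` T" using t by blast
    qed (use f in auto)
  qed
  then show ?thesis by (rule bij_betw_same_card)
qed

text \<open>This is multiplicativity of the index: reduction modulo \<open>V\<close> recovers
  \<open>t\<close> from \<open>t + s\<close>, and then reduction modulo \<open>W\<close> recovers
  \<open>s\<close>.\<close>

lemma transversal_trans:
  assumes T: "transversal U V T" and S: "transversal V W S"
    and "add_subgroup U" "add_subgroup V" "add_subgroup W" "V \<subseteq> U" "W \<subseteq> V"
  shows "transversal U W ((\<lambda>(t, s). t + s) ` (T \<times> S))"
    and "card ((\<lambda>(t, s). t + s) ` (T \<times> S)) = card T * card S"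
proof -
  have key: "t = t' \<and> s = s'"
    if "t \<in> T" "t' \<in> T" "s \<in> S" "s' \<in> S" "(t + s) - (t' + s') \<in> W" for t t' s s'
  proof -
    have "s - s' \<in> V" using that transversalD(1)[OF S] add_subgroupD(2)[OF assms(4)] by blast
    then have "((t + s) - (t' + s')) - (s - s') \<in> V"
      using that assms(7) add_subgroupD(2)[OF assms(4)] by blast
    then have "t = t'" using transversal_inj[OF T assms(4)] that by (simp add: algebra_simps)
    then show ?thesis using transversal_inj[OF S assms(5)] that by simp
  qed
  show "transversal U W ((\<lambda>(t, s). t + s) ` (T \<times> S))"
  proof (rule transversalI[OF assms(5)])
    show "(\<lambda>(t, s). t + s) ` (T \<times> S) \<subseteq> U"
      using transversalD(1)[OF S] transversalD(1)[OF T] assms(6)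
      by (auto intro!: add_subgroupD(4)[OF assms(3)])
    fix u assume "u \<in> U"
    then obtain t where t: "t \<in> T" "u - t \<in> V" using transversalD(2)[OF T] by blast
    then obtain s where "s \<in> S" "(u - t) - s \<in> W" using transversalD(2)[OF S] by blast
    then show "\<exists>r\<in>(\<lambda>(t, s). t + s) ` (T \<times> S). u - r \<in> W"
      using t by (intro bexI[of _ "t + s"] image_eqI[of _ _ "(t, s)"]) (auto simp: algebra_simps)
  qed (use key in auto)
  have "inj_on (\<lambda>(t, s). t + s) (T \<times> S)"
    using key add_subgroupD(1)[OF assms(5)] by (intro inj_onI) auto
  then show "card ((\<lambda>(t, s). t + s) ` (T \<times> S)) = card T * card S"
    by (simp add: card_image card_cartesian_product)
qed

subsection \<open>Ideals in commutative rings given as types\<close>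

definition is_ideal :: "'a::comm_ring_1 set \<Rightarrow> bool" where
  "is_ideal J \<longleftrightarrow> 0 \<in> J \<and> (\<forall>a\<in>J. \<forall>b\<in>J. a + b \<in> J) \<and> (\<forall>c. \<forall>a\<in>J. c * a \<in> J)"

lemma is_idealD:
  assumes "is_ideal J"
  shows "0 \<in> J" "a \<in> J \<Longrightarrow> b \<in> J \<Longrightarrow> a + b \<in> J" "a \<in> J \<Longrightarrow> c * a \<in> J" "a \<in> J \<Longrightarrow> a * c \<in> J"
    "a \<in> J \<Longrightarrow> - a \<in> J" "a \<in> J \<Longrightarrow> b \<in> J \<Longrightarrow> a - b \<in> J"
proof -
  show "0 \<in> J" and a: "\<And>a b. a \<in> J \<Longrightarrow> b \<in> J \<Longrightarrow> a + b \<in> J" and m: "\<And>a c. a \<in> J \<Longrightarrow> c * a \<in> J"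
    using assms by (auto simp: is_ideal_def)
  show "a \<in> J \<Longrightarrow> a * c \<in> J" using m[of a c] by (simp add: mult.commute)
  show n: "- a \<in> J" if "a \<in> J" for a using m[of a "-1"] that by simp
  show "a - b \<in> J" if "a \<in> J" "b \<in> J" using a[of a "- b"] n that by simp
qed

lemma is_ideal_sum:
  assumes "is_ideal J" "\<And>i. i \<in> A \<Longrightarrow> f i \<in> J"
  shows "sum f A \<in> J"
  using assms(2) by (induction A rule: infinite_finite_induct) (auto simp: is_idealD[OF assms(1)])

lemma is_ideal_add_subgroup: "is_ideal J \<Longrightarrow> add_subgroup J"
  by (auto simp: add_subgroup_def is_idealD)

lemma is_ideal_Int: "is_ideal A \<Longrightarrow> is_ideal B \<Longrightarrow> is_ideal (A \<inter> B)"
  by (auto simp: is_ideal_def)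

text \<open>Multiplication by \<open>G\<close> induces an isomorphism from the ring modulo the colon
  ideal \<open>(B : G)\<close> onto \<open>(B + (G)) / B\<close>, so it carries representatives to
  representatives.\<close>

lemma transversal_colon:
  fixes G :: "'a::comm_ring_1"
  assumes B: "is_ideal B" and T: "transversal UNIV {p. G * p \<in> B} T"
  shows "transversal {b + G * p | b p. b \<in> B} B ((*) G ` T)" and "card ((*) G ` T) = card T"
proof -
  have C: "add_subgroup {p. G * p \<in> B}"
    using is_idealD[OF B] by (auto simp: add_subgroup_def algebra_simps)
  have inj: "s = t" if "s \<in> T" "t \<in> T" "G * s - G * t \<in> B" for s t
    using transversal_inj[OF T C] that by (simp add: algebra_simps)
  show "transversal {b + G * p | b p. b \<in> B} B ((*) G ` T)"
  proof (rule transversalI[OF is_ideal_add_subgroup[OF B]])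
    show "(*) G ` T \<subseteq> {b + G * p | b p. b \<in> B}"
    proof
      fix y assume "y \<in> (*) G ` T"
      then obtain t where "y = 0 + G * t" by auto
      then show "y \<in> {b + G * p | b p. b \<in> B}" using is_idealD(1)[OF B] by blast
    qed
    fix u assume "u \<in> {b + G * p | b p. b \<in> B}"
    then obtain b p where u: "u = b + G * p" "b \<in> B" by blast
    obtain t where t: "t \<in> T" "G * (p - t) \<in> B" using transversalD(2)[OF T, of p] by auto
    have "u - G * t = b + G * (p - t)" by (simp add: u algebra_simps)
    also have "\<dots> \<in> B" using u t is_idealD[OF B] by blast
    finally show "\<exists>y\<in>(*) G ` T. u - y \<in> B" using t by blast
  qed (use inj in auto)
  show "card ((*) G ` T) = card T"
    using inj is_idealD(1)[OF B] by (intro card_image inj_onI) auto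
qed

subsection \<open>Hilbert's basis theorem\<close>

text \<open>Generation is phrased by minimality among the ideals containing \<open>S\<close>, which
  avoids explicit linear combinations when passing to polynomial rings and to the
  localization.\<close>

definition fin_gen_ideal :: "'a::comm_ring_1 set \<Rightarrow> bool" where
  "fin_gen_ideal J \<longleftrightarrow> (\<exists>S\<subseteq>J. finite S \<and> (\<forall>J'. is_ideal J' \<and> S \<subseteq> J' \<longrightarrow> J \<subseteq> J'))"

text \<open>The inequality on the degree, instead of an equality, lets \<open>coeff p n\<close>
  vanish; this makes the set closed under addition.\<close>

definition lead_coeffs :: "'a::comm_ring_1 poly set \<Rightarrow> nat \<Rightarrow> 'a set" where
  "lead_coeffs J n = {coeff p n | p. p \<in> J \<and> degree p \<le> n}"

lemma lead_coeffsI: "p \<in> J \<Longrightarrow> degree p \<le> n \<Longrightarrow> coeff p n \<in> lead_coeffs J n"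
  by (auto simp: lead_coeffs_def)

lemma is_ideal_lead_coeffs:
  assumes "is_ideal J"
  shows "is_ideal (lead_coeffs J n)"
  unfolding is_ideal_def
proof (intro conjI ballI allI)
  show "0 \<in> lead_coeffs J n" using lead_coeffsI[of 0 J n] is_idealD(1)[OF assms] by simp
  fix a assume "a \<in> lead_coeffs J n"
  then obtain p where p: "a = coeff p n" "p \<in> J" "degree p \<le> n" by (auto simp: lead_coeffs_def)
  show "a + b \<in> lead_coeffs J n" if b: "b \<in> lead_coeffs J n" for b
  proof -
    obtain q where q: "b = coeff q n" "q \<in> J" "degree q \<le> n"
      using b unfolding lead_coeffs_def by blast
    show ?thesis using lead_coeffsI[of "p + q" J n] p q is_idealD(2)[OF assms]
      by (simp add: degree_add_le)
  qed
  show "c * a \<in> lead_coeffs J n" for c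
    using lead_coeffsI[of "[:c:] * p" J n] p is_idealD(3)[OF assms, of p "[:c:]"]
    by (simp add: order_trans[OF degree_smult_le])
qed

lemma lead_coeffs_mono:
  fixes J :: "'a::comm_ring_1 poly set"
  assumes "is_ideal J" "n \<le> m"
  shows "lead_coeffs J n \<subseteq> lead_coeffs J m"
proof
  fix a assume "a \<in> lead_coeffs J n"
  then obtain p where p: "a = coeff p n" "p \<in> J" "degree p \<le> n" by (auto simp: lead_coeffs_def)
  have "degree (monom 1 (m - n) * p) \<le> m"
    using degree_mult_le[of "monom 1 (m - n)" p] degree_monom_le[of "1::'a" "m - n"] p assms(2)
    by linarith
  moreover have "coeff (monom 1 (m - n) * p) m = a" using p assms(2) by (simp add: coeff_monom_mult)
  ultimately show "a \<in> lead_coeffs J m"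
    using lead_coeffsI[of "monom 1 (m - n) * p" J m] is_idealD(3)[OF assms(1) p(2)] by metis
qed

text \<open>Subtracting an element of \<open>J'\<close> with the same coefficient at
  \<open>n\<close> lowers the degree of an element of \<open>J\<close>, so induction on the degree
  applies.\<close>

lemma ideal_subset_of_lead_coeffs:
  assumes "is_ideal J" "is_ideal J'" "J' \<subseteq> J" "\<And>n. lead_coeffs J n \<subseteq> lead_coeffs J' n"
  shows "J \<subseteq> J'"
proof
  fix p assume "p \<in> J"
  \<comment> \<open>The alternative \<open>p = 0\<close> is carried along because the zero
    polynomial also has degree \<open>0\<close>.\<close>
  have "degree p < n \<or> p = 0 \<Longrightarrow> p \<in> J'" for n
    using \<open>p \<in> J\<close>
  proof (induction n arbitrary: p)
    case 0
    then show ?case using is_idealD(1)[OF assms(2)] by auto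
  next
    case (Suc n)
    show ?case
    proof (cases "p = 0")
      case False
      then have deg: "degree p \<le> n" using Suc by auto
      then have "coeff p n \<in> lead_coeffs J' n" using lead_coeffsI[OF Suc.prems(2)] assms(4) by blast
      then obtain q where q: "q \<in> J'" "degree q \<le> n" "coeff p n = coeff q n"
        by (auto simp: lead_coeffs_def)
      have "degree (p - q) < n \<or> p - q = 0"
        using deg q coeff_0_degree_minus_1[of "p - q" n] degree_diff_le[OF deg q(2)]
        by (metis coeff_diff diff_self le_neq_implies_less leading_coeff_0_iff)
      then have "p - q \<in> J'" using Suc q assms(3) is_idealD(6)[OF assms(1)] by blast
      then show ?thesis using is_idealD(2)[OF assms(2) _ q(1)] by fastforce
    qed (simp add: is_idealD(1)[OF assms(2)])
  qed
  from this[of "Suc (degree p)"] show "p \<in> J'" by simp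
qed

text \<open>The leading-coefficient ideals increase with \<open>n\<close> and become stationary at
  some \<open>N\<close>. Lifts of finite generating sets of those with index up to \<open>N\<close>,
  and of one for their union, suffice to compare leading coefficients in every degree.\<close>

theorem hilbert_basis:
  assumes noeth: "\<And>I :: 'a::comm_ring_1 set. is_ideal I \<Longrightarrow> fin_gen_ideal I"
    and J: "is_ideal (J :: 'a poly set)"
  shows "fin_gen_ideal J"
proof -
  note idl = is_ideal_lead_coeffs[OF J]
  have "is_ideal (\<Union>n. lead_coeffs J n)"
    unfolding is_ideal_def
  proof (intro conjI ballI allI)
    show "0 \<in> (\<Union>n. lead_coeffs J n)" using is_idealD(1)[OF idl] by blast
    fix a assume "a \<in> (\<Union>n. lead_coeffs J n)"
    then obtain n where n: "a \<in> lead_coeffs J n" by blast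
    then show "c * a \<in> (\<Union>n. lead_coeffs J n)" for c using is_idealD(3)[OF idl] by blast
    fix b assume "b \<in> (\<Union>n. lead_coeffs J n)"
    then obtain m where "b \<in> lead_coeffs J m" by blast
    then have "a + b \<in> lead_coeffs J (max n m)"
      using n lead_coeffs_mono[OF J, of _ "max n m"] is_idealD(2)[OF idl] by (meson max.cobounded1 max.cobounded2 subsetD)
    then show "a + b \<in> (\<Union>n. lead_coeffs J n)" by blast
  qed
  from noeth[OF this] obtain S where S: "S \<subseteq> (\<Union>n. lead_coeffs J n)" "finite S"
    "\<And>I. is_ideal I \<Longrightarrow> S \<subseteq> I \<Longrightarrow> (\<Union>n. lead_coeffs J n) \<subseteq> I"
    unfolding fin_gen_ideal_def by metis
  obtain f where f: "\<And>s. s \<in> S \<Longrightarrow> s \<in> lead_coeffs J (f s)" using S(1) by (metis UN_E subsetD)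
  \<comment> \<open>Each of the finitely many generators of the union occurs at some index
    \<open>f s\<close>; the value \<open>0\<close> is inserted so that the maximum exists even if
    \<open>S\<close> is empty.\<close>
  define N where "N = Max (insert 0 (f ` S))"
  have SN: "S \<subseteq> lead_coeffs J N"
  proof
    fix s assume s: "s \<in> S"
    then have "f s \<le> N" using S(2) by (simp add: N_def)
    then show "s \<in> lead_coeffs J N" using f[OF s] lead_coeffs_mono[OF J] by blast
  qed
  have "\<forall>n. \<exists>S'\<subseteq>lead_coeffs J n. finite S' \<and> (\<forall>I. is_ideal I \<and> S' \<subseteq> I \<longrightarrow> lead_coeffs J n \<subseteq> I)"
    using noeth[OF idl] by (simp add: fin_gen_ideal_def)
  then obtain Sn where Sn: "\<And>n. Sn n \<subseteq> lead_coeffs J n" "\<And>n. finite (Sn n)"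
    "\<And>n I. is_ideal I \<Longrightarrow> Sn n \<subseteq> I \<Longrightarrow> lead_coeffs J n \<subseteq> I"
    by metis
  have "\<forall>n a. \<exists>p. a \<in> lead_coeffs J n \<longrightarrow> p \<in> J \<and> degree p \<le> n \<and> coeff p n = a"
    by (auto simp: lead_coeffs_def)
  then obtain l where l: "\<And>n a. a \<in> lead_coeffs J n \<Longrightarrow> l n a \<in> J \<and> degree (l n a) \<le> n \<and> coeff (l n a) n = a"
    by metis
  define G where "G = l N ` S \<union> (\<Union>n\<le>N. l n ` Sn n)"
  have "G \<subseteq> J" using l SN Sn(1) by (auto simp: G_def) blast+
  moreover have "finite G" using S(2) Sn(2) by (auto simp: G_def)
  moreover have "J \<subseteq> J'" if J': "is_ideal J'" "G \<subseteq> J'" for J'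
  proof -
    \<comment> \<open>The competitor \<open>J'\<close> need not lie in \<open>J\<close>, whereas the
      comparison of leading coefficients wants a smaller ideal; hence the intersection.\<close>
    have K: "is_ideal (J' \<inter> J)" using J J' is_ideal_Int by blast
    have lift: "a \<in> lead_coeffs (J' \<inter> J) n" if "a \<in> lead_coeffs J n" "l n a \<in> G" for a n
      using l[OF that(1)] that(2) J'(2) lead_coeffsI[of "l n a" "J' \<inter> J" n] by auto
    have "J \<subseteq> J' \<inter> J"
    proof (rule ideal_subset_of_lead_coeffs[OF J K])
      fix n show "lead_coeffs J n \<subseteq> lead_coeffs (J' \<inter> J) n"
      proof (cases "n \<le> N")
        case True
        then show ?thesis
          using Sn(1) lift
          by (intro Sn(3) is_ideal_lead_coeffs[OF K] subsetI lift) (auto simp: G_def)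
      next
        case False
        then have "S \<subseteq> lead_coeffs (J' \<inter> J) n"
          using SN lift lead_coeffs_mono[OF K, of N n] by (auto simp: G_def)
        from S(3)[OF is_ideal_lead_coeffs[OF K] this] show ?thesis by blast
      qed
    qed simp
    then show ?thesis by blast
  qed
  ultimately show ?thesis unfolding fin_gen_ideal_def by blast
qed

lemma fin_gen_ideal_field:
  fixes J :: "'a::field set"
  assumes J: "is_ideal J"
  shows "fin_gen_ideal J"
proof (cases "J = {0}")
  case True
  then show ?thesis unfolding fin_gen_ideal_def by (intro exI[of _ "{}"]) (auto simp: is_ideal_def)
next
  case False
  then obtain a where a: "a \<in> J" "a \<noteq> 0" using is_idealD(1)[OF J] by blast
  have "J \<subseteq> J'" if "is_ideal J'" "{a} \<subseteq> J'" for J'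
  proof
    fix b show "b \<in> J'" using is_idealD(3)[OF that(1), of a "b / a"] that(2) a(2) by simp
  qed
  then show ?thesis using a unfolding fin_gen_ideal_def by (intro exI[of _ "{a}"]) auto
qed

subsection \<open>Counting residue classes and the Krull dimension of filtered domains\<close>

text \<open>The number of cosets of \<open>V\<close> that meet \<open>U\<close>; it is \<open>0\<close> if there are infinitely many.\<close>

definition ncls :: "'a::ab_group_add set \<Rightarrow> 'a set \<Rightarrow> nat" where
  "ncls U V = card (SOME T. transversal U V T)"

lemma ncls_eq_card:
  assumes "add_subgroup V" "transversal U V T"
  shows "ncls U V = card T"
  using transversal_card_unique[OF someI[of "transversal U V" T] assms(2)] assms
  by (simp add: ncls_def)

text \<open>Infinite indices are covered as well: \<open>card\<close> gives them the value
  \<open>0\<close>, and the cardinality of a product respects this convention.\<close>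

lemma ncls_mult:
  assumes "add_subgroup U" "add_subgroup V" "add_subgroup W" "V \<subseteq> U" "W \<subseteq> V"
  shows "ncls U W = ncls U V * ncls V W"
proof -
  obtain T S where T: "transversal U V T" and S: "transversal V W S"
    using transversal_exists assms by metis
  show ?thesis
    using transversal_trans[OF T S assms] ncls_eq_card T S assms by metis
qed

lemma ncls_eq_1:
  assumes U: "add_subgroup U" and V: "add_subgroup V" "V \<subseteq> U" and 1: "ncls U V = 1"
  shows "U = V"
proof -
  obtain T where T: "transversal U V T" using transversal_exists[OF V(1)] by blast
  then have "card T = 1" using ncls_eq_card[OF V(1) T] 1 by simp
  then obtain t where t: "T = {t}" by (rule card_1_singletonE)
  have "u \<in> V" if "u \<in> U" for u
  proof -
    have "u - t \<in> V" "0 - t \<in> V" using transversalD(2)[OF T] that add_subgroupD(1)[OF U] t by blast+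
    then have "(u - t) - (0 - t) \<in> V" by (rule add_subgroupD(2)[OF V(1)])
    then show ?thesis by simp
  qed
  then show ?thesis using V(2) by blast
qed

lemma card_le_ncls:
  assumes V: "add_subgroup V" and U: "finite U" and f: "f ` A \<subseteq> U"
    and inj: "\<And>a b. a \<in> A \<Longrightarrow> b \<in> A \<Longrightarrow> f a - f b \<in> V \<Longrightarrow> a = b"
  shows "card A \<le> ncls U V"
proof -
  obtain T where T: "transversal U V T" using transversal_exists[OF V] by blast
  define g where "g a = (SOME t. t \<in> T \<and> f a - t \<in> V)" for a
  have g: "g a \<in> T \<and> f a - g a \<in> V" if "a \<in> A" for a
  proof -
    have "\<exists>t. t \<in> T \<and> f a - t \<in> V" using that f transversalD(2)[OF T] by blast
    then show ?thesis unfolding g_def by (rule someI_ex)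
  qed
  have "inj_on g A"
  proof (rule inj_onI)
    fix a b assume ab: "a \<in> A" "b \<in> A" "g a = g b"
    then have "(f a - g a) - (f b - g b) \<in> V" using g add_subgroupD(2)[OF V] by blast
    then show "a = b" using inj ab by simp
  qed
  moreover have "finite T" using transversalD(1)[OF T] U finite_subset by blast
  ultimately have "card A \<le> card T" using g by (intro card_inj_on_le[of g]) auto
  then show ?thesis using ncls_eq_card[OF V T] by simp
qed

lemma ncls_le_card:
  assumes "add_subgroup V" "finite U"
  shows "ncls U V \<le> card U"
proof -
  obtain T where T: "transversal U V T" using transversal_exists[OF assms(1)] by blast
  then show ?thesis using ncls_eq_card[OF assms(1) T] transversalD(1)[OF T] card_mono[OF assms(2)] by metis
qed

lemma ncls_mono:
  assumes V: "add_subgroup V" and "finite U" "U' \<subseteq> U"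
  shows "ncls U' V \<le> ncls U V"
proof -
  obtain T where T: "transversal U' V T" using transversal_exists[OF V] by blast
  have "card T \<le> ncls U V"
    using transversalD(1)[OF T] assms transversal_inj[OF T V]
    by (intro card_le_ncls[of V U id]) auto
  then show ?thesis using ncls_eq_card[OF V T] by simp
qed

section \<open>Prime ideals in rings filtered by finite additive subgroups\<close>

definition is_prime_ideal :: "'a::comm_ring_1 set \<Rightarrow> bool" where
  "is_prime_ideal Q \<longleftrightarrow> is_ideal Q \<and> 1 \<notin> Q \<and> (\<forall>a b. a * b \<in> Q \<longrightarrow> a \<in> Q \<or> b \<in> Q)"

text \<open>The model is given by the polynomials of bounded degree over a finite field; finiteness
  of every stage allows residue classes to be counted.\<close>

definition filtration :: "(nat \<Rightarrow> 'a::comm_ring_1 set) \<Rightarrow> bool" where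
  "filtration D \<longleftrightarrow> (\<forall>n. add_subgroup (D n) \<and> 1 \<in> D n \<and> finite (D n)) \<and> mono D \<and>
     (\<forall>a. \<exists>n. a \<in> D n) \<and> (\<forall>m n a b. a \<in> D m \<longrightarrow> b \<in> D n \<longrightarrow> a * b \<in> D (m + n))"

text \<open>The base-two logarithm of \<open>H\<close> is of order at most \<open>n ^ k\<close>; the
  exponent \<open>k\<close> plays the part of a dimension.\<close>

definition growth_le :: "(nat \<Rightarrow> nat) \<Rightarrow> nat \<Rightarrow> bool" where
  "growth_le H k \<longleftrightarrow> (\<exists>C. \<forall>n\<ge>1. H n \<le> 2 ^ (C * n ^ k))"

text \<open>The map sending \<open>(s, t)\<close> to \<open>t + f * s\<close> is injective modulo
  \<open>Q\<close>: the class modulo \<open>Q'\<close> gives back \<open>t\<close> because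
  \<open>f\<close> lies in \<open>Q'\<close>, and then primality of \<open>Q\<close> with
  \<open>f \<notin> Q\<close> gives back \<open>s\<close>.\<close>

lemma ncls_prime_step:
  assumes D: "filtration D" and Q: "is_prime_ideal Q" and Q': "is_prime_ideal Q'"
    and sub: "Q \<subseteq> Q'" and f: "f \<in> Q'" "f \<notin> Q" "f \<in> D c"
  shows "ncls (D n) Q * ncls (D (n + c)) Q' \<le> ncls (D (n + c)) Q"
proof -
  have sg: "add_subgroup Q" "add_subgroup Q'"
    using Q Q' by (auto simp: is_prime_ideal_def is_ideal_add_subgroup)
  obtain S T where S: "transversal (D n) Q S" and T: "transversal (D (n + c)) Q' T"
    using transversal_exists sg by metis
  have "card (S \<times> T) \<le> ncls (D (n + c)) Q"
  proof (rule card_le_ncls[where f = "\<lambda>(s, t). t + f * s"])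
    show "(\<lambda>(s, t). t + f * s) ` (S \<times> T) \<subseteq> D (n + c)"
    proof -
      have "t + f * s \<in> D (n + c)" if "s \<in> S" "t \<in> T" for s t
      proof -
        have "f * s \<in> D (c + n)" using D f(3) that transversalD(1)[OF S] by (auto simp: filtration_def)
        moreover have "t \<in> D (c + n)" "add_subgroup (D (c + n))"
          using D that transversalD(1)[OF T] by (auto simp: filtration_def add.commute)
        ultimately show ?thesis using add_subgroupD(4) by (metis add.commute)
      qed
      then show ?thesis by auto
    qed
    fix a b assume ab: "a \<in> S \<times> T" "b \<in> S \<times> T"
      "(case a of (s, t) \<Rightarrow> t + f * s) - (case b of (s, t) \<Rightarrow> t + f * s) \<in> Q"
    obtain s t s' t' where [simp]: "a = (s, t)" "b = (s', t')" by (cases a, cases b)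
    have 1: "(t - t') + f * (s - s') \<in> Q" using ab(3) by (simp add: algebra_simps)
    moreover have "f * (s - s') \<in> Q'" using f Q' by (simp add: is_prime_ideal_def is_idealD)
    ultimately have "((t - t') + f * (s - s')) - f * (s - s') \<in> Q'"
      using sub add_subgroupD(2)[OF sg(2)] by blast
    then have "t = t'" using transversal_inj[OF T sg(2)] ab by simp
    with 1 have "s - s' \<in> Q" using f(2) Q by (auto simp: is_prime_ideal_def)
    then show "a = b" using transversal_inj[OF S sg(1)] ab \<open>t = t'\<close> by simp
  qed (use D sg in \<open>auto simp: filtration_def\<close>)
  then show ?thesis using ncls_eq_card[OF sg(1) S] ncls_eq_card[OF sg(2) T]
    by (simp add: card_cartesian_product)
qed

text \<open>Each increase of the degree by \<open>c\<close> gains a factor, which is at least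
  \<open>ncls (D n) Q'\<close> by monotonicity in the stage.\<close>

lemma ncls_prime_power:
  assumes D: "filtration D" and Q: "is_prime_ideal Q" and Q': "is_prime_ideal Q'"
    and sub: "Q \<subseteq> Q'" and f: "f \<in> Q'" "f \<notin> Q" "f \<in> D c"
  shows "ncls (D n) Q' ^ j \<le> ncls (D (n + j * c)) Q"
proof (induction j)
  have sg: "add_subgroup Q" "add_subgroup Q'"
    using Q Q' by (auto simp: is_prime_ideal_def is_ideal_add_subgroup)
  case 0
  have "card {0::'a} \<le> ncls (D n) Q"
    using D sg by (intro card_le_ncls[of _ _ id]) (auto simp: filtration_def add_subgroup_def)
  then show ?case by simp
next
  have sg: "add_subgroup Q" "add_subgroup Q'"
    using Q Q' by (auto simp: is_prime_ideal_def is_ideal_add_subgroup)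
  case (Suc j)
  have "ncls (D n) Q' \<le> ncls (D (n + j * c + c)) Q'"
    using D sg by (intro ncls_mono) (auto simp: filtration_def mono_def intro!: monoD[of D])
  then have "ncls (D n) Q' ^ j * ncls (D n) Q' \<le> ncls (D (n + j * c)) Q * ncls (D (n + j * c + c)) Q'"
    by (rule mult_mono[OF Suc]) auto
  also have "\<dots> \<le> ncls (D (n + j * c + c)) Q" by (rule ncls_prime_step[OF assms])
  finally show ?case by (simp add: algebra_simps)
qed

text \<open>Taking \<open>n\<close> iterations multiplies the degree only by the constant
  \<open>1 + c\<close>, but raises the count modulo \<open>Q'\<close> to the power \<open>n\<close>.
  An \<open>n\<close>-th root then lowers the exponent of growth by one.\<close>

lemma ncls_prime_growth:
  assumes D: "filtration D" and Q: "is_prime_ideal Q" and Q': "is_prime_ideal Q'"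
    and sub: "Q \<subset> Q'" and gr: "growth_le (\<lambda>n. ncls (D n) Q) k"
  shows "\<exists>C. \<forall>n\<ge>1. ncls (D n) Q' ^ n \<le> 2 ^ (C * n ^ k)"
proof -
  obtain f where f: "f \<in> Q'" "f \<notin> Q" using sub by blast
  obtain c where c: "f \<in> D c" using D unfolding filtration_def by blast
  obtain C where C: "\<And>n. n \<ge> 1 \<Longrightarrow> ncls (D n) Q \<le> 2 ^ (C * n ^ k)"
    using gr by (auto simp: growth_le_def)
  have "ncls (D n) Q' ^ n \<le> 2 ^ (C * (1 + c) ^ k * n ^ k)" if "n \<ge> 1" for n
  proof -
    have "ncls (D n) Q' ^ n \<le> ncls (D (n + n * c)) Q"
      using ncls_prime_power[OF D Q Q' _ f c] sub by blast
    also have "\<dots> \<le> 2 ^ (C * (n + n * c) ^ k)" using C that by simp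
    also have "(n + n * c) ^ k = (1 + c) ^ k * n ^ k"
      by (simp add: power_mult_distrib[symmetric] algebra_simps)
    finally show ?thesis by (simp add: mult.assoc)
  qed
  then show ?thesis by blast
qed

text \<open>Along the chain the growth exponent drops from \<open>k\<close> to \<open>0\<close>
  after \<open>k\<close> inclusions. A further inclusion would leave the \<open>n\<close>-th power
  of a count bounded, although \<open>0\<close> and \<open>1\<close> always give two classes modulo
  a prime.\<close>

theorem prime_chain_length_le:
  fixes D :: "nat \<Rightarrow> 'a::comm_ring_1 set" and Q :: "nat \<Rightarrow> 'a set"
  assumes D: "filtration D" and gr: "growth_le (\<lambda>n. card (D n)) k"
    and Q: "\<And>i. i \<le> r \<Longrightarrow> is_prime_ideal (Q i)" "\<And>i. i < r \<Longrightarrow> Q i \<subset> Q (Suc i)"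
  shows "r \<le> k"
proof (rule ccontr)
  assume "\<not> r \<le> k"
  have gr: "i \<le> k \<Longrightarrow> growth_le (\<lambda>n. ncls (D n) (Q i)) (k - i)" for i
  proof (induction i)
    case 0
    have "add_subgroup (Q 0)" using Q(1)[of 0] by (auto simp: is_prime_ideal_def is_ideal_add_subgroup)
    then have "ncls (D n) (Q 0) \<le> card (D n)" for n
      using D by (intro ncls_le_card) (auto simp: filtration_def)
    then show ?case using gr unfolding growth_le_def by (metis diff_zero order_trans)
  next
    case (Suc i)
    obtain C where C: "\<And>n. n \<ge> 1 \<Longrightarrow> ncls (D n) (Q (Suc i)) ^ n \<le> 2 ^ (C * n ^ (k - i))"
      using ncls_prime_growth[OF D Q(1) Q(1) Q(2), of i "k - i"] Suc \<open>\<not> r \<le> k\<close> by auto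
    have "ncls (D n) (Q (Suc i)) \<le> 2 ^ (C * n ^ (k - Suc i))" if "n \<ge> 1" for n
    proof -
      have "k - i = Suc (k - Suc i)" using Suc.prems by simp
      then have "ncls (D n) (Q (Suc i)) ^ n \<le> (2 ^ (C * n ^ (k - Suc i))) ^ n"
        using C[OF that] by (simp add: power_mult[symmetric] algebra_simps)
      then show ?thesis using that power_mono_iff[of "ncls (D n) (Q (Suc i))" "2 ^ (C * n ^ (k - Suc i))" n]
        by simp
    qed
    then show ?case by (auto simp: growth_le_def)
  qed
  obtain C where C: "\<And>n. n \<ge> 1 \<Longrightarrow> ncls (D n) (Q (Suc k)) ^ n \<le> 2 ^ C"
    using ncls_prime_growth[OF D Q(1) Q(1) Q(2), of k 0] gr[of k] \<open>\<not> r \<le> k\<close> by auto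
  have pr: "is_ideal (Q (Suc k))" "1 \<notin> Q (Suc k)"
    using Q(1)[of "Suc k"] \<open>\<not> r \<le> k\<close> by (auto simp: is_prime_ideal_def)
  \<comment> \<open>The stage \<open>Suc C\<close> is chosen to make \<open>2 ^ Suc C\<close> exceed
    the bound \<open>2 ^ C\<close>.\<close>
  have "card {0::'a, 1} \<le> ncls (D (Suc C)) (Q (Suc k))"
  proof (rule card_le_ncls[of _ _ id])
    show "add_subgroup (Q (Suc k))" by (rule is_ideal_add_subgroup[OF pr(1)])
  qed (use D pr is_idealD(5)[OF pr(1), of "- 1"] in \<open>auto simp: filtration_def add_subgroup_def\<close>)
  then have "2 ^ Suc C \<le> ncls (D (Suc C)) (Q (Suc k)) ^ Suc C" by (intro power_mono) auto
  also have "\<dots> \<le> 2 ^ C" by (rule C) simp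
  finally show False by simp
qed

section \<open>Filtrations of polynomial rings\<close>

definition poly_filtration :: "(nat \<Rightarrow> 'a::comm_ring_1 set) \<Rightarrow> nat \<Rightarrow> 'a poly set" where
  "poly_filtration D n = {p. degree p \<le> n \<and> (\<forall>i. coeff p i \<in> D n)}"

lemma card_poly_filtration:
  assumes "finite (D n)"
  shows "finite (poly_filtration D n)" "card (poly_filtration D n) \<le> card (D n) ^ Suc n"
proof -
  let ?f = "\<lambda>p::'a poly. map (coeff p) [0..<Suc n]"
  have inj: "inj_on ?f (poly_filtration D n)"
  proof (rule inj_onI)
    fix p q assume pq: "p \<in> poly_filtration D n" "q \<in> poly_filtration D n" "?f p = ?f q"
    show "p = q"
    proof (rule poly_eqI)
      fix i show "coeff p i = coeff q i"
      proof (cases "i \<le> n")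
        case True
        from pq(3) have "?f p ! i = ?f q ! i" by (rule arg_cong)
        with True show ?thesis using True by (simp del: upt_Suc)
      qed (use pq in \<open>auto simp: poly_filtration_def coeff_eq_0\<close>)
    qed
  qed
  have sub: "?f ` poly_filtration D n \<subseteq> {xs. set xs \<subseteq> D n \<and> length xs = Suc n}"
    by (auto simp: poly_filtration_def)
  have fin: "finite {xs. set xs \<subseteq> D n \<and> length xs = Suc n}" using finite_lists_length_eq[OF assms] .
  show "finite (poly_filtration D n)" using inj_on_finite[OF inj sub fin] .
  show "card (poly_filtration D n) \<le> card (D n) ^ Suc n"
    using card_inj_on_le[OF inj sub fin] card_lists_length_eq[OF assms, of "Suc n"] by simp
qed

lemma filtration_poly:
  assumes D: "filtration D"
  shows "filtration (poly_filtration D)"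
proof -
  have sg: "add_subgroup (D n)" and one: "1 \<in> D n" and fin: "finite (D n)" for n
    using D by (auto simp: filtration_def)
  have mono: "m \<le> n \<Longrightarrow> a \<in> D m \<Longrightarrow> a \<in> D n" for m n a
    using D by (auto simp: filtration_def mono_def)
  have "add_subgroup (poly_filtration D n)" for n
    using add_subgroupD[OF sg] by (auto simp: add_subgroup_def poly_filtration_def degree_diff_le)
  moreover have "1 \<in> poly_filtration D n" for n
    using add_subgroupD[OF sg] one by (auto simp: poly_filtration_def)
  moreover have "mono (poly_filtration D)"
    using mono by (auto simp: mono_def poly_filtration_def)
  moreover have "\<exists>n. p \<in> poly_filtration D n" for p
  proof -
    have "\<forall>i. \<exists>n. coeff p i \<in> D n" using D by (auto simp: filtration_def)
    then obtain f where f: "\<And>i. coeff p i \<in> D (f i)" by metis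
    define N where "N = Max (insert (degree p) (f ` {..degree p}))"
    have "coeff p i \<in> D N" for i
    proof (cases "i \<le> degree p")
      case True
      then have "f i \<le> N" unfolding N_def by (intro Max_ge) auto
      then show ?thesis using f mono by blast
    qed (simp add: coeff_eq_0 add_subgroupD(1)[OF sg])
    moreover have "degree p \<le> N" by (auto simp: N_def)
    ultimately show ?thesis by (auto simp: poly_filtration_def)
  qed
  moreover have "p * q \<in> poly_filtration D (m + n)"
    if "p \<in> poly_filtration D m" "q \<in> poly_filtration D n" for p q m n
  proof -
    have "degree (p * q) \<le> m + n"
      using degree_mult_le[of p q] that by (auto simp: poly_filtration_def)
    moreover have "coeff (p * q) i \<in> D (m + n)" for i
    proof -
      have "coeff p j * coeff q (i - j) \<in> D (m + n)" for j
        using that D by (auto simp: poly_filtration_def filtration_def)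
      then have "sum (\<lambda>j. coeff p j * coeff q (i - j)) A \<in> D (m + n)" for A
        by (induction A rule: infinite_finite_induct) (auto simp: add_subgroupD[OF sg])
      then show ?thesis by (simp add: coeff_mult)
    qed
    ultimately show ?thesis by (auto simp: poly_filtration_def)
  qed
  ultimately show ?thesis
    using card_poly_filtration(1)[OF fin] by (auto simp: filtration_def)
qed

text \<open>A polynomial of degree at most \<open>n\<close> has \<open>n + 1 \<le> 2 * n\<close>
  coefficients, so the logarithm of the count gains one factor of order \<open>n\<close>.\<close>

lemma growth_poly_filtration:
  assumes D: "filtration D" and gr: "growth_le (\<lambda>n. card (D n)) k"
  shows "growth_le (\<lambda>n. card (poly_filtration D n)) (Suc k)"
proof -
  obtain C where C: "\<And>n. n \<ge> 1 \<Longrightarrow> card (D n) \<le> 2 ^ (C * n ^ k)"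
    using gr by (auto simp: growth_le_def)
  have "card (poly_filtration D n) \<le> 2 ^ (2 * C * n ^ Suc k)" if "n \<ge> 1" for n
  proof -
    have "card (poly_filtration D n) \<le> card (D n) ^ Suc n"
      using D by (intro card_poly_filtration) (simp add: filtration_def)
    also have "\<dots> \<le> (2 ^ (C * n ^ k)) ^ Suc n" using C[OF that] by (rule power_mono) simp
    also have "\<dots> = 2 ^ (C * n ^ k * Suc n)" by (rule power_mult[symmetric])
    also have "\<dots> \<le> 2 ^ (C * n ^ k * (2 * n))" using that by (intro power_increasing mult_left_mono) auto
    finally show ?thesis by (simp add: algebra_simps)
  qed
  then show ?thesis by (auto simp: growth_le_def)
qed

subsection \<open>Ideals of a polynomial ring containing a monic polynomial\<close>

text \<open>The ideal \<open>J[X] + (g)\<close>. Congruence of coefficients modulo \<open>J\<close>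
  replaces the passage to polynomials over the quotient by \<open>J\<close>.\<close>

definition adjoin :: "'a::comm_ring_1 set \<Rightarrow> 'a poly \<Rightarrow> 'a poly set" where
  "adjoin J g = {p. \<exists>s. \<forall>i. coeff (p - g * s) i \<in> J}"

lemma coeff_mult_in_ideal:
  assumes J: "is_ideal J" and q: "\<And>i. coeff q i \<in> J"
  shows "coeff (p * q) i \<in> J"
  unfolding coeff_mult using q by (intro is_ideal_sum[OF J] is_idealD(3)[OF J])

lemma is_ideal_adjoin:
  assumes J: "is_ideal J"
  shows "is_ideal (adjoin J g)"
  unfolding is_ideal_def
proof (intro conjI ballI allI)
  show "0 \<in> adjoin J g" using is_idealD(1)[OF J] by (auto simp: adjoin_def intro!: exI[of _ 0])
  fix p assume "p \<in> adjoin J g"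
  then obtain s where s: "\<And>i. coeff (p - g * s) i \<in> J" by (auto simp: adjoin_def)
  show "c * p \<in> adjoin J g" for c
  proof -
    have "coeff (c * p - g * (c * s)) i \<in> J" for i
    proof -
      have "c * p - g * (c * s) = c * (p - g * s)" by (simp add: algebra_simps)
      then show ?thesis using s coeff_mult_in_ideal[OF J, of "p - g * s"] by metis
    qed
    then show ?thesis by (auto simp: adjoin_def)
  qed
  fix q assume "q \<in> adjoin J g"
  then obtain t where t: "\<And>i. coeff (q - g * t) i \<in> J" by (auto simp: adjoin_def)
  have "coeff ((p + q) - g * (s + t)) i \<in> J" for i
  proof -
    have "(p + q) - g * (s + t) = (p - g * s) + (q - g * t)" by (simp add: algebra_simps)
    then show ?thesis using is_idealD(2)[OF J s[of i] t[of i]] by (metis coeff_add)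
  qed
  then show "p + q \<in> adjoin J g" by (auto simp: adjoin_def)
qed

lemma monic_division:
  fixes g :: "'a::comm_ring_1 poly"
  assumes "lead_coeff g = 1"
  obtains s r where "p = g * s + r" "\<And>i. i \<ge> degree g \<Longrightarrow> coeff r i = 0"
proof -
  have g: "g \<noteq> 0" using assms by auto
  obtain s r where sr: "pseudo_divmod p g = (s, r)" by fastforce
  from pseudo_divmod[OF g sr] have "p = g * s + r" "r = 0 \<or> degree r < degree g"
    using assms by auto
  then show thesis using that by (force simp: coeff_eq_0)
qed

text \<open>If \<open>m\<close> is the largest index with \<open>coeff s m\<close> outside
  \<open>J\<close>, then the coefficient of \<open>g * s\<close> at \<open>degree g + m\<close> is
  \<open>coeff s m\<close> up to terms in \<open>J\<close>, because \<open>g\<close> is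
  monic.\<close>

lemma monic_cancel:
  fixes g :: "'a::comm_ring_1 poly"
  assumes J: "is_ideal J" and g: "lead_coeff g = 1"
    and gs: "\<And>i. i \<ge> degree g \<Longrightarrow> coeff (g * s) i \<in> J"
  shows "coeff s i \<in> J"
proof (rule ccontr)
  assume bad: "coeff s i \<notin> J"
  define B where "B = {i. coeff s i \<notin> J}"
  have "B \<subseteq> {..degree s}"
  proof
    fix j assume "j \<in> B"
    then have "coeff s j \<noteq> 0" using is_idealD(1)[OF J] by (auto simp: B_def)
    then show "j \<in> {..degree s}" by (simp add: le_degree)
  qed
  then have fin: "finite B" using finite_subset by blast
  define m where "m = Max B"
  have m: "m \<in> B" using fin bad Max_in by (auto simp: m_def B_def)
  have above: "coeff s j \<in> J" if "j > m" for j
  proof (rule ccontr)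
    assume "coeff s j \<notin> J"
    then have "j \<le> m" unfolding m_def using fin by (intro Max_ge) (auto simp: B_def)
    then show False using that by simp
  qed
  let ?d = "degree g"
  have "coeff (g * s) (?d + m) = (\<Sum>j\<le>?d + m. coeff g j * coeff s (?d + m - j))"
    by (simp add: coeff_mult)
  also have "\<dots> = coeff g ?d * coeff s m + (\<Sum>j\<in>{..?d + m} - {?d}. coeff g j * coeff s (?d + m - j))"
    by (subst sum.remove[of _ ?d]) auto
  finally have "coeff s m = coeff (g * s) (?d + m) - (\<Sum>j\<in>{..?d + m} - {?d}. coeff g j * coeff s (?d + m - j))"
    using g by simp
  moreover have "(\<Sum>j\<in>{..?d + m} - {?d}. coeff g j * coeff s (?d + m - j)) \<in> J"
  proof (rule is_ideal_sum[OF J])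
    fix j assume "j \<in> {..?d + m} - {?d}"
    then consider "j < ?d" | "j > ?d" by fastforce
    then show "coeff g j * coeff s (?d + m - j) \<in> J"
      by cases (auto simp: coeff_eq_0 is_idealD[OF J] intro!: is_idealD(3)[OF J] above)
  qed
  ultimately have "coeff s m \<in> J" using gs[of "?d + m"] is_idealD(6)[OF J] by simp
  then show False using m by (simp add: B_def)
qed

text \<open>This is uniqueness of the remainder on division by a monic polynomial over the quotient
  by \<open>J\<close>.\<close>

lemma adjoin_low_degree:
  fixes g :: "'a::comm_ring_1 poly"
  assumes J: "is_ideal J" and g: "lead_coeff g = 1" and p: "p \<in> adjoin J g"
    and low: "\<And>i. i \<ge> degree g \<Longrightarrow> coeff p i \<in> J"
  shows "coeff p i \<in> J"
proof -
  obtain s where s: "\<And>i. coeff (p - g * s) i \<in> J" using p by (auto simp: adjoin_def)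
  have "coeff (g * s) i \<in> J" if "i \<ge> degree g" for i
    using is_idealD(6)[OF J low[OF that] s[of i]] by simp
  then have "coeff s i \<in> J" for i using monic_cancel[OF J g] by blast
  then have "coeff (g * s) i \<in> J" by (rule coeff_mult_in_ideal[OF J])
  then show ?thesis using is_idealD(2)[OF J s[of i]] by fastforce
qed

text \<open>Remainders of degree below \<open>degree g\<close> with coefficients chosen from
  \<open>T\<close> represent all classes once, and they correspond to lists over \<open>T\<close>.
  Positivity of the index makes \<open>T\<close> finite.\<close>

lemma ncls_adjoin:
  fixes g :: "'a::comm_ring_1 poly"
  assumes J: "is_ideal J" and g: "lead_coeff g = 1" and pos: "ncls UNIV J > 0"
  shows "ncls UNIV (adjoin J g) = ncls UNIV J ^ degree g"
proof -
  have sJ: "add_subgroup J" and sA: "add_subgroup (adjoin J g)"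
    using J by (auto intro: is_ideal_add_subgroup is_ideal_adjoin)
  obtain T where T: "transversal UNIV J T" using transversal_exists[OF sJ] by blast
  have fin: "finite T" using pos ncls_eq_card[OF sJ T] card_ge_0_finite by simp
  let ?X = "{xs. set xs \<subseteq> T \<and> length xs = degree g}"
  have key: "xs = ys" if xs: "xs \<in> ?X" and ys: "ys \<in> ?X" and d: "Poly xs - Poly ys \<in> adjoin J g" for xs ys
  proof (rule nth_equalityI)
    show "length xs = length ys" using xs ys by simp
    fix i assume i: "i < length xs"
    have "coeff (Poly xs - Poly ys) k \<in> J" if "k \<ge> degree g" for k
      using that xs ys is_idealD(1)[OF J] by (simp add: nth_default_beyond)
    from adjoin_low_degree[OF J g d this, of i]
    have "xs ! i - ys ! i \<in> J" using i xs ys by (simp add: nth_default_nth)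
    moreover have "xs ! i \<in> set xs" "ys ! i \<in> set ys" using xs ys i by auto
    then have "xs ! i \<in> T" "ys ! i \<in> T" using xs ys by auto
    ultimately show "xs ! i = ys ! i" using transversal_inj[OF T sJ] by blast
  qed
  have "transversal UNIV (adjoin J g) (Poly ` ?X)"
  proof (rule transversalI[OF sA])
    fix p :: "'a poly"
    obtain s r where sr: "p = g * s + r" "\<And>i. i \<ge> degree g \<Longrightarrow> coeff r i = 0"
      using monic_division[OF g] by metis
    obtain f where f: "\<And>a. f a \<in> T" "\<And>a. a - f a \<in> J" 
    proof -
      have "\<forall>a. \<exists>t. t \<in> T \<and> a - t \<in> J" using transversalD(2)[OF T] by blast
      then show ?thesis using that by metis
    qed
    define xs where "xs = map (\<lambda>i. f (coeff r i)) [0..<degree g]"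
    have xs: "xs \<in> ?X" using f by (auto simp: xs_def)
    have "coeff (p - Poly xs - g * s) i \<in> J" for i
      using sr(2)[of i] f(2) is_idealD(1)[OF J]
      by (cases "i < degree g") (simp_all add: sr(1) xs_def nth_default_nth nth_default_beyond)
    then show "\<exists>t\<in>Poly ` ?X. p - t \<in> adjoin J g" using xs by (auto simp: adjoin_def)
    show "p = q" if "p \<in> Poly ` ?X" "q \<in> Poly ` ?X" "p - q \<in> adjoin J g" for p q
      using that key by (elim imageE) blast
  qed simp
  then have "ncls UNIV (adjoin J g) = card (Poly ` ?X)" by (rule ncls_eq_card[OF sA])
  also have "\<dots> = card ?X"
    by (intro card_image inj_onI key) (simp_all add: add_subgroupD(1)[OF sA])
  finally show ?thesis using card_lists_length_eq[OF fin] ncls_eq_card[OF sJ T] by simp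
qed

text \<open>Replacing \<open>p\<close> by its remainder \<open>r\<close> modulo \<open>g ^ b\<close>
  and cancelling the monic factor \<open>g ^ a\<close> leaves \<open>c * r\<close> modulo
  \<open>g ^ b\<close>. The degree of \<open>r\<close> is low, so membership is coefficientwise and
  the colon condition on constants applies.\<close>

lemma adjoin_colon:
  fixes g :: "'a::idom poly"
  assumes J: "is_ideal J" and J': "is_ideal J'" and g: "lead_coeff g = 1"
    and colon: "\<And>a. c * a \<in> J' \<Longrightarrow> a \<in> J"
    and p: "[:c:] * g ^ a * p \<in> adjoin J' (g ^ (a + b))"
  shows "p \<in> adjoin J (g ^ b)"
proof -
  have gb: "lead_coeff (g ^ b) = 1" and ga: "lead_coeff (g ^ a) = 1"
    using g by (simp_all add: lead_coeff_power)
  obtain s r where sr: "p = g ^ b * s + r" "\<And>i. i \<ge> degree (g ^ b) \<Longrightarrow> coeff r i = 0"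
    using monic_division[OF gb] by metis
  obtain t where t: "\<And>i. coeff ([:c:] * g ^ a * p - g ^ (a + b) * t) i \<in> J'"
    using p by (auto simp: adjoin_def)
  have eq: "[:c:] * g ^ a * p - g ^ (a + b) * t = g ^ a * ([:c:] * r - g ^ b * (t - [:c:] * s))"
  proof -
    have "C * A * (B * s + r) - A * B * t = A * (C * r - B * (t - C * s))" for A B C :: "'a poly"
      by (simp add: algebra_simps)
    then show ?thesis unfolding sr(1) power_add .
  qed
  have "coeff ([:c:] * r - g ^ b * (t - [:c:] * s)) i \<in> J'" for i
    by (rule monic_cancel[OF J' ga]) (use t eq in metis)
  then have "[:c:] * r \<in> adjoin J' (g ^ b)" unfolding adjoin_def by blast
  then have "coeff ([:c:] * r) i \<in> J'" for i
    by (rule adjoin_low_degree[OF J' gb]) (simp_all add: sr(2) is_idealD(1)[OF J'])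
  then have "coeff r i \<in> J" for i by (intro colon) simp
  then have "coeff (p - g ^ b * s) i \<in> J" for i by (simp add: sr(1))
  then show ?thesis unfolding adjoin_def by blast
qed

section \<open>Ideals generated by finite sequences and by powers of their members\<close>

definition gen :: "(nat \<Rightarrow> 'a::comm_ring_1) \<Rightarrow> nat \<Rightarrow> 'a set" where
  "gen x k = {\<Sum>i<k. x i * a i | a. True}"

lemma genI: "(\<Sum>i<k. x i * a i) \<in> gen x k"
  by (auto simp: gen_def)

lemma gen_0 [simp]: "gen x 0 = {0}"
  by (auto simp: gen_def)

lemma is_ideal_gen: "is_ideal (gen x k)"
  unfolding is_ideal_def
proof (intro conjI ballI allI)
  show "0 \<in> gen x k" using genI[of x "\<lambda>_. 0" k] by simp
  fix p assume "p \<in> gen x k"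
  then obtain a where a: "p = (\<Sum>i<k. x i * a i)" by (auto simp: gen_def)
  show "c * p \<in> gen x k" for c
    using genI[of x "\<lambda>i. c * a i" k] by (simp add: a sum_distrib_left algebra_simps)
  fix q assume "q \<in> gen x k"
  then obtain b where b: "q = (\<Sum>i<k. x i * b i)" by (auto simp: gen_def)
  show "p + q \<in> gen x k"
    using genI[of x "\<lambda>i. a i + b i" k] by (simp add: a b sum.distrib algebra_simps)
qed

lemma gen_mem:
  assumes "i < k"
  shows "x i \<in> gen x k"
  using genI[of x "\<lambda>j. if j = i then 1 else 0" k] assms by (simp add: if_distrib cong: if_cong)

lemma gen_subset:
  assumes "is_ideal J" "\<And>i. i < k \<Longrightarrow> x i \<in> J"
  shows "gen x k \<subseteq> J"
  unfolding gen_def using assms by (auto intro!: is_ideal_sum is_idealD(4))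

lemma gen_cong: "(\<And>i. i < k \<Longrightarrow> x i = y i) \<Longrightarrow> gen x k = gen y k"
  by (simp add: gen_def)

text \<open>On passing to the polynomial ring the old sequence becomes constant and \<open>g\<close>
  is appended at position \<open>k\<close>; iteration builds the parameters one variable at a
  time.\<close>

definition ext_seq :: "(nat \<Rightarrow> 'a::comm_ring_1) \<Rightarrow> nat \<Rightarrow> 'a poly \<Rightarrow> nat \<Rightarrow> 'a poly" where
  "ext_seq x k g i = (if i < k then [:x i:] else g)"

text \<open>Each coefficient is a combination of the \<open>x l\<close>; collecting the monomials
  that multiply the same \<open>x l\<close> gives the polynomial \<open>A l\<close>.\<close>

lemma coeff_in_gen:
  assumes "\<And>i. coeff p i \<in> gen x k"
  shows "\<exists>A. p = (\<Sum>l<k. [:x l:] * A l)"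
proof -
  have "\<forall>i. \<exists>a. coeff p i = (\<Sum>l<k. x l * a l)" using assms by (auto simp: gen_def)
  then obtain a where a: "\<And>i. coeff p i = (\<Sum>l<k. x l * a i l)" by metis
  have "p = (\<Sum>i\<le>degree p. monom (coeff p i) i)" by (rule poly_as_sum_of_monoms[symmetric])
  also have "\<dots> = (\<Sum>i\<le>degree p. \<Sum>l<k. [:x l:] * monom (a i l) i)"
  proof (rule sum.cong[OF refl])
    fix i
    have "monom (coeff p i) i = (\<Sum>l<k. monom (x l * a i l) i)" unfolding a by (rule monom_sum)
    then show "monom (coeff p i) i = (\<Sum>l<k. [:x l:] * monom (a i l) i)" by (simp add: smult_monom)
  qed
  also have "\<dots> = (\<Sum>l<k. [:x l:] * (\<Sum>i\<le>degree p. monom (a i l) i))"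
    by (subst sum.swap) (simp add: sum_distrib_left)
  finally show ?thesis by (rule exI[of _ "\<lambda>l. \<Sum>i\<le>degree p. monom (a i l) i"])
qed

lemma adjoin_gen: "adjoin (gen x k) g = gen (ext_seq x k g) (Suc k)"
proof (intro equalityI subsetI)
  fix p assume "p \<in> adjoin (gen x k) g"
  then obtain s where "\<And>i. coeff (p - g * s) i \<in> gen x k" by (auto simp: adjoin_def)
  from coeff_in_gen[OF this] obtain A where A: "p - g * s = (\<Sum>l<k. [:x l:] * A l)" by blast
  have "p = (\<Sum>i<Suc k. ext_seq x k g i * (if i < k then A i else s))"
    using A by (simp add: ext_seq_def algebra_simps)
  then show "p \<in> gen (ext_seq x k g) (Suc k)" by (simp only: genI)
next
  fix p assume p: "p \<in> gen (ext_seq x k g) (Suc k)"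
  have "ext_seq x k g i \<in> adjoin (gen x k) g" if "i < Suc k" for i
  proof (cases "i < k")
    case True
    have "coeff ([:x i:] - g * 0) j \<in> gen x k" for j
      using gen_mem[OF True, of x] is_idealD(1)[OF is_ideal_gen] by (cases j) auto
    then have "[:x i:] \<in> adjoin (gen x k) g" unfolding adjoin_def by blast
    then show ?thesis using True by (simp add: ext_seq_def)
  next
    case False
    have "coeff (g - g * 1) j \<in> gen x k" for j using is_idealD(1)[OF is_ideal_gen] by simp
    then have "g \<in> adjoin (gen x k) g" unfolding adjoin_def by blast
    then show ?thesis using False by (simp add: ext_seq_def)
  qed
  then show "p \<in> adjoin (gen x k) g"
    using gen_subset[OF is_ideal_adjoin[OF is_ideal_gen]] p by blast
qed

lemma adjoin_gen_power:
  "adjoin (gen (\<lambda>i. x i ^ n) k) (g ^ n) = gen (\<lambda>i. ext_seq x k g i ^ n) (Suc k)"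
  unfolding adjoin_gen by (intro gen_cong) (simp add: ext_seq_def poly_const_pow)

text \<open>This consequence of regularity is stable under adjoining a variable and a monic polynomial in it.\<close>

definition power_regular :: "(nat \<Rightarrow> 'a::comm_ring_1) \<Rightarrow> nat \<Rightarrow> bool" where
  "power_regular x k \<longleftrightarrow> (\<forall>a b p. (\<Prod>i<k. x i) ^ a * p \<in> gen (\<lambda>i. x i ^ (a + b)) k \<longrightarrow>
     p \<in> gen (\<lambda>i. x i ^ b) k)"

text \<open>The colon condition for constants is the hypothesis on \<open>x\<close>, and cancelling
  powers of the monic \<open>g\<close> takes care of the new member.\<close>

lemma power_regular_ext_seq:
  fixes x :: "nat \<Rightarrow> 'a::idom"
  assumes "power_regular x k" "lead_coeff g = 1"
  shows "power_regular (ext_seq x k g) (Suc k)"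
  unfolding power_regular_def
proof (intro allI impI)
  fix a b p
  assume p: "(\<Prod>i<Suc k. ext_seq x k g i) ^ a * p \<in> gen (\<lambda>i. ext_seq x k g i ^ (a + b)) (Suc k)"
  have "(\<Prod>i<k. [:x i:]) = [:\<Prod>i<k. x i:]" by (induction k) (auto simp: one_pCons)
  then have "(\<Prod>i<Suc k. ext_seq x k g i) = [:\<Prod>i<k. x i:] * g"
    by (simp add: ext_seq_def)
  then have "[:(\<Prod>i<k. x i) ^ a:] * g ^ a * p \<in> adjoin (gen (\<lambda>i. x i ^ (a + b)) k) (g ^ (a + b))"
    using p unfolding adjoin_gen_power by (simp only: power_mult_distrib poly_const_pow)
  then have "p \<in> adjoin (gen (\<lambda>i. x i ^ b) k) (g ^ b)"
    by (rule adjoin_colon[OF is_ideal_gen is_ideal_gen assms(2), rotated])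
      (use assms(1) in \<open>auto simp: power_regular_def\<close>)
  then show "p \<in> gen (\<lambda>i. ext_seq x k g i ^ b) (Suc k)" unfolding adjoin_gen_power .
qed

lemma ncls_gen_ext_seq:
  fixes x :: "nat \<Rightarrow> 'a::idom"
  assumes "ncls UNIV (gen (\<lambda>i. x i ^ n) k) = 2 ^ m" "lead_coeff g = 1"
  shows "ncls UNIV (gen (\<lambda>i. ext_seq x k g i ^ n) (Suc k)) = 2 ^ (m * n * degree g)"
proof -
  have "g \<noteq> 0" using assms(2) by auto
  moreover have "lead_coeff (g ^ n) = 1" using assms(2) by (simp add: lead_coeff_power)
  from ncls_adjoin[OF is_ideal_gen this, of "\<lambda>i. x i ^ n" k]
  have "ncls UNIV (adjoin (gen (\<lambda>i. x i ^ n) k) (g ^ n)) = (2 ^ m) ^ degree (g ^ n)"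
    using assms(1) by simp
  ultimately show ?thesis
    unfolding adjoin_gen_power[symmetric] by (simp add: degree_power_eq power_mult)
qed

subsection \<open>The parameters\<close>

type_synonym bpoly2 = "bit poly poly"
type_synonym bpoly4 = "bit poly poly poly poly"

text \<open>The variables are \<open>x, y, t, w\<close> from the innermost to the outermost polynomial ring, and
  \<open>par4\<close> is the sequence \<open>x, y, x + y + t, w\<close>.\<close>

definition par1 :: "nat \<Rightarrow> bit poly" where "par1 = ext_seq (\<lambda>_. 0) 0 [:0, 1:]"
definition par2 :: "nat \<Rightarrow> bpoly2" where "par2 = ext_seq par1 1 [:0, 1:]"
definition par4 :: "nat \<Rightarrow> bpoly4" where
  "par4 = ext_seq (ext_seq par2 2 [:[:[:0, 1:], 1:], 1:]) 3 [:0, 1:]"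

lemma ncls_bit: "ncls UNIV {0 :: bit} = 2"
proof -
  have "UNIV = {0 :: bit, 1}" by (auto intro: bit.exhaust)
  then have "card (UNIV :: bit set) = card {0 :: bit, 1}" by (rule arg_cong)
  then have "card (UNIV :: bit set) = 2" by simp
  moreover have "transversal UNIV {0 :: bit} UNIV" by (auto simp: transversal_def)
  ultimately show ?thesis by (subst ncls_eq_card) (auto simp: add_subgroup_def)
qed

lemma ncls_par1: "ncls UNIV (gen (\<lambda>i. par1 i ^ n) 1) = 2 ^ n"
  using ncls_gen_ext_seq[of "\<lambda>_. 0 :: bit" n 0 1 "[:0, 1:]"] ncls_bit by (simp add: par1_def)

lemma ncls_par2: "ncls UNIV (gen (\<lambda>i. par2 i ^ n) 2) = 2 ^ (n * n)"
  using ncls_gen_ext_seq[OF ncls_par1, of "[:0, 1:]"] by (simp add: par2_def numeral_2_eq_2)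

lemma ncls_par4: "ncls UNIV (gen (\<lambda>i. par4 i ^ n) 4) = 2 ^ (n ^ 4)"
  using ncls_gen_ext_seq[OF ncls_gen_ext_seq[OF ncls_par2, of "[:[:[:0, 1:], 1:], 1:]"], of "[:0, 1:]"]
  by (simp add: par4_def eval_nat_numeral algebra_simps)

lemma power_regular_par4: "power_regular par4 4"
proof -
  have "power_regular (\<lambda>_. 0 :: bit) 0" by (simp add: power_regular_def)
  then have "power_regular par1 1" unfolding par1_def One_nat_def by (rule power_regular_ext_seq) simp
  then have "power_regular par2 (Suc 1)" unfolding par2_def by (rule power_regular_ext_seq) simp
  then have "power_regular (ext_seq par2 2 [:[:[:0, 1:], 1:], 1:]) (Suc 2)"
    by (intro power_regular_ext_seq) (simp_all add: numeral_2_eq_2)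
  then have "power_regular par4 (Suc 3)"
    unfolding par4_def by (intro power_regular_ext_seq) (simp_all add: eval_nat_numeral)
  then show ?thesis by simp
qed

lemma par4_simps:
  "par4 0 = [:[:[:[:0, 1:]:]:]:]" "par4 1 = [:[:[:0, 1:]:]:]"
  "par4 2 = [:[:[:[:0, 1:], 1:], 1:]:]" "par4 3 = [:0, 1:]"
  by (simp_all add: par4_def par2_def par1_def ext_seq_def)

lemma par2_simps: "par2 0 = [:[:0, 1:]:]" "par2 1 = [:0, 1:]"
  by (simp_all add: par2_def par1_def ext_seq_def)

subsection \<open>The colength of the ideal generated by x^n, y^n and (x + y)^n\<close>

lemma add_self_bpoly2: "p + p = (0 :: bpoly2)"
proof -
  have "b + b = 0" for b :: bit by (cases b) auto
  then show ?thesis by (intro poly_eqI) (simp only: coeff_add coeff_0)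
qed

lemma minus_bpoly2: "p - q = p + (q :: bpoly2)"
  using add_self_bpoly2[of q] by (metis add_diff_cancel_right' add.assoc add.right_neutral)

lemma frobenius_bpoly2: "(a + b) ^ (2 ^ f) = a ^ (2 ^ f) + (b :: bpoly2) ^ (2 ^ f)"
proof (induction f)
  case (Suc f)
  have "(a + b) ^ (2 ^ Suc f) = ((a + b) ^ (2 ^ f)) ^ 2"
    by (simp add: power_mult[symmetric] mult.commute)
  also have "\<dots> = (a ^ 2 ^ f) ^ 2 + (b ^ 2 ^ f) ^ 2 + (a ^ 2 ^ f * b ^ 2 ^ f + a ^ 2 ^ f * b ^ 2 ^ f)"
    unfolding Suc by (simp add: power2_eq_square algebra_simps)
  also have "\<dots> = a ^ (2 ^ Suc f) + b ^ (2 ^ Suc f)"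
    by (simp only: add_self_bpoly2) (simp add: power_mult[symmetric] mult.commute)
  finally show ?case .
qed simp

text \<open>Multiplying the right side by \<open>a + b = a - b\<close> telescopes to
  \<open>a ^ (2 ^ e) - b ^ (2 ^ e)\<close>, which is \<open>(a + b) ^ (2 ^ e)\<close> by Frobenius.
  In other words, all binomial coefficients of \<open>2 ^ e - 1\<close> are odd.\<close>

lemma power_pred_bpoly2:
  assumes "a + b \<noteq> (0 :: bpoly2)"
  shows "(a + b) ^ (2 ^ e - 1) = (\<Sum>i<2 ^ e. a ^ i * b ^ (2 ^ e - 1 - i))"
proof -
  obtain m where m: "(2::nat) ^ e = Suc m" using not0_implies_Suc by (metis power_not_zero zero_neq_numeral)
  have "(a + b) * (\<Sum>i<Suc m. a ^ i * b ^ (m - i)) = a ^ Suc m - b ^ Suc m"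
    using diff_power_eq_sum[of a m b] minus_bpoly2 by metis
  also have "\<dots> = (a + b) ^ Suc m" using frobenius_bpoly2[of a b e] minus_bpoly2 by (simp only: m)
  finally have "(a + b) * (\<Sum>i<Suc m. a ^ i * b ^ (m - i)) = (a + b) * (a + b) ^ m" by simp
  then have "(\<Sum>i<Suc m. a ^ i * b ^ (m - i)) = (a + b) ^ m" using assms mult_left_cancel by blast
  then show ?thesis by (simp only: m diff_Suc_1)
qed

text \<open>Applied to \<open>x ^ (2 ^ f)\<close> and \<open>y ^ (2 ^ f)\<close>, the previous
  expansion has only exponents divisible by \<open>2 ^ f\<close>. The gaps between the powers of
  \<open>y\<close> are what makes the colon ideal computable.\<close>

lemma par_sum_power:
  assumes n: "n = (2 ^ e - 1) * 2 ^ f"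
  shows "[:[:0, 1:], 1:] ^ n =
    (\<Sum>i<2 ^ e. monom ([:0, 1 :: bit:] ^ (2 ^ f * i)) (2 ^ f * (2 ^ e - 1 - i)))"
proof -
  let ?a = "[:[:0, 1:] ^ (2 ^ f):] :: bpoly2" and ?b = "[:0, 1:] ^ (2 ^ f) :: bpoly2"
  have ab: "?a + ?b = [:[:0, 1:], 1:] ^ (2 ^ f)"
    using frobenius_bpoly2[of "[:[:0, 1:]:]" "[:0, 1:]" f] by (simp add: poly_const_pow)
  have "[:[:0, 1:], 1:] ^ n = (?a + ?b) ^ (2 ^ e - 1)"
    unfolding ab n by (simp add: power_mult[symmetric] mult.commute)
  also have "\<dots> = (\<Sum>i<2 ^ e. ?a ^ i * ?b ^ (2 ^ e - 1 - i))"
    by (rule power_pred_bpoly2) (simp add: ab)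
  also have "\<dots> = (\<Sum>i<2 ^ e. monom ([:0, 1:] ^ (2 ^ f * i)) (2 ^ f * (2 ^ e - 1 - i)))"
    by (simp add: monom_altdef poly_const_pow power_mult[symmetric])
  finally show ?thesis .
qed

lemma coeff_gen_par2:
  assumes "p \<in> gen (\<lambda>i. par2 i ^ n) 2" "m < n"
  shows "[:0, 1:] ^ n dvd coeff p m"
proof -
  obtain a where "p = (\<Sum>i<2. par2 i ^ n * a i)" using assms(1) by (auto simp: gen_def)
  then have "p = smult ([:0, 1:] ^ n) (a 0) + monom 1 n * a 1"
    using par2_simps by (simp add: numeral_2_eq_2 poly_const_pow monom_altdef)
  then show ?thesis using assms(2) by (simp add: coeff_monom_mult)
qed

lemma gen_par1: "gen (\<lambda>i. par1 i ^ m) 1 = {a. [:0, 1:] ^ m dvd a}"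
  by (auto simp: gen_def par1_def ext_seq_def dvd_def)

text \<open>With \<open>q = 2 ^ f\<close>, the right side is
  \<open>(x ^ (n - q), (x + y) ^ q)\<close>. Both generators multiply \<open>(x + y) ^ n\<close>
  into \<open>(x ^ n, y ^ n)\<close>. Conversely, division by \<open>(x + y) ^ q\<close> reduces to
  remainders of degree below \<open>q\<close> in \<open>y\<close>, whose coefficients can be read
  off thanks to the gaps in \<open>(x + y) ^ n\<close>.\<close>

lemma colon_par2:
  assumes e: "e \<ge> 1" and n: "n = (2 ^ e - 1) * 2 ^ f"
  shows "{p. [:[:0, 1:], 1:] ^ n * p \<in> gen (\<lambda>i. par2 i ^ n) 2} =
    adjoin (gen (\<lambda>i. par1 i ^ (n - 2 ^ f)) 1) ([:[:0, 1:], 1:] ^ (2 ^ f))"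
proof -
  let ?B = "gen (\<lambda>i. par2 i ^ n) 2" and ?x = "[:0, 1:] :: bit poly" and ?q = "2 ^ f :: nat"
  define G where "G = [:?x, 1:] ^ n"
  define g where "g = [:?x, 1:] ^ ?q"
  note B = is_idealD[OF is_ideal_gen[of "\<lambda>i. par2 i ^ n" 2]]
  have e2: "(2::nat) ^ e \<ge> 2" using e power_increasing[of 1 e "2::nat"] by simp
  have nq: "n \<ge> ?q" using e2 n by simp
  have Xn: "[:?x:] ^ n \<in> ?B" and Yn: "[:0, 1:] ^ n \<in> ?B"
    using gen_mem[of 0 2 "\<lambda>i. par2 i ^ n"] gen_mem[of 1 2 "\<lambda>i. par2 i ^ n"]
    by (simp_all only: par2_simps)
  have pw: "y ^ m \<in> ?B" if "y ^ n \<in> ?B" "m \<ge> n" for y m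
    using B(3)[OF that(1), of "y ^ (m - n)"] that(2) by (simp add: power_add[symmetric])
  \<comment> \<open>The exponent \<open>n + q\<close> is the power \<open>2 ^ (e + f)\<close>, so
    Frobenius leaves only two pure powers, and their exponent exceeds \<open>n\<close>.\<close>
  have Gg: "G * g \<in> ?B"
  proof -
    have "n + ?q = 2 ^ (e + f)" using e2 by (simp add: n power_add algebra_simps)
    then have "G * g = [:?x:] ^ (n + ?q) + [:0, 1:] ^ (n + ?q)"
      using frobenius_bpoly2[of "[:?x:]" "[:0, 1:]" "e + f"] by (simp add: G_def g_def power_add[symmetric])
    then show ?thesis using B(2) pw[OF Xn] pw[OF Yn] by simp
  qed
  \<comment> \<open>The monomial with \<open>i = 0\<close> is \<open>y ^ n\<close> itself; all
    others carry at least \<open>x ^ q\<close>, which completes \<open>x ^ (n - q)\<close> to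
    \<open>x ^ n\<close>.\<close>
  have XG: "[:?x:] ^ (n - ?q) * G \<in> ?B"
  proof -
    have "[:?x:] ^ (n - ?q) * monom (?x ^ (?q * i)) (?q * (2 ^ e - 1 - i)) \<in> ?B" if "i < 2 ^ e" for i
    proof -
      have eq: "[:?x:] ^ (n - ?q) * monom (?x ^ (?q * i)) (?q * (2 ^ e - 1 - i)) =
        [:?x:] ^ (n - ?q + ?q * i) * [:0, 1:] ^ (?q * (2 ^ e - 1 - i))"
        by (simp add: monom_altdef poly_const_pow power_add)
      show ?thesis
      proof (cases "i = 0")
        case True
        then have "?q * (2 ^ e - 1 - i) = n" by (simp add: n)
        then show ?thesis unfolding eq using B(3)[OF Yn] by simp
      next
        case False
        then have "?q * i \<ge> ?q" by simp
        then have "n - ?q + ?q * i \<ge> n" using nq by linarith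
        then show ?thesis unfolding eq using B(4) pw[OF Xn] by blast
      qed
    qed
    then show ?thesis unfolding G_def par_sum_power[OF n] sum_distrib_left
      by (intro is_ideal_sum[OF is_ideal_gen]) auto
  qed
  have "G * p \<in> ?B" if p: "p \<in> adjoin (gen (\<lambda>i. par1 i ^ (n - ?q)) 1) g" for p
  proof -
    obtain a where "p = (\<Sum>i<Suc 1. ext_seq (\<lambda>i. par1 i ^ (n - ?q)) 1 g i * a i)"
      using p unfolding adjoin_gen by (auto simp: gen_def)
    then have "G * p = [:?x:] ^ (n - ?q) * G * a 0 + G * g * a 1"
      by (simp add: ext_seq_def par1_def poly_const_pow algebra_simps)
    then show ?thesis using B(2)[OF B(4)[OF XG] B(4)[OF Gg]] by simp
  qed
  moreover have "p \<in> adjoin (gen (\<lambda>i. par1 i ^ (n - ?q)) 1) g" if p: "G * p \<in> ?B" for p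
  proof -
    have "lead_coeff g = 1" by (simp add: g_def lead_coeff_power)
    from monic_division[OF this] obtain s r
      where sr: "p = g * s + r" "\<And>i. i \<ge> degree g \<Longrightarrow> coeff r i = 0" by metis
    have dg: "degree g = ?q" by (simp add: g_def degree_power_eq)
    have "G * r = G * p - G * g * s" by (simp add: sr(1) algebra_simps)
    then have Gr: "G * r \<in> ?B" using B(6)[OF p B(4)[OF Gg]] by simp
    have "coeff r j \<in> gen (\<lambda>i. par1 i ^ (n - ?q)) 1" for j
    proof (cases "j < ?q")
      case False
      then show ?thesis using sr(2) dg is_idealD(1)[OF is_ideal_gen] by simp
    next
      case j: True
      \<comment> \<open>This index lies below \<open>n\<close>, so \<open>x ^ n\<close> divides the
        coefficient there. Only the summand \<open>i = 1\<close> reaches it: for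
        \<open>i = 0\<close> the power of \<open>y\<close> is too large, and for
        \<open>i \<ge> 2\<close> a coefficient of \<open>r\<close> at an index of at least
        \<open>q\<close> would be needed.\<close>
      let ?k = "?q * (2 ^ e - 2) + j"
      have "?k < ?q * (2 ^ e - 2) + ?q" using j by simp
      also have "\<dots> = n" using e2 by (simp add: n algebra_simps diff_mult_distrib2)
      finally have "?x ^ n dvd coeff (G * r) ?k" by (rule coeff_gen_par2[OF Gr])
      also have "coeff (G * r) ?k =
        (\<Sum>i<(2::nat) ^ e. if i = 1 then ?x ^ ?q * coeff r j else 0)"
        unfolding G_def par_sum_power[OF n] sum_distrib_right coeff_sum
      proof (rule sum.cong[OF refl])
        fix i :: nat assume "i \<in> {..<2 ^ e}"
        then have i: "i < 2 ^ e" by simp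
        consider "i = 0" | "i = 1" | "i \<ge> 2" by linarith
        then show "coeff (monom (?x ^ (?q * i)) (?q * (2 ^ e - 1 - i)) * r) ?k =
          (if i = 1 then ?x ^ ?q * coeff r j else 0)"
        proof cases
          case 1
          have "?k < ?q * (2 ^ e - 1)" using \<open>?k < ?q * (2 ^ e - 2) + ?q\<close> e2
            by (simp add: algebra_simps diff_mult_distrib2)
          then show ?thesis using 1 by (simp add: coeff_monom_mult)
        next
          case 2
          then show ?thesis by (simp add: coeff_monom_mult numeral_2_eq_2)
        next
          case 3
          have "?q * (2 ^ e - 2) = ?q * (2 ^ e - 1 - i) + ?q * (i - 1)"
            using i 3 by (simp add: add_mult_distrib2[symmetric])
          moreover have "?q * (i - 1) \<ge> ?q" using 3 by simp
          ultimately have "?k - ?q * (2 ^ e - 1 - i) \<ge> ?q" by linarith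
          then have "coeff r (?k - ?q * (2 ^ e - 1 - i)) = 0" using sr(2) dg by simp
          then show ?thesis using 3 by (simp add: coeff_monom_mult)
        qed
      qed
      also have "\<dots> = ?x ^ ?q * coeff r j" using e2 by simp
      finally have "?x ^ ?q * ?x ^ (n - ?q) dvd ?x ^ ?q * coeff r j"
        using nq by (simp add: power_add[symmetric])
      then show ?thesis unfolding gen_par1 by simp
    qed
    then have "coeff (p - g * s) j \<in> gen (\<lambda>i. par1 i ^ (n - ?q)) 1" for j by (simp add: sr(1))
    then show ?thesis unfolding adjoin_def by blast
  qed
  ultimately show ?thesis unfolding G_def g_def by blast
qed

text \<open>The ideal is written in the form \<open>B + (G)\<close> so that
  \<open>transversal_colon\<close> applies to it.\<close>

definition three_powers :: "nat \<Rightarrow> bpoly2 set" where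
  "three_powers n = {b + [:[:0, 1:], 1:] ^ n * p | b p. b \<in> gen (\<lambda>i. par2 i ^ n) 2}"

lemma is_ideal_three_powers: "is_ideal (three_powers n)"
  unfolding is_ideal_def
proof (intro conjI ballI allI)
  note B = is_idealD[OF is_ideal_gen[of "\<lambda>i. par2 i ^ n" 2]]
  let ?G = "[:[:0, 1:], 1:] ^ n :: bpoly2"
  have I: "b + ?G * p \<in> three_powers n" if "b \<in> gen (\<lambda>i. par2 i ^ n) 2" for b p
    using that unfolding three_powers_def by blast
  show "0 \<in> three_powers n" using I[OF B(1), of 0] by simp
  fix u assume "u \<in> three_powers n"
  then obtain b p where u: "u = b + ?G * p" "b \<in> gen (\<lambda>i. par2 i ^ n) 2"
    unfolding three_powers_def by blast
  show "c * u \<in> three_powers n" for c using I[OF B(3)[OF u(2)], of c "c * p"] by (simp add: u(1) algebra_simps)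
  fix v assume "v \<in> three_powers n"
  then obtain b' p' where v: "v = b' + ?G * p'" "b' \<in> gen (\<lambda>i. par2 i ^ n) 2"
    unfolding three_powers_def by blast
  show "u + v \<in> three_powers n" using I[OF B(2)[OF u(2) v(2)], of "p + p'"] by (simp add: u(1) v(1) algebra_simps)
qed

text \<open>The index of \<open>(x ^ n, y ^ n)\<close> factors through
  \<open>three_powers n\<close>, and the lower factor is the index of the colon ideal in the whole
  ring. The product form avoids subtraction of exponents.\<close>

lemma ncls_three_powers:
  assumes e: "e \<ge> 1" and n: "n = (2 ^ e - 1) * 2 ^ f"
  shows "ncls UNIV (three_powers n) * 2 ^ ((n - 2 ^ f) * 2 ^ f) = 2 ^ (n * n)"
proof -
  let ?B = "gen (\<lambda>i. par2 i ^ n) 2" and ?G = "[:[:0, 1:], 1:] ^ n :: bpoly2"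
  let ?C = "{p. ?G * p \<in> ?B}"
  have sg: "add_subgroup ?B" "add_subgroup (three_powers n)" "add_subgroup ?C"
    by (auto intro!: is_ideal_add_subgroup is_ideal_gen is_ideal_three_powers is_ideal_adjoin
      simp: colon_par2[OF assms])
  obtain T where T: "transversal UNIV ?C T" using transversal_exists[OF sg(3)] by blast
  have "ncls (three_powers n) ?B = card T"
    using transversal_colon[OF is_ideal_gen T] ncls_eq_card[OF sg(1)] by (simp add: three_powers_def)
  also have "\<dots> = ncls UNIV ?C" using ncls_eq_card[OF sg(3) T] by simp
  also have "\<dots> = (2 ^ (n - 2 ^ f)) ^ degree ([:[:0, 1:], 1:] ^ (2 ^ f) :: bpoly2)"
    unfolding colon_par2[OF assms]
    by (subst ncls_adjoin) (simp_all only: is_ideal_gen ncls_par1 lead_coeff_power, simp_all)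
  also have "\<dots> = 2 ^ ((n - 2 ^ f) * 2 ^ f)" by (simp add: degree_power_eq power_mult)
  finally have 1: "ncls (three_powers n) ?B = 2 ^ ((n - 2 ^ f) * 2 ^ f)" .
  have "?B \<subseteq> three_powers n"
  proof
    fix b assume "b \<in> ?B"
    then have "b + ?G * 0 \<in> three_powers n" unfolding three_powers_def by blast
    then show "b \<in> three_powers n" by simp
  qed
  then have "ncls UNIV ?B = ncls UNIV (three_powers n) * ncls (three_powers n) ?B"
    using sg by (intro ncls_mult) (auto simp: add_subgroup_def)
  then show ?thesis using 1 ncls_par2 by simp
qed

subsection \<open>The colength of the limit closure in the polynomial ring\<close>

text \<open>The two outer variables are \<open>w\<close> and \<open>t\<close>, so this is reduction
  modulo \<open>(t, w)\<close>.\<close>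

definition at_origin2 :: "bpoly4 \<Rightarrow> bpoly2" where "at_origin2 p = coeff (coeff p 0) 0"

lemma at_origin2_simps [simp]:
  "at_origin2 (p + q) = at_origin2 p + at_origin2 q" "at_origin2 (p - q) = at_origin2 p - at_origin2 q"
  "at_origin2 (p * q) = at_origin2 p * at_origin2 q" "at_origin2 (p ^ n) = at_origin2 p ^ n"
  "at_origin2 0 = 0" "at_origin2 1 = 1" "at_origin2 [:[:r:]:] = r"
  by (simp_all add: at_origin2_def coeff_mult_0 coeff_0_power)

lemma at_origin2_par4:
  "at_origin2 (par4 0) = [:[:0, 1:]:]" "at_origin2 (par4 1) = [:0, 1:]"
  "at_origin2 (par4 2) = [:[:0, 1:], 1:]" "at_origin2 (par4 3) = 0"
  unfolding par4_simps by (simp_all add: at_origin2_def)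

text \<open>The ideal \<open>(t, w)\<close>, given as a kernel; its extension to the localization is
  the module of the theorem.\<close>

definition idlP :: "bpoly4 set" where "idlP = {p. at_origin2 p = 0}"

lemma is_ideal_idlP: "is_ideal idlP"
  by (simp add: is_ideal_def idlP_def)

text \<open>The map \<open>f\<close> induces an isomorphism of quotients, and \<open>s\<close> lifts
  representatives along it.\<close>

lemma ncls_vimage:
  assumes add: "\<And>p q. f (p - q) = f p - f q" and surj: "\<And>r. f (s r) = r" and V: "add_subgroup V"
  shows "ncls UNIV (f -` V) = ncls UNIV V"
proof -
  obtain T where T: "transversal UNIV V T" using transversal_exists[OF V] by blast
  have "f 0 = 0" using add[of 0 0] by simp
  then have V': "add_subgroup (f -` V)" using V by (simp add: add_subgroup_def add)
  have "transversal UNIV (f -` V) (s ` T)"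
  proof (rule transversalI[OF V'])
    fix u
    obtain t where "t \<in> T" "f u - t \<in> V" using transversalD(2)[OF T, of "f u"] by blast
    then show "\<exists>t\<in>s ` T. u - t \<in> f -` V" by (auto simp: add surj intro!: bexI[of _ t])
    show "a = b" if ab: "a \<in> s ` T" "b \<in> s ` T" "a - b \<in> f -` V" for a b
    proof -
      obtain x y where xy: "a = s x" "b = s y" "x \<in> T" "y \<in> T" using ab(1,2) by blast
      then have "x - y \<in> V" using ab(3) by (simp add: add surj)
      then show ?thesis using transversal_inj[OF T V] xy by blast
    qed
  qed simp
  moreover have "card (s ` T) = card T" by (rule card_image) (metis inj_onI surj)
  ultimately show ?thesis using ncls_eq_card[OF V'] ncls_eq_card[OF V T] by metis
qed

text \<open>Modulo \<open>(t, w)\<close> the parameters become \<open>x\<close>, \<open>y\<close>,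
  \<open>x + y\<close> and \<open>0\<close>, so adding \<open>(t, w)\<close> to the ideal of
  \<open>n\<close>-th powers gives the preimage of \<open>three_powers n\<close>.\<close>

lemma at_origin2_vimage:
  "at_origin2 -` three_powers n = {i + p | i p. i \<in> idlP \<and> p \<in> gen (\<lambda>i. par4 i ^ n) 4}"
proof (intro equalityI subsetI)
  fix p assume "p \<in> at_origin2 -` three_powers n"
  then obtain b r where br: "at_origin2 p = b + [:[:0, 1:], 1:] ^ n * r" "b \<in> gen (\<lambda>i. par2 i ^ n) 2"
    unfolding three_powers_def by blast
  then obtain a where "b = (\<Sum>i<2. par2 i ^ n * a i)" by (auto simp: gen_def)
  then have a: "b = par2 0 ^ n * a 0 + par2 1 ^ n * a 1" by (simp add: numeral_2_eq_2)
  \<comment> \<open>The coefficients are lifted as constants in \<open>t\<close> and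
    \<open>w\<close>; the power of \<open>w\<close> gets the coefficient \<open>0\<close>.\<close>
  define c where "c i = (if i < 2 then [:[:a i:]:] else if i = 2 then [:[:r:]:] else (0::bpoly4))" for i
  define s where "s = (\<Sum>i<4. par4 i ^ n * c i)"
  have "s = par4 0 ^ n * [:[:a 0:]:] + par4 1 ^ n * [:[:a 1:]:] + par4 2 ^ n * [:[:r:]:]"
    by (simp add: s_def c_def eval_nat_numeral)
  then have "at_origin2 s = at_origin2 (par4 0) ^ n * a 0 + at_origin2 (par4 1) ^ n * a 1 + at_origin2 (par4 2) ^ n * r"
    by (simp only: at_origin2_simps)
  also have "\<dots> = at_origin2 p" unfolding br(1) a at_origin2_par4 par2_simps ..
  finally have "p - s \<in> idlP" by (simp add: idlP_def)
  moreover have "s \<in> gen (\<lambda>i. par4 i ^ n) 4" unfolding s_def by (rule genI)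
  moreover have "p = (p - s) + s" by simp
  ultimately show "p \<in> {i + p | i p. i \<in> idlP \<and> p \<in> gen (\<lambda>i. par4 i ^ n) 4}" by blast
next
  fix u assume "u \<in> {i + p | i p. i \<in> idlP \<and> p \<in> gen (\<lambda>i. par4 i ^ n) 4}"
  then obtain i p where u: "u = i + p" "i \<in> idlP" "p \<in> gen (\<lambda>i. par4 i ^ n) 4" by blast
  have "is_ideal (at_origin2 -` three_powers n)"
    using is_ideal_three_powers[of n] by (auto simp: is_ideal_def)
  moreover have "par4 i ^ n \<in> at_origin2 -` three_powers n" if i: "i < 4" for i
  proof (cases "n = 0")
    \<comment> \<open>The exponent \<open>0\<close> is separate because \<open>w ^ 0 = 1\<close>
      does not map to \<open>0\<close>; here \<open>three_powers n\<close> contains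
      \<open>1\<close>.\<close>
    case True
    have "1 \<in> gen (\<lambda>i. par2 i ^ n) 2" using gen_mem[of 0 2 "\<lambda>i. par2 i ^ n"] True by simp
    then have "1 + [:[:0, 1:], 1:] ^ n * 0 \<in> three_powers n" unfolding three_powers_def by blast
    then show ?thesis using True by simp
  next
    case False
    have I: "b + [:[:0, 1:], 1:] ^ n * p \<in> three_powers n" if "b \<in> gen (\<lambda>i. par2 i ^ n) 2" for b p
      using that unfolding three_powers_def by blast
    from i consider "i = 0" | "i = 1" | "i = 2" | "i = 3" by linarith
    then show ?thesis
    proof cases
      case 1
      then show ?thesis using I[OF gen_mem[of 0 2 "\<lambda>i. par2 i ^ n"], of 0]
        by (simp only: vimage_eq at_origin2_simps at_origin2_par4 par2_simps) simp
    next
      case 2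
      then show ?thesis using I[OF gen_mem[of 1 2 "\<lambda>i. par2 i ^ n"], of 0]
        by (simp only: vimage_eq at_origin2_simps at_origin2_par4 par2_simps) simp
    next
      case 3
      then show ?thesis using I[OF is_idealD(1)[OF is_ideal_gen], of 1]
        by (simp only: vimage_eq at_origin2_simps at_origin2_par4) simp
    next
      case 4
      then show ?thesis using is_idealD(1)[OF is_ideal_three_powers, of n] False
        by (simp only: vimage_eq at_origin2_simps at_origin2_par4) (simp add: power_0_left)
    qed
  qed
  ultimately have "gen (\<lambda>i. par4 i ^ n) 4 \<subseteq> at_origin2 -` three_powers n" by (rule gen_subset)
  then have "p \<in> at_origin2 -` three_powers n" using u(3) by blast
  then show "u \<in> at_origin2 -` three_powers n" using u by (simp add: idlP_def)
qed

text \<open>By the second isomorphism theorem the index of \<open>P \<inter> Q\<close> in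
  \<open>P\<close> is that of \<open>Q\<close> in \<open>P + Q\<close>, where \<open>P\<close> is
  \<open>idlP\<close> and \<open>Q\<close> the ideal of \<open>n\<close>-th powers. It equals the
  index \<open>2 ^ (n ^ 4)\<close> of \<open>Q\<close> divided by the index of
  \<open>three_powers n\<close>.\<close>

lemma ncls_idlP:
  assumes e: "e \<ge> 1" and n: "n = (2 ^ e - 1) * 2 ^ f"
  shows "ncls idlP (idlP \<inter> gen (\<lambda>i. par4 i ^ n) 4) = 2 ^ (n ^ 4 + (n - 2 ^ f) * 2 ^ f - n * n)"
proof -
  let ?Q = "gen (\<lambda>i. par4 i ^ n) 4" and ?V = "at_origin2 -` three_powers n"
  have sV: "add_subgroup ?V"
    using is_ideal_add_subgroup[OF is_ideal_three_powers[of n]] by (simp add: add_subgroup_def)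
  have sQ: "add_subgroup ?Q" and sI: "add_subgroup (idlP \<inter> ?Q)"
    by (auto intro!: is_ideal_add_subgroup is_ideal_gen is_ideal_Int is_ideal_idlP)
  obtain T where T: "transversal idlP (idlP \<inter> ?Q) T" using transversal_exists[OF sI] by blast
  have "transversal ?V ?Q T"
  proof (rule transversalI[OF sQ])
    show "T \<subseteq> ?V"
      using transversalD(1)[OF T] is_idealD(1)[OF is_ideal_three_powers] by (auto simp: idlP_def)
    fix u assume "u \<in> ?V"
    then obtain i p where u: "u = i + p" "i \<in> idlP" "p \<in> ?Q" unfolding at_origin2_vimage by blast
    obtain t where t: "t \<in> T" "i - t \<in> idlP \<inter> ?Q" using transversalD(2)[OF T u(2)] by blast
    have "u - t = (i - t) + p" by (simp add: u(1))
    then show "\<exists>t\<in>T. u - t \<in> ?Q" using t u(3) add_subgroupD(4)[OF sQ] by (metis IntD2)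
  next
    fix s t assume st: "s \<in> T" "t \<in> T" "s - t \<in> ?Q"
    then have "s - t \<in> idlP \<inter> ?Q"
      using transversalD(1)[OF T] is_idealD(6)[OF is_ideal_idlP] by blast
    then show "s = t" using transversal_inj[OF T sI st(1,2)] by blast
  qed
  then have 1: "ncls ?V ?Q = ncls idlP (idlP \<inter> ?Q)" 
    using ncls_eq_card[OF sQ] ncls_eq_card[OF sI T] by simp
  have "?Q \<subseteq> ?V"
    unfolding at_origin2_vimage using is_idealD(1)[OF is_ideal_idlP] by force
  then have "ncls UNIV ?Q = ncls UNIV ?V * ncls ?V ?Q"
    using sV sQ by (intro ncls_mult) (auto simp: add_subgroup_def)
  moreover have "ncls UNIV ?V = ncls UNIV (three_powers n)"
    by (rule ncls_vimage[of _ "\<lambda>r. [:[:r:]:]"]) (auto intro!: is_ideal_add_subgroup is_ideal_three_powers)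
  ultimately have 2: "(2::nat) ^ (n ^ 4) = ncls UNIV (three_powers n) * ncls idlP (idlP \<inter> ?Q)"
    using 1 ncls_par4 by simp
  let ?u = "(n - 2 ^ f) * 2 ^ f" and ?k = "ncls idlP (idlP \<inter> ?Q)"
  have le: "n * n \<le> n ^ 4 + ?u" by (cases "n = 0") (simp_all add: eval_nat_numeral trans_le_add1)
  have "?k * 2 ^ (n * n) = ?k * (ncls UNIV (three_powers n) * 2 ^ ?u)"
    unfolding ncls_three_powers[OF assms] ..
  also have "\<dots> = 2 ^ (n ^ 4) * 2 ^ ?u" unfolding 2 by (simp only: mult_ac)
  also have "\<dots> = 2 ^ (n ^ 4 + ?u - n * n) * 2 ^ (n * n)" using le by (simp add: power_add[symmetric])
  finally show ?thesis by simp
qed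

text \<open>Every strict inclusion at least doubles the index, and positivity keeps the intermediate
  indices finite. This bounds lengths of chains of submodules by a base-two logarithm.\<close>

lemma ncls_strict_chain:
  assumes C: "\<And>i. i \<le> n \<Longrightarrow> add_subgroup (C i)" "\<And>i. i < n \<Longrightarrow> C i \<subset> C (Suc i)"
    and pos: "ncls (C n) (C 0) > 0"
  shows "2 ^ n \<le> ncls (C n) (C 0)"
  using assms
proof (induction n)
  case (Suc n)
  have "C 0 \<subseteq> C j" if "j \<le> Suc n" for j
    using that
  proof (induction j)
    case (Suc j)
    then show ?case using Suc.prems \<open>\<And>i. i < Suc n \<Longrightarrow> C i \<subset> C (Suc i)\<close>[of j] by auto
  qed simp
  moreover have "C n \<subseteq> C (Suc n)" using Suc.prems(2)[of n] by blast
  ultimately have m: "ncls (C (Suc n)) (C 0) = ncls (C (Suc n)) (C n) * ncls (C n) (C 0)"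
    using Suc.prems by (intro ncls_mult) auto
  then have pos: "ncls (C (Suc n)) (C n) > 0" "ncls (C n) (C 0) > 0" using Suc.prems(3) by auto
  then have IH: "2 ^ n \<le> ncls (C n) (C 0)" using Suc by auto
  have sg: "add_subgroup (C n)" "add_subgroup (C (Suc n))" using Suc.prems by auto
  obtain T where T: "transversal (C (Suc n)) (C n) T" using transversal_exists[OF sg(1)] by blast
  have fin: "finite T" using pos(1) ncls_eq_card[OF sg(1) T] by (simp add: card_gt_0_iff)
  obtain u where u: "u \<in> C (Suc n)" "u \<notin> C n" using Suc.prems(2)[of n] by blast
  obtain s t where st: "s \<in> T" "0 - s \<in> C n" "t \<in> T" "u - t \<in> C n"
    using transversalD(2)[OF T] u(1) add_subgroupD(1)[OF sg(2)] by blast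
  have "s \<noteq> t"
  proof
    assume "s = t"
    then have "(u - t) - (0 - s) \<in> C n" using st add_subgroupD(2)[OF sg(1)] by blast
    then show False using u \<open>s = t\<close> by simp
  qed
  then have "2 \<le> card T" using card_mono[OF fin, of "{s, t}"] st by simp
  then have "2 \<le> ncls (C (Suc n)) (C n)" using ncls_eq_card[OF sg(1) T] by simp
  from mult_mono[OF this IH] show ?case by (simp add: m)
qed (simp add: Suc_leI)

subsection \<open>Rings and ideals transported along an injection\<close>

text \<open>Here \<open>g\<close> is a left inverse of the injection \<open>h\<close>.\<close>

definition ring_on :: "('k::comm_ring_1 \<Rightarrow> 'b) \<Rightarrow> ('b \<Rightarrow> 'k) \<Rightarrow> 'k set \<Rightarrow> 'b ring" where
  "ring_on h g L = \<lparr>carrier = h ` L, monoid.mult = (\<lambda>a b. h (g a * g b)), one = h 1, zero = h 0,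
     add = (\<lambda>a b. h (g a + g b))\<rparr>"

definition module_on :: "('k::comm_ring_1 \<Rightarrow> 'b) \<Rightarrow> ('b \<Rightarrow> 'k) \<Rightarrow> 'k set \<Rightarrow> ('b, 'b) module" where
  "module_on h g I = \<lparr>carrier = h ` I, monoid.mult = (\<lambda>a b. h (g a * g b)), one = h 1, zero = h 0,
     add = (\<lambda>a b. h (g a + g b)), module.smult = (\<lambda>a b. h (g a * g b))\<rparr>"

text \<open>The theorem fixes the element type \<open>nat set\<close>, whereas the ring lives in a
  fraction field. The locale pulls statements about \<open>R\<close> back along \<open>h\<close> to
  subsets of the type \<open>'k\<close>.\<close>

locale transported_ring =
  fixes h :: "'k::comm_ring_1 \<Rightarrow> 'b" and g :: "'b \<Rightarrow> 'k" and L :: "'k set"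
  assumes gh [simp]: "g (h z) = z"
    and L1: "1 \<in> L" and Ldiff: "a \<in> L \<Longrightarrow> b \<in> L \<Longrightarrow> a - b \<in> L"
    and Lmult: "a \<in> L \<Longrightarrow> b \<in> L \<Longrightarrow> a * b \<in> L"
begin

abbreviation "R \<equiv> ring_on h g L"

lemma h_eq [simp]: "h a = h b \<longleftrightarrow> a = b"
  by (metis gh)

lemma h_image_mem [simp]: "h a \<in> h ` J \<longleftrightarrow> a \<in> J"
  by auto

lemma h_image_subset [simp]: "h ` J \<subseteq> h ` J' \<longleftrightarrow> J \<subseteq> J'"
  by auto

lemma h_image_eq [simp]: "h ` J = h ` J' \<longleftrightarrow> J = J'"
  by (auto simp: set_eq_iff) (metis h_image_mem)+

lemma L0: "0 \<in> L" using Ldiff[OF L1 L1] by simp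

lemma Lneg: "a \<in> L \<Longrightarrow> - a \<in> L" using Ldiff[OF L0] by simp

lemma Ladd: "a \<in> L \<Longrightarrow> b \<in> L \<Longrightarrow> a + b \<in> L" using Ldiff[of a "- b"] Lneg by simp

lemma Lpow: "a \<in> L \<Longrightarrow> a ^ n \<in> L" by (induction n) (auto simp: L1 Lmult)

lemma R_simps [simp]:
  "carrier R = h ` L" "h a \<otimes>\<^bsub>R\<^esub> h b = h (a * b)" "h a \<oplus>\<^bsub>R\<^esub> h b = h (a + b)" "\<one>\<^bsub>R\<^esub> = h 1" "\<zero>\<^bsub>R\<^esub> = h 0"
  by (simp_all add: ring_on_def)

lemma M_simps [simp]:
  "carrier (module_on h g I) = h ` I" "h a \<odot>\<^bsub>module_on h g I\<^esub> h b = h (a * b)"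
  "h a \<oplus>\<^bsub>module_on h g I\<^esub> h b = h (a + b)" "\<zero>\<^bsub>module_on h g I\<^esub> = h 0"
  by (simp_all add: module_on_def)

lemma cring_R: "cring R"
proof (rule cringI)
  show "abelian_group R"
    by (rule abelian_groupI) (auto simp: Ladd L0 algebra_simps intro!: bexI[of _ "- _"] Lneg)
  show "comm_monoid R"
    by (rule comm_monoidI) (auto simp: Lmult L1 algebra_simps)
qed (auto simp: algebra_simps)

text \<open>Ideals of the subring \<open>L\<close>, as opposed to \<open>is_ideal\<close>, which
  refers to the whole type.\<close>

definition lideal :: "'k set \<Rightarrow> bool" where
  "lideal J \<longleftrightarrow> J \<subseteq> L \<and> 0 \<in> J \<and> (\<forall>a\<in>J. \<forall>b\<in>J. a + b \<in> J) \<and> (\<forall>l\<in>L. \<forall>a\<in>J. l * a \<in> J)"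

lemma lidealD:
  assumes "lideal J"
  shows "a \<in> J \<Longrightarrow> a \<in> L" "0 \<in> J" "a \<in> J \<Longrightarrow> b \<in> J \<Longrightarrow> a + b \<in> J" "l \<in> L \<Longrightarrow> a \<in> J \<Longrightarrow> l * a \<in> J"
    "a \<in> J \<Longrightarrow> - a \<in> J" "a \<in> J \<Longrightarrow> b \<in> J \<Longrightarrow> a - b \<in> J"
proof -
  show "a \<in> J \<Longrightarrow> a \<in> L" "0 \<in> J" and ad: "\<And>a b. a \<in> J \<Longrightarrow> b \<in> J \<Longrightarrow> a + b \<in> J"
    and m: "\<And>l a. l \<in> L \<Longrightarrow> a \<in> J \<Longrightarrow> l * a \<in> J"
    using assms by (auto simp: lideal_def)
  show n: "\<And>a. a \<in> J \<Longrightarrow> - a \<in> J" using m[OF Lneg[OF L1]] by simp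
  show "a - b \<in> J" if "a \<in> J" "b \<in> J" using ad[of a "- b"] n that by simp
qed

lemma lideal_add_subgroup: "lideal J \<Longrightarrow> add_subgroup J"
  by (auto simp: add_subgroup_def lidealD)

lemma lideal_sum: "lideal J \<Longrightarrow> (\<And>i. i \<in> A \<Longrightarrow> f i \<in> J) \<Longrightarrow> sum f A \<in> J"
  by (induction A rule: infinite_finite_induct) (auto simp: lidealD)

lemma lideal_Int: "lideal A \<Longrightarrow> lideal B \<Longrightarrow> lideal (A \<inter> B)"
  by (auto simp: lideal_def)

lemma R_a_inv: "a \<in> L \<Longrightarrow> \<ominus>\<^bsub>R\<^esub> h a = h (- a)"
proof -
  interpret cring R by (rule cring_R)
  assume "a \<in> L"
  then show ?thesis by (intro minus_equality) (auto simp: Lneg)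
qed

lemma ideal_image: "lideal J \<Longrightarrow> ideal (h ` J) R"
proof -
  interpret cring R by (rule cring_R)
  assume J: "lideal J"
  show ?thesis
  proof (rule idealI[OF ring_axioms])
    show "subgroup (h ` J) (add_monoid R)"
    proof (rule add.subgroupI)
      fix a assume "a \<in> h ` J"
      then obtain z where z: "a = h z" "z \<in> J" by auto
      then have "\<ominus>\<^bsub>R\<^esub> a = h (- z)" using R_a_inv lidealD[OF J] by simp
      then show "\<ominus>\<^bsub>R\<^esub> a \<in> h ` J" using z lidealD[OF J] by simp
    qed (use lidealD[OF J] in \<open>auto simp del: R_simps(2-) simp: ring_on_def\<close>)
    fix a x assume "a \<in> h ` J" "x \<in> carrier R"
    then obtain z l where "a = h z" "z \<in> J" "x = h l" "l \<in> L" by auto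
    then show "x \<otimes>\<^bsub>R\<^esub> a \<in> h ` J" "a \<otimes>\<^bsub>R\<^esub> x \<in> h ` J"
      using lidealD(4)[OF J, of l z] by (simp_all add: mult.commute)
  qed
qed

lemma ideal_obtain:
  assumes "ideal A R"
  obtains J where "A = h ` J" "lideal J"
proof -
  interpret ideal A R by fact
  have sub: "A \<subseteq> h ` L" using a_subset by simp
  define J where "J = h -` A"
  have A: "A = h ` J" using sub by (auto simp: J_def)
  have "lideal J"
    unfolding lideal_def
  proof (intro conjI ballI)
    show "J \<subseteq> L" using sub A by simp
    show "0 \<in> J" using additive_subgroup.zero_closed[OF is_additive_subgroup] by (simp add: J_def)
    fix a assume a: "a \<in> J"
    show "a + b \<in> J" if "b \<in> J" for b 
      using additive_subgroup.a_closed[OF is_additive_subgroup, of "h a" "h b"] a that by (simp add: J_def)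
    show "l * a \<in> J" if "l \<in> L" for l using I_l_closed[of "h a" "h l"] a that by (simp add: J_def)
  qed
  then show thesis using A that by blast
qed

lemma primeideal_image:
  "primeideal (h ` J) R \<longleftrightarrow> lideal J \<and> 1 \<notin> J \<and> (\<forall>a\<in>L. \<forall>b\<in>L. a * b \<in> J \<longrightarrow> a \<in> J \<or> b \<in> J)"
proof
  assume "primeideal (h ` J) R"
  then interpret primeideal "h ` J" R .
  have J: "lideal J" using ideal_obtain[OF is_ideal] by (metis h_image_eq)
  have "1 \<notin> J"
  proof
    assume "1 \<in> J"
    then have "J = L" using lidealD(1)[OF J] lidealD(4)[OF J, of _ 1] by auto
    then show False using I_notcarr by simp
  qed
  moreover have "a \<in> J \<or> b \<in> J" if "a \<in> L" "b \<in> L" "a * b \<in> J" for a b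
    using I_prime[of "h a" "h b"] that by simp
  ultimately show "lideal J \<and> 1 \<notin> J \<and> (\<forall>a\<in>L. \<forall>b\<in>L. a * b \<in> J \<longrightarrow> a \<in> J \<or> b \<in> J)" using J by blast
next
  assume J: "lideal J \<and> 1 \<notin> J \<and> (\<forall>a\<in>L. \<forall>b\<in>L. a * b \<in> J \<longrightarrow> a \<in> J \<or> b \<in> J)"
  show "primeideal (h ` J) R"
  proof (intro primeidealI ideal_image cring_R)
    show "carrier R \<noteq> h ` J" using J L1 by auto
    show "a \<in> h ` J \<or> b \<in> h ` J" if ab: "a \<in> carrier R" "b \<in> carrier R" "a \<otimes>\<^bsub>R\<^esub> b \<in> h ` J" for a b
    proof -
      obtain c d where "a = h c" "b = h d" "c \<in> L" "d \<in> L" using ab(1,2) by auto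
      then show ?thesis using ab(3) J by simp
    qed
  qed (use J in blast)
qed

lemma genideal_image:
  assumes "S \<subseteq> L"
  shows "\<exists>J. genideal R (h ` S) = h ` J \<and> lideal J \<and> S \<subseteq> J \<and> (\<forall>J'. lideal J' \<and> S \<subseteq> J' \<longrightarrow> J \<subseteq> J')"
proof -
  interpret cring R by (rule cring_R)
  have S: "h ` S \<subseteq> carrier R" using assms by simp
  obtain J where J: "genideal R (h ` S) = h ` J" "lideal J"
    using ideal_obtain[OF genideal_ideal[OF S]] by metis
  moreover have "S \<subseteq> J" using genideal_self[OF S] J by simp
  moreover have "J \<subseteq> J'" if "lideal J'" "S \<subseteq> J'" for J'
    using genideal_minimal[OF ideal_image[OF that(1)], of "h ` S"] that J by simp
  ultimately show ?thesis by blast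
qed

lemma module_M: "lideal I \<Longrightarrow> module R (module_on h g I)"
proof -
  assume I: "lideal I"
  show ?thesis
  proof (rule moduleI[OF cring_R])
    show "abelian_group (module_on h g I)"
      by (rule abelian_groupI) (auto simp: lidealD[OF I] algebra_simps intro!: bexI[of _ "- _"])
  qed (auto simp: lidealD[OF I] algebra_simps)
qed

lemma M_a_inv: "lideal I \<Longrightarrow> a \<in> I \<Longrightarrow> \<ominus>\<^bsub>module_on h g I\<^esub> h a = h (- a)"
proof -
  assume I: "lideal I" and a: "a \<in> I"
  interpret module R "module_on h g I" by (rule module_M[OF I])
  show ?thesis using a by (intro M.minus_equality) (auto simp: lidealD[OF I])
qed

lemma submodule_image:
  assumes I: "lideal I"
  shows "submodule (h ` J) R (module_on h g I) \<longleftrightarrow> lideal J \<and> J \<subseteq> I"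
proof
  interpret module R "module_on h g I" by (rule module_M[OF I])
  assume "lideal J \<and> J \<subseteq> I"
  then show "submodule (h ` J) R (module_on h g I)"
    by (intro submoduleI) (auto simp: lidealD M_a_inv[OF I] subset_iff)
next
  assume "submodule (h ` J) R (module_on h g I)"
  then interpret submodule "h ` J" R "module_on h g I" .
  have sub: "J \<subseteq> I" using subset by simp
  moreover have "lideal J"
    unfolding lideal_def
  proof (intro conjI ballI)
    show "J \<subseteq> L" using sub lidealD(1)[OF I] by blast
    show "0 \<in> J" using one_closed by simp
    fix a assume a: "a \<in> J"
    show "a + b \<in> J" if "b \<in> J" for b using m_closed[of "h a" "h b"] a that by simp
    show "l * a \<in> J" if "l \<in> L" for l using smult_closed[of "h l" "h a"] a that by simp
  qed
  ultimately show "lideal J \<and> J \<subseteq> I" by blast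
qed

lemma submodule_obtain:
  assumes I: "lideal I" and A: "submodule A R (module_on h g I)"
  obtains J where "A = h ` J" "lideal J" "J \<subseteq> I"
proof -
  interpret submodule A R "module_on h g I" by (rule A)
  have "A \<subseteq> h ` I" using subset by simp
  then have "A = h ` (h -` A)" by auto
  then show thesis using that submodule_image[OF I] A by metis
qed

lemma R_pow: "h a [^]\<^bsub>R\<^esub> (n::nat) = h (a ^ n)"
proof -
  interpret cring R by (rule cring_R)
  show ?thesis by (induction n) (auto simp: mult.commute)
qed

lemma R_finprod: "finite A \<Longrightarrow> (\<And>i. i \<in> A \<Longrightarrow> f i \<in> L) \<Longrightarrow> finprod R (\<lambda>i. h (f i)) A = h (prod f A)"
proof -
  interpret cring R by (rule cring_R)
  show "finite A \<Longrightarrow> (\<And>i. i \<in> A \<Longrightarrow> f i \<in> L) \<Longrightarrow> ?thesis"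
    by (induction A rule: finite_induct) (auto simp: finprod_insert Pi_def)
qed

end

subsection \<open>The localization of a domain at a maximal ideal with residue field of two elements\<close>

text \<open>In each term of the binomial expansion either the exponent of \<open>a\<close> is at
  least \<open>m\<close> or that of \<open>b\<close> exceeds \<open>n\<close>.\<close>

lemma power_add_mem_ideal:
  assumes Q: "is_ideal Q" and a: "a ^ m \<in> Q" and b: "b ^ n \<in> Q"
  shows "(a + b) ^ (m + n) \<in> Q"
  unfolding binomial_ring
proof (rule is_ideal_sum[OF Q])
  fix k
  have "a ^ k * b ^ (m + n - k) \<in> Q"
  proof (cases "k \<ge> m")
    case True
    then have "a ^ k = a ^ (k - m) * a ^ m" by (simp add: power_add[symmetric])
    then show ?thesis using is_idealD[OF Q] a by simp
  next
    case False
    then have "b ^ (m + n - k) = b ^ (m - k) * b ^ n" by (simp add: power_add[symmetric])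
    then show ?thesis using is_idealD[OF Q] b by simp
  qed
  then show "of_nat (m + n choose k) * a ^ k * b ^ (m + n - k) \<in> Q"
    using is_idealD(3)[OF Q] by (simp add: mult.assoc)
qed

lemma is_ideal_radical:
  assumes Q: "is_ideal Q"
  shows "is_ideal {a. \<exists>m. a ^ m \<in> Q}"
  unfolding is_ideal_def
proof (intro conjI ballI allI)
  show "0 \<in> {a. \<exists>m. a ^ m \<in> Q}" using is_idealD(1)[OF Q] by (auto intro: exI[of _ 1])
  fix a assume "a \<in> {a. \<exists>m. a ^ m \<in> Q}"
  then obtain m where m: "a ^ m \<in> Q" by blast
  then show "c * a \<in> {a. \<exists>m. a ^ m \<in> Q}" for c
    using is_idealD(3)[OF Q m, of "c ^ m"] by (auto simp: power_mult_distrib)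
  fix b assume "b \<in> {a. \<exists>m. a ^ m \<in> Q}"
  then show "a + b \<in> {a. \<exists>m. a ^ m \<in> Q}" using power_add_mem_ideal[OF Q m] by blast
qed

text \<open>The element \<open>1 - b\<close> is nilpotent modulo the powers, so a finite geometric
  series in \<open>1 - b\<close> inverts \<open>b\<close>.\<close>

lemma inverse_mod_gen_powers:
  fixes x :: "nat \<Rightarrow> 'a::comm_ring_1"
  assumes c: "1 - b \<in> gen x d"
  shows "\<exists>b'. 1 - b * b' \<in> gen (\<lambda>i. x i ^ n) d"
proof -
  let ?Q = "gen (\<lambda>i. x i ^ n) d"
  have "gen x d \<subseteq> {a. \<exists>m. a ^ m \<in> ?Q}"
  proof (rule gen_subset[OF is_ideal_radical[OF is_ideal_gen]])
    fix i assume "i < d"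
    then have "x i ^ n \<in> ?Q" by (rule gen_mem)
    then show "x i \<in> {a. \<exists>m. a ^ m \<in> ?Q}" by blast
  qed
  then obtain m where m: "(1 - b) ^ m \<in> ?Q" using c by blast
  have "1 - (1 - b) ^ m = b * (\<Sum>i<m. (1 - b) ^ i)" using one_diff_power_eq[of "1 - b" m] by simp
  then have "1 - b * (\<Sum>i<m. (1 - b) ^ i) = (1 - b) ^ m" by (simp add: algebra_simps)
  then show ?thesis using m by metis
qed

text \<open>Here \<open>ev\<close> is the residue map, whose kernel is the maximal ideal generated
  by the \<open>p i\<close>. With a residue field of two elements, \<open>ev b = 1\<close> says
  precisely that \<open>b\<close> lies outside this ideal.\<close>

locale localized_domain =
  fixes ev :: "'p::idom \<Rightarrow> bit" and h :: "'p fract \<Rightarrow> 'b" and g :: "'b \<Rightarrow> 'p fract"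
    and p :: "nat \<Rightarrow> 'p" and d :: nat
  assumes gh': "g (h z) = z"
    and ev_add: "ev (a + b) = ev a + ev b" and ev_mult: "ev (a * b) = ev a * ev b" and ev_1: "ev 1 = 1"
    and ker: "{a. ev a = 0} = gen p d"
    and noeth: "\<And>J :: 'p set. is_ideal J \<Longrightarrow> fin_gen_ideal J"
begin

lemma ev_0: "ev 0 = 0"
  using ev_add[of 0 0] by (cases "ev 0") auto

lemma ev_uminus: "ev (- a) = ev a"
proof -
  have "ev a + ev (- a) = 0" using ev_add[of a "- a"] ev_0 by simp
  then show ?thesis by (cases "ev a"; cases "ev (- a)") auto
qed

lemma ev_diff: "ev (a - b) = ev a - ev b"
  using ev_add[of a "- b"] ev_uminus[of b] by (cases "ev b") auto

lemma ev_nz: "ev b = 1 \<Longrightarrow> b \<noteq> 0"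
  using ev_0 by auto

definition L :: "'p fract set" where "L = {Fract a b | a b. ev b = 1}"

abbreviation iota :: "'p \<Rightarrow> 'p fract" where "iota a \<equiv> Fract a 1"

lemma iota_simps [simp]:
  "iota a + iota b = iota (a + b)" "iota a * iota b = iota (a * b)" "iota a - iota b = iota (a - b)"
  "iota a = iota b \<longleftrightarrow> a = b"
  by (simp_all add: eq_fract)

lemma iota_0: "iota 0 = 0" and iota_1: "iota 1 = 1"
  by (simp_all add: Zero_fract_def One_fract_def)

lemma iota_pow: "iota a ^ n = iota (a ^ n)"
  by (induction n) (simp_all add: iota_1)

lemma iota_prod: "(\<Prod>i\<in>A. iota (f i)) = iota (\<Prod>i\<in>A. f i)"
  by (induction A rule: infinite_finite_induct) (simp_all add: iota_1)

sublocale transported_ring h g L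
proof
  show "1 \<in> L" using ev_1 by (auto simp: L_def One_fract_def)
  fix y z assume "y \<in> L" "z \<in> L"
  then obtain a b c e where yz: "y = Fract a b" "ev b = 1" "z = Fract c e" "ev e = 1"
    by (auto simp: L_def)
  have "ev (b * e) = 1" using yz by (simp add: ev_mult)
  moreover have "y - z = Fract (a * e - c * b) (b * e)" "y * z = Fract (a * c) (b * e)"
    using yz ev_nz by simp_all
  ultimately show "y - z \<in> L" "y * z \<in> L" unfolding L_def by blast+
qed (rule gh')

lemma iota_L [simp]: "iota a \<in> L"
  using ev_1 by (auto simp: L_def)

lemma LE:
  assumes "z \<in> L"
  obtains a b where "z = Fract a b" "ev b = 1"
  using assms by (auto simp: L_def)

lemma FractL: "ev b = 1 \<Longrightarrow> Fract a b \<in> L"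
  by (auto simp: L_def)

lemma Fract_split: "ev b = 1 \<Longrightarrow> Fract a b = Fract 1 b * iota a"
  using ev_nz[of b] by simp

lemma iota_split: "ev b = 1 \<Longrightarrow> iota a = iota b * Fract a b"
  using ev_nz[of b] by (simp add: eq_fract)

text \<open>Admissible denominators are units of \<open>L\<close>, so only the numerator
  matters.\<close>

lemma lideal_Fract:
  assumes J: "lideal J" and b: "ev b = 1"
  shows "Fract a b \<in> J \<longleftrightarrow> iota a \<in> J"
proof
  assume "Fract a b \<in> J"
  from lidealD(4)[OF J iota_L this, of b] show "iota a \<in> J" by (simp only: iota_split[OF b, symmetric])
next
  assume "iota a \<in> J"
  from lidealD(4)[OF J FractL[OF b] this, of 1] show "Fract a b \<in> J" by (simp only: Fract_split[OF b, symmetric])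
qed

section \<open>Extension and contraction of ideals\<close>

definition ext :: "'p set \<Rightarrow> 'p fract set" where "ext A = {Fract a b | a b. a \<in> A \<and> ev b = 1}"

definition contr :: "'p fract set \<Rightarrow> 'p set" where "contr J = {a. iota a \<in> J}"

lemma extI: "a \<in> A \<Longrightarrow> ev b = 1 \<Longrightarrow> Fract a b \<in> ext A"
  by (auto simp: ext_def)

lemma lideal_ext:
  assumes A: "is_ideal A"
  shows "lideal (ext A)"
  unfolding lideal_def
proof (intro conjI ballI subsetI)
  show "z \<in> L" if "z \<in> ext A" for z using that by (auto simp: ext_def L_def)
  show "0 \<in> ext A" unfolding iota_0[symmetric] by (rule extI[OF is_idealD(1)[OF A] ev_1])
  fix y assume "y \<in> ext A"
  then obtain a b where y: "y = Fract a b" "a \<in> A" "ev b = 1" by (auto simp: ext_def)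
  show "z * y \<in> ext A" if z: "z \<in> L" for z
  proof -
    obtain c e where z: "z = Fract c e" "ev e = 1" using z by (rule LE)
    have "z * y = Fract (c * a) (e * b)" "ev (e * b) = 1" "c * a \<in> A"
      using y z by (simp_all add: ev_mult is_idealD[OF A])
    then show ?thesis using extI by simp
  qed
  show "y + z \<in> ext A" if z: "z \<in> ext A" for z
  proof -
    obtain c e where z: "z = Fract c e" "c \<in> A" "ev e = 1" using z by (auto simp: ext_def)
    have "y + z = Fract (a * e + c * b) (b * e)" "ev (b * e) = 1" "a * e + c * b \<in> A"
      using y z ev_nz by (simp_all add: ev_mult is_idealD[OF A])
    then show ?thesis using extI by simp
  qed
qed

lemma is_ideal_contr:
  assumes J: "lideal J"
  shows "is_ideal (contr J)"
  unfolding is_ideal_def contr_def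
proof (intro conjI ballI allI; simp only: mem_Collect_eq)
  show "iota 0 \<in> J" unfolding iota_0 by (rule lidealD(2)[OF J])
  fix a assume a: "iota a \<in> J"
  show "iota (c * a) \<in> J" for c using lidealD(4)[OF J iota_L a, of c] by simp
  show "iota (a + b) \<in> J" if "iota b \<in> J" for b using lidealD(3)[OF J a that] by simp
qed

lemma lideal_subset_iff:
  assumes "lideal J" "lideal J'"
  shows "J \<subseteq> J' \<longleftrightarrow> contr J \<subseteq> contr J'"
proof
  assume s: "contr J \<subseteq> contr J'"
  show "J \<subseteq> J'"
  proof
    fix z assume z: "z \<in> J"
    obtain a b where ab: "z = Fract a b" "ev b = 1" using lidealD(1)[OF assms(1) z] by (rule LE)
    then show "z \<in> J'" using z s lideal_Fract assms by (auto simp: contr_def)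
  qed
qed (auto simp: contr_def)

lemma subset_contr_ext: "A \<subseteq> contr (ext A)"
  using ev_1 by (auto simp: contr_def ext_def)

lemma ext_subset:
  assumes "lideal J" "A \<subseteq> contr J"
  shows "ext A \<subseteq> J"
proof
  fix z assume "z \<in> ext A"
  then obtain a b where "z = Fract a b" "a \<in> A" "ev b = 1" by (auto simp: ext_def)
  then show "z \<in> J" using assms(2) lideal_Fract[OF assms(1)] by (auto simp: contr_def)
qed

lemma contr_extE:
  assumes "a \<in> contr (ext A)" "is_ideal A"
  obtains c where "ev c = 1" "c * a \<in> A"
proof -
  obtain e b where "iota a = Fract e b" "e \<in> A" "ev b = 1" using assms by (auto simp: contr_def ext_def)
  then have "b * a = e" using ev_nz by (simp add: eq_fract mult.commute)
  then show thesis using that \<open>ev b = 1\<close> \<open>e \<in> A\<close> by blast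
qed

text \<open>If \<open>c * a \<in> Q\<close> with \<open>ev c = 1\<close>, then \<open>c\<close> is
  outside \<open>Q\<close> because \<open>Q\<close> lies in the kernel of \<open>ev\<close>, and
  primality gives \<open>a \<in> Q\<close>.\<close>

lemma contr_ext_prime:
  assumes "is_prime_ideal Q" "\<And>a. a \<in> Q \<Longrightarrow> ev a = 0"
  shows "contr (ext Q) = Q"
proof (intro equalityI subsetI)
  fix a assume "a \<in> contr (ext Q)"
  then obtain c where "ev c = 1" "c * a \<in> Q" using assms by (auto simp: is_prime_ideal_def elim: contr_extE)
  then have "c \<notin> Q" using assms(2) by fastforce
  then show "a \<in> Q" using \<open>c * a \<in> Q\<close> assms(1) by (auto simp: is_prime_ideal_def)
qed (use subset_contr_ext in blast)

text \<open>An ideal of the localization is determined by its contraction, so generators of the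
  contraction generate it.\<close>

lemma noetherian_R: "noetherian_ring R"
proof -
  interpret cring R by (rule cring_R)
  show ?thesis
  proof
    fix A assume "ideal A R"
    then obtain J where J: "A = h ` J" "lideal J" by (rule ideal_obtain)
    obtain S where S: "S \<subseteq> contr J" "finite S" "\<And>J'. is_ideal J' \<Longrightarrow> S \<subseteq> J' \<Longrightarrow> contr J \<subseteq> J'"
      using noeth[OF is_ideal_contr[OF J(2)]] unfolding fin_gen_ideal_def by metis
    have "iota ` S \<subseteq> L" by auto
    from genideal_image[OF this] obtain J' where J': "genideal R (h ` iota ` S) = h ` J'" "lideal J'" "iota ` S \<subseteq> J'"
      "\<forall>J''. lideal J'' \<and> iota ` S \<subseteq> J'' \<longrightarrow> J' \<subseteq> J''"
      by (elim exE conjE) (rule that; assumption)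
    have "J' \<subseteq> J" using J'(4) J(2) S(1) by (auto simp: contr_def)
    moreover have "J \<subseteq> J'" unfolding lideal_subset_iff[OF J(2) J'(2)]
      using J'(3) by (intro S(3) is_ideal_contr[OF J'(2)]) (auto simp: contr_def)
    ultimately have "A = genideal R (h ` iota ` S)" using J J' by simp
    moreover have "h ` iota ` S \<subseteq> carrier R" "finite (h ` iota ` S)" using S(2) by auto
    ultimately show "\<exists>A'\<subseteq>carrier R. finite A' \<and> A = genideal R A'" by blast
  qed
qed

section \<open>The maximal ideal and the dimension of the localization\<close>

definition mL :: "'p fract set" where "mL = ext {a. ev a = 0}"

lemma is_ideal_ker: "is_ideal {a. ev a = 0}"
  unfolding ker by (rule is_ideal_gen)

lemma lideal_mL: "lideal mL"
  unfolding mL_def by (rule lideal_ext[OF is_ideal_ker])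

lemma mL_Fract: "ev b = 1 \<Longrightarrow> Fract a b \<in> mL \<longleftrightarrow> ev a = 0"
proof
  assume b: "ev b = 1" and "Fract a b \<in> mL"
  then obtain c e where "Fract a b = Fract c e" "ev c = 0" "ev e = 1" by (auto simp: mL_def ext_def)
  then have "a * e = c * b" using b ev_nz by (simp add: eq_fract)
  then have "ev a * ev e = ev c * ev b" by (metis ev_mult)
  then show "ev a = 0" using \<open>ev c = 0\<close> \<open>ev e = 1\<close> by simp
qed (auto simp: mL_def intro: extI)

text \<open>A fraction whose numerator and denominator both have value \<open>1\<close> under
  \<open>ev\<close> is a unit of \<open>L\<close>.\<close>

lemma proper_lideal_subset:
  assumes J: "lideal J" and "1 \<notin> J"
  shows "J \<subseteq> mL"
proof
  fix z assume z: "z \<in> J"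
  obtain a b where ab: "z = Fract a b" "ev b = 1" using lidealD(1)[OF J z] by (rule LE)
  have "ev a \<noteq> 1"
  proof
    assume "ev a = 1"
    then have "Fract b a * z \<in> J" using lidealD(4)[OF J FractL z] by blast
    moreover have "Fract b a * z = 1" using ab \<open>ev a = 1\<close> ev_nz
      by (simp add: One_fract_def eq_fract mult.commute)
    ultimately show False using assms(2) by simp
  qed
  then show "z \<in> mL" using ab mL_Fract by simp
qed

lemma one_notin_mL: "1 \<notin> mL"
  unfolding iota_1[symmetric] using mL_Fract[OF ev_1, of 1] ev_1 by simp

lemma local_ring_R: "local_ring R (h ` mL)"
proof -
  have proper: "1 \<notin> J" if "lideal J" "h ` J \<noteq> carrier R" for J
  proof
    assume "1 \<in> J"
    then have "L \<subseteq> J" using lidealD(4)[OF that(1), of _ 1] by auto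
    then show False using that lidealD(1) by auto
  qed
  have max: "maximalideal (h ` mL) R"
  proof (rule maximalidealI[OF ideal_image[OF lideal_mL]])
    show "carrier R \<noteq> h ` mL" using one_notin_mL L1 by auto
    fix A assume A: "ideal A R" "h ` mL \<subseteq> A" "A \<subseteq> carrier R"
    obtain J where J: "A = h ` J" "lideal J" using A(1) by (rule ideal_obtain)
    show "A = h ` mL \<or> A = carrier R"
      using proper_lideal_subset[OF J(2) proper[OF J(2)]] A(2) J(1) by auto
  qed
  moreover have "A = h ` mL" if A: "maximalideal A R" for A
  proof -
    interpret maximalideal A R by fact
    obtain J where J: "A = h ` J" "lideal J" using is_ideal by (rule ideal_obtain)
    have "J \<subseteq> mL" using proper_lideal_subset[OF J(2) proper[OF J(2)]] I_notcarr J(1) by auto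
    then have "h ` mL = A \<or> h ` mL = carrier R"
      using I_maximal[OF ideal_image[OF lideal_mL]] J lidealD(1)[OF lideal_mL] by auto
    then show ?thesis using one_notin_mL L1 by auto
  qed
  ultimately show ?thesis unfolding local_ring_def using cring_R by blast
qed

lemma mL_genideal: "h ` mL = genideal R ((\<lambda>i. h (iota (p i))) ` {..<d})"
proof -
  have "(\<lambda>i. iota (p i)) ` {..<d} \<subseteq> L" by auto
  from genideal_image[OF this] obtain J where J: "genideal R (h ` (\<lambda>i. iota (p i)) ` {..<d}) = h ` J" "lideal J"
    "(\<lambda>i. iota (p i)) ` {..<d} \<subseteq> J"
    "\<forall>J'. lideal J' \<and> (\<lambda>i. iota (p i)) ` {..<d} \<subseteq> J' \<longrightarrow> J \<subseteq> J'"
    by (elim exE conjE) (rule that; assumption)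
  have "ev (p i) = 0" if "i < d" for i using gen_mem[OF that, of p] ker by auto
  then have "(\<lambda>i. iota (p i)) ` {..<d} \<subseteq> mL" using mL_Fract[OF ev_1] by auto
  then have "J \<subseteq> mL" using J(4) lideal_mL by blast
  moreover have "mL \<subseteq> J"
    unfolding mL_def ker
    using J(3) by (intro ext_subset[OF J(2)] gen_subset is_ideal_contr[OF J(2)]) (auto simp: contr_def)
  ultimately show ?thesis using J(1) by (simp add: image_image)
qed

text \<open>Contraction keeps primes and strict inclusions, so \<open>upper\<close> bounds all
  chains; extension does the same for primes inside the kernel of \<open>ev\<close>, so the given
  chain survives in the localization.\<close>

lemma krull_dim_R:
  assumes upper: "\<And>(Q :: nat \<Rightarrow> 'p set) r. (\<And>i. i \<le> r \<Longrightarrow> is_prime_ideal (Q i)) \<Longrightarrow> (\<And>i. i < r \<Longrightarrow> Q i \<subset> Q (Suc i)) \<Longrightarrow>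
      r \<le> (k::nat)"
    and lower: "\<And>i. i \<le> k \<Longrightarrow> is_prime_ideal (Q i)" "\<And>i. i < k \<Longrightarrow> Q i \<subset> Q (Suc i)"
      "\<And>i a. i \<le> k \<Longrightarrow> a \<in> Q i \<Longrightarrow> ev a = 0"
  shows "krull_dim R = enat k"
  unfolding krull_dim_def
proof (rule antisym)
  show "Sup {enat n | n P. prime_chain R P n} \<le> enat k"
  proof (rule Sup_least, clarify)
    fix n P assume P: "prime_chain R P n"
    have pr: "primeideal (P i) R" if "i \<le> n" for i using P that by (simp add: prime_chain_def)
    define J where "J i = (SOME J. P i = h ` J \<and> lideal J)" for i
    have J: "P i = h ` J i \<and> lideal (J i)" if "i \<le> n" for i
    proof -
      have "ideal (P i) R" using pr[OF that] by (rule primeideal.axioms)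
      from ideal_obtain[OF this] have "\<exists>J. P i = h ` J \<and> lideal J" by metis
      then show ?thesis unfolding J_def by (rule someI_ex)
    qed
    have "n \<le> k"
    proof (rule upper[of n "\<lambda>i. contr (J i)"])
      fix i assume i: "i \<le> n"
      then have "lideal (J i) \<and> 1 \<notin> J i \<and> (\<forall>a\<in>L. \<forall>b\<in>L. a * b \<in> J i \<longrightarrow> a \<in> J i \<or> b \<in> J i)"
        using pr[OF i] J[OF i] primeideal_image[of "J i"] by simp
      then have li: "lideal (J i)" and one: "1 \<notin> J i"
        and pri: "\<And>a b. a \<in> L \<Longrightarrow> b \<in> L \<Longrightarrow> a * b \<in> J i \<Longrightarrow> a \<in> J i \<or> b \<in> J i" by blast+
      show "is_prime_ideal (contr (J i))"
        unfolding is_prime_ideal_def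
      proof (intro conjI allI impI)
        show "is_ideal (contr (J i))" by (rule is_ideal_contr[OF li])
        show "1 \<notin> contr (J i)" using one by (simp add: contr_def iota_1)
        show "a \<in> contr (J i) \<or> b \<in> contr (J i)" if "a * b \<in> contr (J i)" for a b
          using pri[OF iota_L iota_L, of a b] that by (simp add: contr_def)
      qed
    next
      fix i assume i: "i < n"
      then have "h ` J i \<subset> h ` J (Suc i)" 
        using P J[of i] J[of "Suc i"] unfolding prime_chain_def by (metis Suc_leI less_imp_le)
      then have "J i \<subset> J (Suc i)" by (simp add: psubset_eq)
      then show "contr (J i) \<subset> contr (J (Suc i))"
        using lideal_subset_iff[of "J i" "J (Suc i)"] lideal_subset_iff[of "J (Suc i)" "J i"] J[of i] J[of "Suc i"] i
        by auto
    qed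
    then show "enat n \<le> enat k" by simp
  qed
  have "prime_chain R (\<lambda>i. h ` ext (Q i)) k"
    unfolding prime_chain_def
  proof (intro conjI allI impI)
    fix i assume i: "i \<le> k"
    have idl: "is_ideal (Q i)" using lower(1)[OF i] by (simp add: is_prime_ideal_def)
    have c: "contr (ext (Q i)) = Q i" using contr_ext_prime lower i by blast
    have mem: "Fract a b \<in> ext (Q i) \<longleftrightarrow> a \<in> Q i" if "ev b = 1" for a b
      using lideal_Fract[OF lideal_ext[OF idl] that, of a] c by (auto simp: contr_def)
    show "primeideal (h ` ext (Q i)) R"
      unfolding primeideal_image
    proof (intro conjI ballI impI)
      show "lideal (ext (Q i))" by (rule lideal_ext[OF idl])
      show "1 \<notin> ext (Q i)"
        unfolding iota_1[symmetric] using mem[OF ev_1, of 1] lower(1)[OF i] by (simp add: is_prime_ideal_def)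
      fix y z assume "y \<in> L" "z \<in> L" and yz: "y * z \<in> ext (Q i)"
      then obtain a b c e where ab: "y = Fract a b" "ev b = 1" "z = Fract c e" "ev e = 1"
        by (auto simp: L_def)
      then have "ev (b * e) = 1" by (simp add: ev_mult)
      then have "a * c \<in> Q i" using mem[of "b * e" "a * c"] ab yz by simp
      then show "y \<in> ext (Q i) \<or> z \<in> ext (Q i)"
        using lower(1)[OF i] mem ab by (auto simp: is_prime_ideal_def)
    qed
  next
    fix i assume i: "i < k"
    have "ext (Q i) \<subseteq> ext (Q (Suc i))" using lower(2)[OF i] by (auto simp: ext_def)
    moreover have "contr (ext (Q i)) = Q i" "contr (ext (Q (Suc i))) = Q (Suc i)"
      using contr_ext_prime lower i by (metis Suc_leI less_imp_le)+
    then have "ext (Q i) \<noteq> ext (Q (Suc i))" using lower(2)[OF i] by (metis psubset_eq)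
    ultimately have "ext (Q i) \<subset> ext (Q (Suc i))" by blast
    then show "h ` ext (Q i) \<subset> h ` ext (Q (Suc i))" by (simp add: psubset_eq)
  qed
  then show "enat k \<le> Sup {enat n | n P. prime_chain R P n}" by (intro Sup_upper) blast
qed

subsection \<open>Ideals as modules over the localization\<close>

abbreviation "M A \<equiv> module_on h g (ext A)"

lemma iota_ext: "a \<in> A \<Longrightarrow> iota a \<in> ext A"
  using extI ev_1 by blast

lemma iota_sum: "iota (\<Sum>i\<in>S. f i) = (\<Sum>i\<in>S. iota (f i))"
  by (induction S rule: infinite_finite_induct)
    (simp_all add: iota_0 iota_simps(1)[symmetric] del: iota_simps(1))

lemma finitely_generated_M:
  assumes A: "is_ideal A"
  shows "finitely_generated R (M A)"
proof -
  note I = lideal_ext[OF A]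
  obtain S where S: "S \<subseteq> A" "finite S" "\<And>J'. is_ideal J' \<Longrightarrow> S \<subseteq> J' \<Longrightarrow> A \<subseteq> J'"
    using noeth[OF A] unfolding fin_gen_ideal_def by metis
  let ?S = "h ` iota ` S"
  have sub: "?S \<subseteq> carrier (M A)" using S(1) iota_ext by auto
  have "span R (M A) ?S = carrier (M A)"
  proof
    have "submodule (carrier (M A)) R (M A)" using submodule_image[OF I, of "ext A"] I by simp
    then show "span R (M A) ?S \<subseteq> carrier (M A)" unfolding span_def using sub by blast
    show "carrier (M A) \<subseteq> span R (M A) ?S"
      unfolding span_def
    proof (rule Inter_greatest, clarify)
      fix H z assume H: "submodule H R (M A)" "?S \<subseteq> H" and z: "z \<in> carrier (M A)"
      obtain J where J: "H = h ` J" "lideal J" "J \<subseteq> ext A" using submodule_obtain[OF I H(1)] .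
      have "S \<subseteq> contr J" using H(2) J(1) by (auto simp: contr_def)
      then have "A \<subseteq> contr J" by (rule S(3)[OF is_ideal_contr[OF J(2)]])
      then have "ext A \<subseteq> J" by (rule ext_subset[OF J(2)])
      then show "z \<in> H" using z J(1) by auto
    qed
  qed
  then show ?thesis unfolding finitely_generated_def using S(2) sub by (intro exI[of _ ?S]) simp
qed

text \<open>A nonzero ideal of a domain has zero annihilator, so every chain of primes is admissible
  for the module.\<close>

lemma module_dim_M:
  assumes e: "e \<in> A" "e \<noteq> 0"
  shows "module_dim R (M A) = krull_dim R"
proof -
  have "ann R (M A) \<subseteq> {\<zero>\<^bsub>R\<^esub>}"
  proof
    fix y assume y: "y \<in> ann R (M A)"
    then obtain z where z: "y = h z" "z \<in> L" by (auto simp: ann_def)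
    have "h z \<odot>\<^bsub>M A\<^esub> h (iota e) = \<zero>\<^bsub>M A\<^esub>"
      using y z iota_ext[OF e(1)] unfolding ann_def by auto
    then have "z * iota e = 0" by simp
    moreover have "iota e \<noteq> 0" using e(2) iota_simps(4)[of e 0] iota_0 by simp
    ultimately show "y \<in> {\<zero>\<^bsub>R\<^esub>}" using z by simp
  qed
  moreover have "\<zero>\<^bsub>R\<^esub> \<in> P 0" if "prime_chain R P n" for P and n :: nat
  proof -
    have "primeideal (P 0) R" using that by (simp add: prime_chain_def)
    then show ?thesis
      by (meson additive_subgroup.zero_closed ideal.axioms(1) primeideal.axioms(1))
  qed
  ultimately have "prime_chain R P n \<and> ann R (M A) \<subseteq> P 0 \<longleftrightarrow> prime_chain R P n" for P and n :: nat
    by blast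
  then show ?thesis unfolding module_dim_def krull_dim_def by simp
qed

text \<open>One inclusion cancels powers of the product of the parameters in the ring, by
  \<open>power_regular\<close>. The other needs coefficients in \<open>A\<close> and not merely in
  the ring; \<open>wit\<close> supplies them for \<open>k = 2\<close>.\<close>

lemma lim_closure_M:
  assumes A: "is_ideal A" and reg: "power_regular p d"
    and wit: "\<And>a. a \<in> gen (\<lambda>i. p i ^ n) d \<Longrightarrow>
      \<exists>v. (\<forall>i<d. v i \<in> A) \<and> (\<Prod>i<d. p i) ^ (2 * n) * a = (\<Sum>i<d. p i ^ (3 * n) * v i)"
  shows "lim_closure R (M A) d (\<lambda>i. h (iota (p i)) [^]\<^bsub>R\<^esub> n) = h ` (ext A \<inter> ext (gen (\<lambda>i. p i ^ n) d))"
proof -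
  note I = lideal_ext[OF A]
  define c where "c = (\<Prod>i<d. p i)"
  have fp: "finprod R (\<lambda>i. h (iota (p i)) [^]\<^bsub>R\<^esub> n) {..<d} [^]\<^bsub>R\<^esub> k = h (iota (c ^ (n * k)))" for k :: nat
  proof -
    have "finprod R (\<lambda>i. h (iota (p i ^ n))) {..<d} = h (iota (c ^ n))"
      by (subst R_finprod) (simp_all add: iota_prod c_def prod_power_distrib)
    then show ?thesis by (simp add: R_pow iota_pow power_mult)
  qed
  define G where "G k = {(h (iota (p i)) [^]\<^bsub>R\<^esub> n) [^]\<^bsub>R\<^esub> (k + 1) \<odot>\<^bsub>M A\<^esub> v | i v. i < d \<and> v \<in> carrier (M A)}" for k :: nat
  have G: "G k = {h (iota (p i ^ (n * k + n)) * w) | i w. i < d \<and> w \<in> ext A}" for k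
  proof -
    have "(h (iota (p i)) [^]\<^bsub>R\<^esub> n) [^]\<^bsub>R\<^esub> (k + 1) \<odot>\<^bsub>M A\<^esub> h w = h (iota (p i ^ (n * k + n)) * w)" (is "?l i w = ?r i w") for i w
      by (simp only: R_pow iota_pow M_simps power_mult[symmetric]) (simp add: algebra_simps)
    moreover have "G k = {?l i w | i w. i < d \<and> w \<in> ext A}" unfolding G_def M_simps(1) by blast
    ultimately show ?thesis by simp
  qed
  have lc: "lim_closure R (M A) d (\<lambda>i. h (iota (p i)) [^]\<^bsub>R\<^esub> n) =
    {h z | z. z \<in> ext A \<and> (\<exists>k>0. h (iota (c ^ (n * k)) * z) \<in> span R (M A) (G k))}"
    unfolding lim_closure_def fp G_def[symmetric] by auto
  show ?thesis unfolding lc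
  proof (intro equalityI subsetI)
    fix y assume "y \<in> {h z | z. z \<in> ext A \<and> (\<exists>k>0. h (iota (c ^ (n * k)) * z) \<in> span R (M A) (G k))}"
    then obtain z k where y: "y = h z" "z \<in> ext A" and k: "h (iota (c ^ (n * k)) * z) \<in> span R (M A) (G k)"
      by blast
    let ?Q = "gen (\<lambda>i. p i ^ (n * k + n)) d"
    have lQ: "lideal (ext ?Q)" by (rule lideal_ext[OF is_ideal_gen])
    have "submodule (h ` (ext A \<inter> ext ?Q)) R (M A)"
      unfolding submodule_image[OF I] using lideal_Int[OF I lQ] by blast
    moreover have "G k \<subseteq> h ` (ext A \<inter> ext ?Q)"
    proof
      fix s assume "s \<in> G k"
      then obtain i w where s: "s = h (iota (p i ^ (n * k + n)) * w)" "i < d" "w \<in> ext A" unfolding G by blast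
      have "iota (p i ^ (n * k + n)) * w \<in> ext A" using lidealD(4)[OF I iota_L s(3)] .
      moreover have "w * iota (p i ^ (n * k + n)) \<in> ext ?Q"
        using lidealD(1)[OF I s(3)] gen_mem[OF s(2), of "\<lambda>i. p i ^ (n * k + n)"]
        by (intro lidealD(4)[OF lQ] iota_ext) auto
      ultimately show "s \<in> h ` (ext A \<inter> ext ?Q)" using s(1) by (simp add: mult.commute)
    qed
    ultimately have "h (iota (c ^ (n * k)) * z) \<in> h ` (ext A \<inter> ext ?Q)" using k unfolding span_def by blast
    then have 1: "iota (c ^ (n * k)) * z \<in> ext ?Q" by simp
    obtain a b where ab: "z = Fract a b" "ev b = 1" using lidealD(1)[OF I y(2)] by (rule LE)
    have "Fract (c ^ (n * k) * a) b \<in> ext ?Q" using 1 ab by simp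
    then have "c ^ (n * k) * a \<in> contr (ext ?Q)" using lideal_Fract[OF lQ ab(2)] by (simp add: contr_def)
    then obtain e where e: "ev e = 1" "e * (c ^ (n * k) * a) \<in> ?Q" using is_ideal_gen by (rule contr_extE)
    then have "c ^ (n * k) * (e * a) \<in> ?Q" by (simp add: algebra_simps)
    \<comment> \<open>The factor \<open>e\<close> only clears denominators; regularity is used with
      the exponents \<open>n * k\<close> and \<open>n\<close>.\<close>
    then have "e * a \<in> gen (\<lambda>i. p i ^ n) d" using reg by (auto simp: power_regular_def c_def)
    then have "Fract (e * a) (e * b) \<in> ext (gen (\<lambda>i. p i ^ n) d)" using e ab by (intro extI) (simp_all add: ev_mult)
    moreover have "Fract (e * a) (e * b) = z" using ab e ev_nz by (simp add: eq_fract)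
    ultimately show "y \<in> h ` (ext A \<inter> ext (gen (\<lambda>i. p i ^ n) d))" using y by simp
  next
    fix y assume "y \<in> h ` (ext A \<inter> ext (gen (\<lambda>i. p i ^ n) d))"
    then obtain z where y: "y = h z" "z \<in> ext A" "z \<in> ext (gen (\<lambda>i. p i ^ n) d)" by blast
    obtain a b where ab: "z = Fract a b" "a \<in> gen (\<lambda>i. p i ^ n) d" "ev b = 1" using y(3) by (auto simp: ext_def)
    obtain v where v: "\<And>i. i < d \<Longrightarrow> v i \<in> A" "c ^ (2 * n) * a = (\<Sum>i<d. p i ^ (3 * n) * v i)"
      using wit[OF ab(2)] unfolding c_def by blast
    \<comment> \<open>The choice \<open>k = 2\<close> turns the exponents of
      \<open>lim_closure\<close> into those of \<open>wit\<close>: \<open>n * 2\<close> on the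
      product and \<open>n * (2 + 1)\<close> on the generators.\<close>
    have "h (iota (c ^ (n * 2)) * z) \<in> H" if H: "submodule H R (M A)" "G 2 \<subseteq> H" for H
    proof -
      obtain J where J: "H = h ` J" "lideal J" "J \<subseteq> ext A" using submodule_obtain[OF I H(1)] .
      have "iota (p i ^ (3 * n)) * iota (v i) \<in> J" if "i < d" for i
      proof -
        have "iota (v i) \<in> ext A" using iota_ext[OF v(1)[OF that]] .
        then have "h (iota (p i ^ (n * 2 + n)) * iota (v i)) \<in> G 2" unfolding G using that by blast
        then have "h (iota (p i ^ (n * 2 + n)) * iota (v i)) \<in> h ` J" using H(2) J(1) by blast
        moreover have "n * 2 + n = 3 * n" by simp
        ultimately show ?thesis by (simp only: h_image_mem)
      qed
      then have "(\<Sum>i<d. iota (p i ^ (3 * n)) * iota (v i)) \<in> J" by (intro lideal_sum[OF J(2)]) simp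
      then have "iota (c ^ (2 * n) * a) \<in> J" unfolding v(2) iota_sum by simp
      then have "Fract (c ^ (2 * n) * a) b \<in> J" using lideal_Fract[OF J(2) ab(3)] by simp
      moreover have "iota (c ^ (n * 2)) * z = Fract (c ^ (2 * n) * a) b" by (simp add: ab(1) mult.commute)
      ultimately show ?thesis using J(1) by simp
    qed
    then have "h (iota (c ^ (n * 2)) * z) \<in> span R (M A) (G 2)" unfolding span_def by blast
    then show "y \<in> {h z | z. z \<in> ext A \<and> (\<exists>k>0. h (iota (c ^ (n * k)) * z) \<in> span R (M A) (G k))}"
      using y by (intro CollectI exI[of _ z]) (auto intro!: exI[of _ 2])
  qed
qed

text \<open>Each element of the maximal ideal is nilpotent modulo the ideal of powers, so
  denominators are invertible there even before localizing, and representatives in \<open>A\<close>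
  stay representatives.\<close>

lemma ncls_ext:
  assumes A: "is_ideal A"
  shows "ncls (ext A) (ext A \<inter> ext (gen (\<lambda>i. p i ^ n) d)) = ncls A (A \<inter> gen (\<lambda>i. p i ^ n) d)"
proof -
  let ?Q = "gen (\<lambda>i. p i ^ n) d"
  note Q = is_idealD[OF is_ideal_gen[of "\<lambda>i. p i ^ n" d]]
  have lI: "lideal (ext A \<inter> ext ?Q)" by (intro lideal_Int lideal_ext A is_ideal_gen)
  have sg: "add_subgroup (ext A \<inter> ext ?Q)" "add_subgroup (A \<inter> ?Q)"
    by (auto intro!: lideal_add_subgroup[OF lI] is_ideal_add_subgroup is_ideal_Int A is_ideal_gen)
  have inv: "\<exists>b'. 1 - b * b' \<in> ?Q" if "ev b = 1" for b
  proof (rule inverse_mod_gen_powers)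
    have "ev (1 - b) = 0" using that by (simp add: ev_diff ev_1)
    then show "1 - b \<in> gen p d" using ker by auto
  qed
  obtain T where T: "transversal A (A \<inter> ?Q) T" using transversal_exists[OF sg(2)] by blast
  have "transversal (ext A) (ext A \<inter> ext ?Q) (iota ` T)"
  proof (rule transversalI[OF sg(1)])
    show "iota ` T \<subseteq> ext A" using transversalD(1)[OF T] iota_ext by auto
    fix u assume "u \<in> ext A"
    then obtain a b where u: "u = Fract a b" "a \<in> A" "ev b = 1" by (auto simp: ext_def)
    \<comment> \<open>The fraction \<open>a / b\<close> will be represented by
      \<open>a * b'\<close>, with \<open>b'\<close> an inverse of \<open>b\<close> modulo the
      powers.\<close>
    obtain b' where b': "1 - b * b' \<in> ?Q" using inv[OF u(3)] by blast
    have "a * b' \<in> A" using is_idealD(4)[OF A u(2)] .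
    then obtain t where t: "t \<in> T" "a * b' - t \<in> A \<inter> ?Q" using transversalD(2)[OF T] by blast
    have "a * (1 - b * b') \<in> A" "a * (1 - b * b') \<in> ?Q" using is_idealD(4)[OF A u(2)] Q(3)[OF b'] by blast+
    then have 1: "Fract (a * (1 - b * b')) b \<in> ext A \<inter> ext ?Q" using extI u(3) by blast
    have 2: "iota (a * b' - t) \<in> ext A \<inter> ext ?Q" using t(2) iota_ext by blast
    have "u - iota t = Fract (a * (1 - b * b')) b + iota (a * b' - t)"
      using ev_nz[OF u(3)] by (simp add: u(1) eq_fract algebra_simps)
    then have "u - iota t \<in> ext A \<inter> ext ?Q" using lidealD(3)[OF lI 1 2] by simp
    then show "\<exists>t\<in>iota ` T. u - t \<in> ext A \<inter> ext ?Q" using t(1) by blast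
  next
    fix s' t' assume "s' \<in> iota ` T" "t' \<in> iota ` T" "s' - t' \<in> ext A \<inter> ext ?Q"
    then obtain s t where st: "s' = iota s" "t' = iota t" "s \<in> T" "t \<in> T" "iota (s - t) \<in> ext ?Q" by auto
    then have "s - t \<in> contr (ext ?Q)" by (simp add: contr_def)
    then obtain c where c: "ev c = 1" "c * (s - t) \<in> ?Q" using is_ideal_gen by (rule contr_extE)
    obtain c' where c': "1 - c * c' \<in> ?Q" using inv[OF c(1)] by blast
    have "s - t = (s - t) * (1 - c * c') + c' * (c * (s - t))" by (simp add: algebra_simps)
    then have "s - t \<in> ?Q" using Q(2)[OF Q(3)[OF c'] Q(3)[OF c(2)]] by metis
    moreover have "s - t \<in> A" using transversalD(1)[OF T] st is_idealD(6)[OF A] by blast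
    ultimately show "s' = t'" using transversal_inj[OF T sg(2)] st by blast
  qed
  moreover have "card (iota ` T) = card T" by (intro card_image inj_onI) simp
  ultimately show ?thesis using ncls_eq_card[OF sg(1)] ncls_eq_card[OF sg(2) T] by metis
qed

text \<open>The generators of the maximal ideal are handled one after another: the last multiple of
  \<open>u\<close> by a power of \<open>p j\<close> before entering \<open>N\<close> is killed by
  \<open>p j\<close> modulo \<open>N\<close>, and it stays killed by the earlier generators.\<close>

lemma socle_element:
  assumes I: "lideal I" and N: "lideal N" "N \<subset> I"
    and nil: "\<And>i u. i < d \<Longrightarrow> u \<in> I \<Longrightarrow> \<exists>a. iota (p i) ^ a * u \<in> N"
  shows "\<exists>u\<in>I. u \<notin> N \<and> (\<forall>l\<in>mL. l * u \<in> N)"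
proof -
  have "j \<le> d \<Longrightarrow> \<exists>u\<in>I. u \<notin> N \<and> (\<forall>i<j. iota (p i) * u \<in> N)" for j
  proof (induction j)
    case 0
    then show ?case using N(2) by blast
  next
    case (Suc j)
    then obtain u where u: "u \<in> I" "u \<notin> N" "\<And>i. i < j \<Longrightarrow> iota (p i) * u \<in> N" by auto
    define a where "a = (LEAST a. iota (p j) ^ a * u \<in> N)"
    have "\<exists>a. iota (p j) ^ a * u \<in> N" using nil[of j u] u(1) Suc.prems by simp
    then have a: "iota (p j) ^ a * u \<in> N" unfolding a_def by (rule LeastI_ex)
    have "a \<noteq> 0" using a u(2) by (intro notI) simp
    then obtain b where b: "a = Suc b" using not0_implies_Suc by blast
    define w where "w = iota (p j) ^ b * u"
    have "w \<notin> N" using not_less_Least[of b "\<lambda>a. iota (p j) ^ a * u \<in> N"] b by (auto simp: a_def[symmetric] w_def)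
    moreover have "w \<in> I" unfolding w_def by (intro lidealD(4)[OF I] Lpow u iota_L)
    moreover have "iota (p i) * w \<in> N" if i: "i < Suc j" for i
    proof (cases "i = j")
      case True
      then show ?thesis using a by (simp add: b w_def mult.assoc)
    next
      case False
      then have "iota (p j) ^ b * (iota (p i) * u) \<in> N"
        using i u(3) by (intro lidealD(4)[OF N(1) Lpow[OF iota_L]]) simp
      then show ?thesis unfolding w_def by (simp only: mult.left_commute)
    qed
    ultimately show ?case by blast
  qed
  then obtain u where u: "u \<in> I" "u \<notin> N" "\<And>i. i < d \<Longrightarrow> iota (p i) * u \<in> N" by auto
  have K: "lideal {l \<in> L. l * u \<in> N}"
    using lidealD[OF N(1)] by (auto simp: lideal_def L0 Ladd Lmult distrib_right mult.assoc)
  have "mL \<subseteq> {l \<in> L. l * u \<in> N}"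
    unfolding mL_def ker
    by (intro ext_subset[OF K] gen_subset is_ideal_contr[OF K]) (simp add: contr_def u(3))
  then show ?thesis using u by blast
qed

text \<open>Adding a socle element \<open>u\<close> to \<open>N\<close> gives \<open>N'\<close> with
  \<open>N' / N\<close> isomorphic to the residue field of two elements, so each step halves the
  index that remains.\<close>

lemma composition_chain:
  assumes I: "lideal I" and N: "lideal N" "N \<subseteq> I" and r: "ncls I N = 2 ^ r"
    and nil: "\<And>i u. i < d \<Longrightarrow> u \<in> I \<Longrightarrow> \<exists>a. iota (p i) ^ a * u \<in> N"
  shows "\<exists>C. (\<forall>i\<le>r. lideal (C i) \<and> C i \<subseteq> I) \<and> C 0 = N \<and> C r = I \<and> (\<forall>i<r. C i \<subset> C (Suc i))"
  using N r nil
proof (induction r arbitrary: N)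
  case 0
  then have "N = I" using ncls_eq_1[OF lideal_add_subgroup[OF I] lideal_add_subgroup[OF 0(1)]] by simp
  then show ?case using I by (intro exI[of _ "\<lambda>_. I"]) simp
next
  case (Suc r)
  note sN = lideal_add_subgroup[OF Suc.prems(1)]
  have "N \<noteq> I"
  proof
    assume "N = I"
    then have "transversal I N {0}" using lidealD[OF I] by (intro transversalI[OF sN]) auto
    then show False using ncls_eq_card[OF sN] Suc.prems(3) by fastforce
  qed
  then obtain u where u: "u \<in> I" "u \<notin> N" "\<And>l. l \<in> mL \<Longrightarrow> l * u \<in> N"
    using socle_element[OF I Suc.prems(1) _ Suc.prems(4)] Suc.prems(2) by blast
  define N' where "N' = {v + l * u | v l. v \<in> N \<and> l \<in> L}"
  have N'I: "v + l * u \<in> N'" if "v \<in> N" "l \<in> L" for v l using that unfolding N'_def by blast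
  have N': "lideal N'"
    unfolding lideal_def
  proof (intro conjI ballI subsetI)
    show "z \<in> L" if "z \<in> N'" for z
      using that lidealD(1)[OF I u(1)] lidealD(1)[OF Suc.prems(1)] unfolding N'_def by (auto intro: Ladd Lmult)
    show "0 \<in> N'" using N'I[OF lidealD(2)[OF Suc.prems(1)] L0] by simp
    fix y assume "y \<in> N'"
    then obtain v l where y: "y = v + l * u" "v \<in> N" "l \<in> L" unfolding N'_def by blast
    show "k * y \<in> N'" if "k \<in> L" for k
      using N'I[OF lidealD(4)[OF Suc.prems(1) that y(2)] Lmult[OF that y(3)]] by (simp add: y(1) algebra_simps)
    fix z assume "z \<in> N'"
    then obtain w k where z: "z = w + k * u" "w \<in> N" "k \<in> L" unfolding N'_def by blast
    show "y + z \<in> N'"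
      using N'I[OF lidealD(3)[OF Suc.prems(1) y(2) z(2)] Ladd[OF y(3) z(3)]] by (simp add: y(1) z(1) algebra_simps)
  qed
  have NN': "N \<subseteq> N'" using N'I[OF _ L0] by auto
  have uN': "u \<in> N'" using N'I[OF lidealD(2)[OF Suc.prems(1)] L1] by simp
  have N'sub: "N' \<subseteq> I"
    unfolding N'_def using Suc.prems(2) lidealD(4)[OF I _ u(1)] by (auto intro!: lidealD(3)[OF I])
  \<comment> \<open>Every \<open>l \<in> L\<close> is congruent to \<open>0\<close> or
    \<open>1\<close> modulo \<open>mL\<close>, and \<open>mL\<close> sends \<open>u\<close> into
    \<open>N\<close>.\<close>
  have "transversal N' N {0, u}"
  proof (rule transversalI[OF sN])
    show "{0, u} \<subseteq> N'" using uN' lidealD(2)[OF N'] by simp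
    fix y assume "y \<in> N'"
    then obtain v l where y: "y = v + l * u" "v \<in> N" "l \<in> L" unfolding N'_def by blast
    obtain a b where ab: "l = Fract a b" "ev b = 1" using y(3) by (rule LE)
    show "\<exists>t\<in>{0, u}. y - t \<in> N"
    proof (cases "ev a = 0")
      case True
      then have "l \<in> mL" using mL_Fract[OF ab(2)] ab(1) by simp
      then show ?thesis using lidealD(3)[OF Suc.prems(1) y(2) u(3)] y(1) by simp
    next
      case False
      then have "ev (a - b) = 0" using ab(2) by (simp add: ev_diff)
      then have "Fract (a - b) b \<in> mL" using mL_Fract[OF ab(2)] by simp
      moreover have "Fract (a - b) b = l - 1" using ab ev_nz[OF ab(2)] by (simp add: One_fract_def eq_fract)
      ultimately have "v + (l - 1) * u \<in> N" using lidealD(3)[OF Suc.prems(1) y(2) u(3)] by simp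
      then show ?thesis by (simp add: y(1) algebra_simps)
    qed
  next
    fix s t assume "s \<in> {0, u}" "t \<in> {0, u}" "s - t \<in> N"
    then show "s = t" using u(2) lidealD(5)[OF Suc.prems(1), of "- u"] by auto
  qed
  moreover have "u \<noteq> 0" using u(2) lidealD(2)[OF Suc.prems(1)] by blast
  ultimately have "ncls N' N = 2" using ncls_eq_card[OF sN] by fastforce
  then have "ncls I N' * 2 = 2 ^ Suc r"
    using ncls_mult[OF lideal_add_subgroup[OF I] lideal_add_subgroup[OF N'] sN N'sub NN'] Suc.prems(3) by simp
  then have "ncls I N' = 2 ^ r" by simp
  moreover have "\<exists>a. iota (p i) ^ a * u \<in> N'" if "i < d" "u \<in> I" for i u
    using Suc.prems(4)[OF that] NN' by blast
  ultimately obtain C where C: "\<And>i. i \<le> r \<Longrightarrow> lideal (C i) \<and> C i \<subseteq> I" "C 0 = N'" "C r = I"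
    "\<And>i. i < r \<Longrightarrow> C i \<subset> C (Suc i)"
    using Suc.IH[OF N' N'sub] by metis
  define C' where "C' i = (case i of 0 \<Rightarrow> N | Suc j \<Rightarrow> C j)" for i
  have "lideal (C' i) \<and> C' i \<subseteq> I" if "i \<le> Suc r" for i
    using that C(1) Suc.prems by (cases i) (auto simp: C'_def)
  moreover have "C' i \<subset> C' (Suc i)" if "i < Suc r" for i
  proof (cases i)
    case 0
    then show ?thesis using NN' uN' u(2) by (auto simp: C'_def C(2))
  qed (use that C(4) in \<open>auto simp: C'_def\<close>)
  moreover have "C' 0 = N" "C' (Suc r) = I" by (simp_all add: C'_def C(3))
  ultimately show ?case by blast
qed

text \<open>Strict inclusions at least double the index, so \<open>r\<close> bounds the length of
  every chain, and the composition chain reaches this bound.\<close>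

lemma quot_length_M:
  assumes A: "is_ideal A" and N: "lideal N" "N \<subseteq> ext A" and r: "ncls (ext A) N = 2 ^ r"
    and nil: "\<And>i u. i < d \<Longrightarrow> u \<in> ext A \<Longrightarrow> \<exists>a. iota (p i) ^ a * u \<in> N"
  shows "quot_length R (M A) (h ` N) = enat r"
  unfolding quot_length_def
proof (rule antisym)
  note I = lideal_ext[OF A]
  show "Sup {enat n | n C. (\<forall>i\<le>n. submodule (C i) R (M A)) \<and> C 0 = h ` N \<and> C n = carrier (M A) \<and>
    (\<forall>i<n. C i \<subset> C (Suc i))} \<le> enat r"
  proof (rule Sup_least, clarify)
    fix n C assume C: "\<forall>i\<le>n. submodule (C i) R (M A)" "C 0 = h ` N" "C n = carrier (M A)"
      "\<forall>i<n. C i \<subset> C (Suc i)"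
    have "\<exists>J. C i = h ` J \<and> lideal J" if "i \<le> n" for i using C(1) that submodule_obtain[OF I] by metis
    then obtain J where J: "\<And>i. i \<le> n \<Longrightarrow> C i = h ` J i \<and> lideal (J i)" by metis
    have J0: "J 0 = N" and Jn: "J n = ext A" using J[of 0] J[of n] C(2,3) by auto
    have "2 ^ n \<le> ncls (J n) (J 0)"
    proof (rule ncls_strict_chain)
      show "add_subgroup (J i)" if "i \<le> n" for i using J[OF that] lideal_add_subgroup by blast
      show "J i \<subset> J (Suc i)" if "i < n" for i
      proof -
        have "h ` J i \<subset> h ` J (Suc i)" using C(4) J[of i] J[of "Suc i"] that by (metis Suc_leI less_imp_le)
        then show ?thesis by (simp add: psubset_eq)
      qed
      show "ncls (J n) (J 0) > 0" using r J0 Jn by simp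
    qed
    then have "n \<le> r" using r J0 Jn by simp
    then show "enat n \<le> enat r" by simp
  qed
  obtain C where C: "\<forall>i\<le>r. lideal (C i) \<and> C i \<subseteq> ext A" "C 0 = N" "C r = ext A" "\<forall>i<r. C i \<subset> C (Suc i)"
    using composition_chain[OF I N r nil] by blast
  have "\<forall>i\<le>r. submodule (h ` C i) R (M A)" using C(1) submodule_image[OF I] by blast
  moreover have "\<forall>i<r. h ` C i \<subset> h ` C (Suc i)" using C(4) by (simp add: psubset_eq)
  ultimately show "enat r \<le> Sup {enat n | n C. (\<forall>i\<le>n. submodule (C i) R (M A)) \<and> C 0 = h ` N \<and>
    C n = carrier (M A) \<and> (\<forall>i<n. C i \<subset> C (Suc i))}"
    using C(2,3) by (intro Sup_upper CollectI exI[of _ r] exI[of _ "\<lambda>i. h ` C i"]) auto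
qed

end

subsection \<open>The polynomial ring in four variables over the field with two elements\<close>

lemma ex_inj_poly:
  assumes "inj (f :: 'a::zero \<Rightarrow> nat)"
  shows "\<exists>f' :: 'a poly \<Rightarrow> nat. inj f'"
proof
  show "inj (\<lambda>p. to_nat (map f (coeffs p)))"
    using assms by (intro injI) (simp add: inj_map_eq_map coeffs_eq_iff)
qed

lemma ex_inj_fract:
  assumes "inj (f :: 'a::idom \<Rightarrow> nat)"
  shows "\<exists>f' :: 'a fract \<Rightarrow> nat. inj f'"
proof -
  have "\<forall>z :: 'a fract. \<exists>a b. z = Fract a b" by (metis Fract_cases)
  then obtain u v where uv: "\<And>z :: 'a fract. z = Fract (u z) (v z)" by metis
  have "inj (\<lambda>z. to_nat (f (u z), f (v z)))"
  proof (rule injI)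
    fix y z assume "to_nat (f (u y), f (v y)) = to_nat (f (u z), f (v z))"
    then have "u y = u z" "v y = v z" using assms by (auto simp: inj_eq)
    then show "y = z" using uv[of y] uv[of z] by simp
  qed
  then show ?thesis by blast
qed

text \<open>The fraction field is countable, being obtained from a finite field by adjoining
  variables and forming fractions; singletons of codes turn this into an embedding in the required
  type.\<close>

lemma ex_inj_nat_set: "\<exists>f :: bpoly4 fract \<Rightarrow> nat set. inj f"
proof -
  have "inj (\<lambda>b :: bit. if b = 0 then 0 else 1 :: nat)"
    by (intro injI) (auto split: if_splits)
  then obtain f1 :: "bit poly \<Rightarrow> nat" where "inj f1" using ex_inj_poly by blast
  then obtain f2 :: "bpoly2 \<Rightarrow> nat" where "inj f2" using ex_inj_poly by blast
  then obtain f3 :: "bpoly2 poly \<Rightarrow> nat" where "inj f3" using ex_inj_poly by blast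
  then obtain f4 :: "bpoly4 \<Rightarrow> nat" where "inj f4" using ex_inj_poly by blast
  then obtain f :: "bpoly4 fract \<Rightarrow> nat" where "inj f" using ex_inj_fract by blast
  then have "inj (\<lambda>z. {f z})" by (simp add: inj_def)
  then show ?thesis by blast
qed

lemma fin_gen_ideal_bpoly4: "is_ideal (J :: bpoly4 set) \<Longrightarrow> fin_gen_ideal J"
  by (intro hilbert_basis fin_gen_ideal_field)

section \<open>The residue map and the chain of coordinate primes\<close>

definition ev4 :: "bpoly4 \<Rightarrow> bit" where "ev4 p = coeff (coeff (at_origin2 p) 0) 0"

lemma ev4_simps:
  "ev4 (p + q) = ev4 p + ev4 q" "ev4 (p - q) = ev4 p - ev4 q" "ev4 (p * q) = ev4 p * ev4 q" "ev4 1 = 1"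
  by (simp_all add: ev4_def coeff_mult_0)

text \<open>The parameters vanish at the origin, which gives one inclusion; both ideals have index
  \<open>2\<close>, which forces equality.\<close>

lemma ker_ev4: "{p. ev4 p = 0} = gen par4 4"
proof -
  have idl: "is_ideal {p. ev4 p = 0}" by (simp add: is_ideal_def ev4_simps) (simp add: ev4_def)
  have s: "add_subgroup {p. ev4 p = 0}" "add_subgroup (gen par4 4)"
    using idl is_ideal_gen by (blast intro: is_ideal_add_subgroup)+
  have "ev4 (par4 i) = 0" if "i < 4" for i
  proof -
    from that consider "i = 0" | "i = 1" | "i = 2" | "i = 3" by linarith
    then show ?thesis by cases (simp_all only: ev4_def at_origin2_par4, simp_all)
  qed
  then have sub: "gen par4 4 \<subseteq> {p. ev4 p = 0}" by (intro gen_subset[OF idl]) simp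
  have "{p. ev4 p = 0} = ev4 -` {0}" by auto
  also have "ncls UNIV (ev4 -` {0}) = ncls UNIV {0 :: bit}"
    by (rule ncls_vimage[where s = "\<lambda>b. [:[:[:[:b:]:]:]:]"])
      (simp_all only: ev4_simps, simp_all add: ev4_def add_subgroup_def)
  finally have "ncls UNIV {p. ev4 p = 0} = 2" by (simp add: ncls_bit)
  moreover have "ncls UNIV (gen par4 4) = 2" using ncls_par4[of 1] by simp
  moreover have "ncls UNIV (gen par4 4) = ncls UNIV {p. ev4 p = 0} * ncls {p. ev4 p = 0} (gen par4 4)"
    using s sub by (intro ncls_mult) (auto simp: add_subgroup_def)
  ultimately have "ncls {p. ev4 p = 0} (gen par4 4) = 1" by simp
  then show ?thesis using ncls_eq_1[OF s sub] by simp
qed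

text \<open>The constant filtration of the field of two elements has growth exponent
  \<open>0\<close>, and each of the four variables adds one.\<close>

lemma bpoly4_chain_le:
  assumes "\<And>i. i \<le> r \<Longrightarrow> is_prime_ideal (Q i :: bpoly4 set)" "\<And>i. i < r \<Longrightarrow> Q i \<subset> Q (Suc i)"
  shows "r \<le> 4"
proof -
  define D0 :: "nat \<Rightarrow> bit set" where "D0 n = UNIV" for n
  have "UNIV = {0 :: bit, 1}" by (auto intro: bit.exhaust)
  then have U: "finite (UNIV :: bit set)" "card (UNIV :: bit set) \<le> 2"
    by (metis finite.emptyI finite.insertI, metis card_2_iff order_refl zero_neq_one)
  have f0: "filtration D0" using U by (auto simp: filtration_def D0_def add_subgroup_def mono_def)
  have g0: "growth_le (\<lambda>n. card (D0 n)) 0" using U by (auto simp: growth_le_def D0_def intro!: exI[of _ 1])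
  note f1 = filtration_poly[OF f0] and g1 = growth_poly_filtration[OF f0 g0]
  note f2 = filtration_poly[OF f1] and g2 = growth_poly_filtration[OF f1 g1]
  note f3 = filtration_poly[OF f2] and g3 = growth_poly_filtration[OF f2 g2]
  note f4 = filtration_poly[OF f3] and g4 = growth_poly_filtration[OF f3 g3]
  have "r \<le> Suc (Suc (Suc (Suc 0)))"
    by (rule prime_chain_length_le[OF f4 g4, of r Q]) (use assms in auto)
  then show ?thesis by simp
qed

lemma is_prime_ideal_kernel:
  fixes f :: "'a::comm_ring_1 \<Rightarrow> 'b::idom"
  assumes "\<And>a b. f (a + b) = f a + f b" "\<And>a b. f (a * b) = f a * f b" "f 1 = 1"
  shows "is_prime_ideal {a. f a = 0}"
proof -
  have "f 0 = 0" by (metis add.right_neutral add_left_cancel assms(1))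
  then show ?thesis by (auto simp: is_prime_ideal_def is_ideal_def assms)
qed

text \<open>The chain \<open>0\<close>, \<open>(w)\<close>, \<open>(t, w)\<close>,
  \<open>(y, t, w)\<close>, \<open>(x, y, t, w)\<close>, described by kernels so that primality
  comes from the target being a domain.\<close>

definition chain4 :: "nat \<Rightarrow> bpoly4 set" where
  "chain4 i = (if i = 0 then {p. p = 0} else if i = 1 then {p. coeff p 0 = 0}
     else if i = 2 then {p. at_origin2 p = 0} else if i = 3 then {p. coeff (at_origin2 p) 0 = 0}
     else {p. ev4 p = 0})"

lemma chain4_prime: "is_prime_ideal (chain4 i)"
proof -
  have "is_prime_ideal {p :: bpoly4. p = 0}" "is_prime_ideal {p :: bpoly4. coeff p 0 = 0}"
    "is_prime_ideal {p. at_origin2 p = 0}" "is_prime_ideal {p. coeff (at_origin2 p) 0 = 0}"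
    "is_prime_ideal {p. ev4 p = 0}"
    by (rule is_prime_ideal_kernel; simp add: coeff_mult_0 ev4_simps)+
  then show ?thesis by (simp add: chain4_def)
qed

lemma chain4_strict:
  assumes "i < 4"
  shows "chain4 i \<subset> chain4 (Suc i)"
proof -
  have "chain4 i \<subseteq> chain4 (Suc i)" using assms by (auto simp: chain4_def at_origin2_def ev4_def)
  moreover have "\<exists>p. p \<in> chain4 (Suc i) \<and> p \<notin> chain4 i"
  proof -
    from assms consider "i = 0" | "i = 1" | "i = 2" | "i = 3" by linarith
    then show ?thesis
    proof cases
      case 1 then show ?thesis by (intro exI[of _ "[:0, 1:]"]) (simp add: chain4_def)
    next
      case 2 then show ?thesis by (intro exI[of _ "[:[:0, 1:]:]"]) (simp add: chain4_def at_origin2_def)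
    next
      case 3 then show ?thesis by (intro exI[of _ "[:[:[:0, 1:]:]:]"]) (simp add: chain4_def)
    next
      case 4 then show ?thesis by (intro exI[of _ "[:[:[:[:0, 1:]:]:]:]"]) (simp add: chain4_def ev4_def)
    qed
  qed
  ultimately show ?thesis by blast
qed

lemma chain4_ker: "p \<in> chain4 i \<Longrightarrow> ev4 p = 0"
  by (auto simp: chain4_def at_origin2_def ev4_def split: if_splits)

text \<open>The reason is that every monomial of \<open>(x + y)\<^bsup>2n\<^esup>\<close> is divisible by \<open>x\<^sup>n\<close> or \<open>y\<^sup>n\<close>.\<close>

lemma power_par2_product:
  "par2 0 ^ (2 * n) * par2 1 ^ (2 * n) * (par2 0 + par2 1) ^ (2 * n) \<in> gen (\<lambda>i. par2 i ^ (3 * n)) 2"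
proof -
  let ?x = "par2 0" and ?y = "par2 1" and ?Q = "gen (\<lambda>i. par2 i ^ (3 * n)) 2"
  note Q = is_idealD[OF is_ideal_gen[of "\<lambda>i. par2 i ^ (3 * n)" 2]]
  \<comment> \<open>A colon ideal: as it contains \<open>x ^ n\<close> and \<open>y ^ n\<close>, it
    also contains \<open>(x + y) ^ (n + n)\<close>.\<close>
  let ?J = "{p. ?x ^ (2 * n) * ?y ^ (2 * n) * p \<in> ?Q}"
  have J: "is_ideal ?J"
    unfolding is_ideal_def using Q(1,2) Q(3)
    by (simp add: distrib_left) (metis mult.left_commute)
  have xy: "?x ^ (3 * n) \<in> ?Q" "?y ^ (3 * n) \<in> ?Q"
    using gen_mem[of 0 2 "\<lambda>i. par2 i ^ (3 * n)"] gen_mem[of 1 2 "\<lambda>i. par2 i ^ (3 * n)"] by simp_all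
  have "?x ^ (2 * n) * ?y ^ (2 * n) * ?x ^ n = ?y ^ (2 * n) * ?x ^ (3 * n)"
    "?x ^ (2 * n) * ?y ^ (2 * n) * ?y ^ n = ?x ^ (2 * n) * ?y ^ (3 * n)"
    by (simp_all add: power_add[symmetric] mult.assoc mult.left_commute)
  then have "?x ^ n \<in> ?J" "?y ^ n \<in> ?J" 
    using Q(3)[OF xy(1)] Q(3)[OF xy(2)] by (simp_all only: mem_Collect_eq)
  from power_add_mem_ideal[OF J this] show ?thesis by (simp add: mult_2)
qed

text \<open>The multiples of \<open>x ^ n\<close>, \<open>y ^ n\<close> and \<open>z ^ n\<close> get
  coefficients with a factor \<open>w ^ (2 * n)\<close>, which lies in \<open>(t, w)\<close>. For a
  multiple of \<open>w ^ n\<close>, the factor \<open>(x * y * z) ^ (2 * n)\<close> is rewritten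
  modulo \<open>(t, w)\<close> as a combination of \<open>x ^ (3 * n)\<close> and
  \<open>y ^ (3 * n)\<close>.\<close>

lemma par4_witness:
  assumes n: "n \<ge> 1" and a: "a \<in> gen (\<lambda>i. par4 i ^ n) 4"
  shows "\<exists>v. (\<forall>i<4. v i \<in> idlP) \<and> (\<Prod>i<4. par4 i) ^ (2 * n) * a = (\<Sum>i<4. par4 i ^ (3 * n) * v i)"
proof -
  define x y z w where "x = par4 0" and "y = par4 1" and "z = par4 2" and "w = par4 3"
  obtain r where "a = (\<Sum>i<4. par4 i ^ n * r i)" using a by (auto simp: gen_def)
  then have r: "a = x ^ n * r 0 + y ^ n * r 1 + z ^ n * r 2 + w ^ n * r 3"
    by (simp add: eval_nat_numeral x_def y_def z_def w_def)
  have pr: "(\<Prod>i<4. par4 i) = x * y * z * w"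
    by (simp add: eval_nat_numeral x_def y_def z_def w_def)
  obtain s where "par2 0 ^ (2 * n) * par2 1 ^ (2 * n) * (par2 0 + par2 1) ^ (2 * n) = (\<Sum>i<2. par2 i ^ (3 * n) * s i)"
    using power_par2_product[of n] by (auto simp: gen_def)
  then have s: "par2 0 ^ (2 * n) * par2 1 ^ (2 * n) * (par2 0 + par2 1) ^ (2 * n) =
      par2 0 ^ (3 * n) * s 0 + par2 1 ^ (3 * n) * s 1"
    by (simp add: numeral_2_eq_2)
  define al be where "al = ([:[:s 0:]:] :: bpoly4)" and "be = ([:[:s 1:]:] :: bpoly4)"
  \<comment> \<open>The error made by replacing \<open>z = x + y + t\<close> with
    \<open>x + y\<close>; it lies in \<open>(t, w)\<close> and becomes the coefficient of
    \<open>w ^ (3 * n)\<close>.\<close>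
  define ga where "ga = x ^ (2 * n) * y ^ (2 * n) * z ^ (2 * n) - (x ^ (3 * n) * al + y ^ (3 * n) * be)"
  have o: "at_origin2 x = par2 0" "at_origin2 y = par2 1" "at_origin2 z = par2 0 + par2 1" "at_origin2 w = 0"
    unfolding x_def y_def z_def w_def at_origin2_par4 par2_simps by simp_all
  have ga: "ga \<in> idlP"
    unfolding idlP_def mem_Collect_eq ga_def at_origin2_simps o s by (simp add: al_def be_def)
  have w: "w ^ m * p \<in> idlP" if "m \<ge> 1" for m p using that by (simp add: idlP_def o power_0_left)
  have xyz: "x ^ (2 * n) * y ^ (2 * n) * z ^ (2 * n) = x ^ (3 * n) * al + y ^ (3 * n) * be + ga"
    by (simp add: ga_def)
  define v where "v i = (if i = 0 then w ^ (2 * n) * (y ^ (2 * n) * z ^ (2 * n) * r 0) + w ^ (3 * n) * (al * r 3)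
    else if i = 1 then w ^ (2 * n) * (x ^ (2 * n) * z ^ (2 * n) * r 1) + w ^ (3 * n) * (be * r 3)
    else if i = 2 then w ^ (2 * n) * (x ^ (2 * n) * y ^ (2 * n) * r 2) else ga * r 3)" for i :: nat
  have "v i \<in> idlP" for i
    unfolding v_def using n is_idealD(2)[OF is_ideal_idlP] w is_idealD(4)[OF is_ideal_idlP ga] by simp
  moreover have "(\<Prod>i<4. par4 i) ^ (2 * n) * a = (\<Sum>i<4. par4 i ^ (3 * n) * v i)"
  proof -
    have p3: "u ^ (3 * n) = u ^ (2 * n) * u ^ n" for u :: bpoly4 by (simp add: power_add[symmetric])
    have "(\<Sum>i<4. par4 i ^ (3 * n) * v i) = x ^ (3 * n) * v 0 + y ^ (3 * n) * v 1 + z ^ (3 * n) * v 2 + w ^ (3 * n) * v 3"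
      by (simp add: eval_nat_numeral x_def y_def z_def w_def)
    also have "\<dots> = x ^ (3 * n) * (w ^ (2 * n) * (y ^ (2 * n) * z ^ (2 * n) * r 0))
      + y ^ (3 * n) * (w ^ (2 * n) * (x ^ (2 * n) * z ^ (2 * n) * r 1))
      + z ^ (3 * n) * (w ^ (2 * n) * (x ^ (2 * n) * y ^ (2 * n) * r 2))
      + w ^ (3 * n) * r 3 * (x ^ (3 * n) * al + y ^ (3 * n) * be + ga)"
      by (simp add: v_def algebra_simps)
    also have "\<dots> = (x * y * z * w) ^ (2 * n) * a"
      unfolding xyz[symmetric] unfolding r p3 power_mult_distrib by (simp only: algebra_simps)
    finally show ?thesis unfolding pr ..
  qed
  ultimately show ?thesis by blast
qed

text \<open>For fixed \<open>e\<close> the values follow one polynomial \<open>S e\<close> at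
  infinitely many arguments; by pigeonhole some member of \<open>Ps\<close> agrees with it
  infinitely often, hence equals it. The polynomials \<open>S e\<close> with
  \<open>e \<ge> 2\<close> are distinct, so \<open>Ps\<close> would be infinite.\<close>

lemma not_finitely_many_polys:
  fixes J :: "nat \<Rightarrow> real" and c :: real
  assumes J: "\<And>e f n. e \<ge> 1 \<Longrightarrow> n = (2 ^ e - 1) * 2 ^ f \<Longrightarrow>
    J n = real n ^ 4 * c - real (n ^ 4 + (n - 2 ^ f) * 2 ^ f - n * n)"
  shows "\<not> (\<exists>Ps :: real poly set. finite Ps \<and> (\<forall>n::nat \<ge> 1. \<exists>P \<in> Ps. J n = poly P (real n)))"
proof
  assume "\<exists>Ps :: real poly set. finite Ps \<and> (\<forall>n::nat \<ge> 1. \<exists>P \<in> Ps. J n = poly P (real n))"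
  then obtain Ps where fin: "finite Ps" and Ps: "\<And>n::nat. n \<ge> 1 \<Longrightarrow> \<exists>P \<in> Ps. J n = poly P (real n)" by blast
  define N where "N e = (2 ^ e - 1 :: real)" for e :: nat
  \<comment> \<open>Substituting \<open>q = n / N e\<close> in \<open>n ^ 2 - (n - q) * q\<close>
    gives the coefficient of \<open>n ^ 2\<close>.\<close>
  define S where "S e = (monom (c - 1) 4 + monom ((N e ^ 2 - N e + 1) / N e ^ 2) 2 :: real poly)" for e
  have NJ: "J ((2 ^ e - 1) * 2 ^ f) = poly (S e) (N e * 2 ^ f)" "real ((2 ^ e - 1) * 2 ^ f) = N e * 2 ^ f"
    if e: "e \<ge> 1" for e f
  proof -
    define n q :: nat where "n = (2 ^ e - 1) * 2 ^ f" and "q = 2 ^ f"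
    have e2: "(2::nat) ^ e \<ge> 2" using e power_increasing[of 1 e "2::nat"] by simp
    have n: "real n = N e * real q" using e2 by (simp add: n_def q_def N_def of_nat_diff)
    then show "real ((2 ^ e - 1) * 2 ^ f) = N e * 2 ^ f" by (simp add: n_def q_def)
    have nq: "q \<le> n" using e2 by (simp add: n_def q_def)
    have "n * n \<le> n ^ 4" by (cases "n = 0") (simp_all add: eval_nat_numeral)
    then have "real (n ^ 4 + (n - q) * q - n * n) = real n ^ 4 + (real n - real q) * real q - real n * real n"
      using nq by (simp add: of_nat_diff trans_le_add1)
    then have "J n = real n ^ 4 * c - (real n ^ 4 + (real n - real q) * real q - real n * real n)"
      using J[OF e n_def] by (simp add: q_def)
    also have "\<dots> = (c - 1) * real n ^ 4 + (N e ^ 2 - N e + 1) * real q ^ 2"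
      unfolding n by (simp add: algebra_simps power2_eq_square)
    also have "\<dots> = poly (S e) (N e * real q)"
    proof -
      have "(2::real) ^ e \<ge> 2" using e2 by (metis of_nat_le_iff of_nat_numeral of_nat_power)
      then have "N e \<noteq> 0" by (auto simp: N_def)
      then show ?thesis unfolding n by (simp add: S_def poly_monom power_mult_distrib)
    qed
    finally show "J ((2 ^ e - 1) * 2 ^ f) = poly (S e) (N e * 2 ^ f)" by (simp add: n_def q_def)
  qed
  have "S e \<in> Ps" if e: "e \<ge> 1" for e
  proof -
    have N: "N e > 0" using e by (simp add: N_def)
    have "\<exists>P\<in>Ps. poly (S e) (N e * 2 ^ f) = poly P (N e * 2 ^ f)" for f
    proof -
      have "(2::nat) ^ e \<ge> 2" using e power_increasing[of 1 e "2::nat"] by simp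
      then show ?thesis using Ps[of "(2 ^ e - 1) * 2 ^ f"] NJ[OF e, of f] by simp
    qed
    then obtain P where P: "\<And>f. P f \<in> Ps" "\<And>f. poly (S e) (N e * 2 ^ f) = poly (P f) (N e * 2 ^ f)" by metis
    have "finite (range P)" by (rule finite_subset[OF _ fin]) (use P(1) in auto)
    then obtain f0 where inf: "infinite {f. P f = P f0}"
      using pigeonhole_infinite[of UNIV P] by auto
    have "S e - P f0 = 0"
    proof (rule ccontr)
      assume "S e - P f0 \<noteq> 0"
      then have "finite {t. poly (S e - P f0) t = 0}" by (rule poly_roots_finite)
      moreover have "(\<lambda>f. N e * 2 ^ f) ` {f. P f = P f0} \<subseteq> {t. poly (S e - P f0) t = 0}"
      proof clarify
        fix f assume "P f = P f0"
        then show "poly (S e - P f0) (N e * 2 ^ f) = 0" using P(2)[of f] by simp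
      qed
      ultimately have "finite ((\<lambda>f. N e * 2 ^ f) ` {f. P f = P f0})" using finite_subset by blast
      moreover have "inj_on (\<lambda>f. N e * 2 ^ f) {f. P f = P f0}" using N by (intro inj_onI) simp
      ultimately show False using inf finite_imageD by blast
    qed
    then show ?thesis using P(1)[of f0] by simp
  qed
  then have "S ` {2..} \<subseteq> Ps" by auto
  then have "finite (S ` {2..})" using fin finite_subset by blast
  moreover have "inj_on S {2..}"
  proof (rule inj_onI)
    fix e e' assume e: "e \<in> {2..}" "e' \<in> {2..}" and "S e = S e'"
    then have "coeff (S e) 2 = coeff (S e') 2" by simp
    then have eq: "(N e ^ 2 - N e + 1) / N e ^ 2 = (N e' ^ 2 - N e' + 1) / N e' ^ 2" by (simp add: S_def)
    have N3: "N k \<ge> 3" if "k \<ge> 2" for k using power_increasing[OF that, of "2::real"] by (simp add: N_def)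
    have n: "N e \<ge> 3" "N e' \<ge> 3" using N3 e by auto
    then have "(N e ^ 2 - N e + 1) * N e' ^ 2 = (N e' ^ 2 - N e' + 1) * N e ^ 2"
      using eq by (simp add: field_simps)
    \<comment> \<open>With \<open>u = 1 / N e\<close> the coefficient is
      \<open>1 - u + u ^ 2\<close>. Equal values mean equal \<open>u\<close> or a pair with sum
      \<open>1\<close>; the latter is excluded because both are at most
      \<open>1 / 3\<close>.\<close>
    then have "(N e' - N e) * (N e + N e' - N e * N e') = 0" by (simp add: algebra_simps power2_eq_square)
    moreover have "N e * N e' \<ge> 3 * N e'" "N e * N e' \<ge> N e * 3" using n by (auto intro: mult_right_mono mult_left_mono)
    then have "N e + N e' - N e * N e' < 0" using n by linarith
    ultimately have "N e = N e'" by simp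
    then show "e = e'" by (simp add: N_def)
  qed
  ultimately have "finite {2::nat..}" using finite_imageD by blast
  then show False using infinite_Ici by blast
qed

theorem theorem5p2:
  shows "\<exists>(R :: nat set ring) (m :: nat set set) (d :: nat) (x :: nat \<Rightarrow> nat set)
            (M :: (nat set, nat set) module).
     noetherian_local_ring R m \<and> krull_dim R = enat d \<and>
     (\<forall>i<d. x i \<in> carrier R) \<and> m = genideal R (x ` {..<d}) \<and>
     module R M \<and> finitely_generated R M \<and> module_dim R M = enat d \<and>
     \<not> (\<exists>Ps :: real poly set. finite Ps \<and>
          (\<forall>n::nat \<ge> 1. \<exists>P \<in> Ps. J_fun R M d x n = poly P (real n)))"
proof -
  obtain h :: "bpoly4 fract \<Rightarrow> nat set" where h: "inj h" using ex_inj_nat_set by blast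
  define g where "g = the_inv h"
  interpret loc: localized_domain ev4 h g par4 4
  proof
    show "g (h z) = z" for z unfolding g_def by (rule the_inv_f_f[OF h])
  qed (use ev4_simps ker_ev4 fin_gen_ideal_bpoly4 in auto)
  let ?R = "ring_on h g loc.L" and ?M = "module_on h g (loc.ext idlP)"
  let ?x = "\<lambda>i. h (Fract (par4 i) 1)"
  note I = loc.lideal_ext[OF is_ideal_idlP]
  have dim: "krull_dim ?R = enat 4"
    using bpoly4_chain_le chain4_prime chain4_strict chain4_ker by (rule loc.krull_dim_R)
  have "[:0, 1:] \<in> idlP" by (simp add: idlP_def at_origin2_def)
  then have mdim: "module_dim ?R ?M = enat 4" using loc.module_dim_M[of "[:0, 1:]"] dim by simp
  \<comment> \<open>The multiplicity does not depend on \<open>n\<close>, so it serves as the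
    constant \<open>c\<close> of \<open>not_finitely_many_polys\<close>, whatever its value.\<close>
  have J: "J_fun ?R ?M 4 ?x n = real n ^ 4 * multiplicity ?R ?M 4 ?x -
      real (n ^ 4 + (n - 2 ^ f) * 2 ^ f - n * n)"
    if e: "e \<ge> 1" and n: "n = (2 ^ e - 1) * 2 ^ f" for e f n
  proof -
    let ?Q = "gen (\<lambda>i. par4 i ^ n) 4"
    have "(2::nat) ^ e \<ge> 2" using e power_increasing[of 1 e "2::nat"] by simp
    then have n1: "n \<ge> 1" by (simp add: n)
    have lc: "lim_closure ?R ?M 4 (\<lambda>i. ?x i [^]\<^bsub>?R\<^esub> n) = h ` (loc.ext idlP \<inter> loc.ext ?Q)"
      by (rule loc.lim_closure_M[OF is_ideal_idlP power_regular_par4 par4_witness[OF n1]])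
    have "quot_length ?R ?M (h ` (loc.ext idlP \<inter> loc.ext ?Q)) = enat (n ^ 4 + (n - 2 ^ f) * 2 ^ f - n * n)"
    proof (rule loc.quot_length_M[OF is_ideal_idlP])
      show "loc.lideal (loc.ext idlP \<inter> loc.ext ?Q)"
        by (intro loc.lideal_Int I loc.lideal_ext is_ideal_gen)
      show "ncls (loc.ext idlP) (loc.ext idlP \<inter> loc.ext ?Q) = 2 ^ (n ^ 4 + (n - 2 ^ f) * 2 ^ f - n * n)"
        unfolding loc.ncls_ext[OF is_ideal_idlP] by (rule ncls_idlP[OF e n])
      fix i :: nat and u assume i: "i < 4" and u: "u \<in> loc.ext idlP"
      have "Fract (par4 i) 1 ^ n * u \<in> loc.ext idlP"
        using loc.lidealD(4)[OF I loc.Lpow[OF loc.iota_L] u] .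
      moreover have "u * Fract (par4 i) 1 ^ n \<in> loc.ext ?Q"
        unfolding loc.iota_pow using loc.lidealD(1)[OF I u] gen_mem[OF i, of "\<lambda>i. par4 i ^ n"]
        by (intro loc.lidealD(4)[OF loc.lideal_ext[OF is_ideal_gen]] loc.iota_ext)
      ultimately show "\<exists>a. Fract (par4 i) 1 ^ a * u \<in> loc.ext idlP \<inter> loc.ext ?Q"
        by (intro exI[of _ n]) (simp add: mult.commute)
    qed simp
    then show ?thesis unfolding J_fun_def lc by simp
  qed
  have "noetherian_local_ring ?R (h ` loc.mL)"
    unfolding noetherian_local_ring_def using loc.noetherian_R loc.local_ring_R by blast
  moreover have "\<forall>i<4. ?x i \<in> carrier ?R" by simp
  moreover have "h ` loc.mL = genideal ?R (?x ` {..<4})" by (rule loc.mL_genideal)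
  moreover have "module ?R ?M" by (rule loc.module_M[OF I])
  moreover have "finitely_generated ?R ?M" by (rule loc.finitely_generated_M[OF is_ideal_idlP])
  moreover note not_finitely_many_polys[OF J]
  ultimately show ?thesis using dim mdim
    by (intro exI[of _ ?R] exI[of _ "h ` loc.mL"] exI[of _ 4] exI[of _ ?x] exI[of _ ?M] conjI)
qed

end
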